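(* Let $G$ be a compact group with $\widehat G$ at most countable and $z:G\to\mathbb C\setminus\{0\}$ a continuous central function. Define $\varphi_z:\mathbb Y(\widehat G)\to\mathbb R_{\ge0}$ by $\varphi_z(\Lambda)=M^{(n)}_z(\Lambda)/\operatorname{DIM}\Lambda$ for $\Lambda\in\mathbb Y_n(\widehat G)$ (with $\varphi_z(\emptyset)=1$), where $$M^{(n)}_z(\Lambda)=\frac{n!}{(I)_n}\prod_{\zeta\in\widehat G}\prod_{\Box\in\Lambda(\zeta)}\frac{(\alpha(\zeta)+c(\Box))(\overline{\alpha(\zeta)}+c(\Box))}{h(\Box)^2},\qquad \operatorname{DIM}\Lambda=n!\prod_{\zeta\in\widehat G}(\dim\zeta)^{|\Lambda(\zeta)|}\frac{\dim\Lambda(\zeta)}{|\Lambda(\zeta)|!}.$$ Then $\varphi_z$ is harmonic on the branching graph $\mathbb Y(\widehat G)$, i.e. for every $n\ge1$ and every $M\in\mathbb Y_{n-1}(\widehat G)$, $$\varphi_z(M)=\sum_{\Lambda\in\mathbb Y_n(\widehat G):\,M\nearrow\Lambda}\dim(\zeta_{M,\Lambda})\,\varphi_z(\Lambda).$$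
   Context: $G$ compact with normalized Haar measure $\mu_G$; $\widehat G$ its continuous irreducible unitary representations, $\dim\zeta$ the dimension of $\zeta\in\widehat G$, $\chi^{\pi^\zeta}$ its character. $I=\int_G|z|^2d\mu_G$, $(I)_n=I(I+1)\cdots(I+n-1)$, $\alpha(\zeta)=\int_G z\,\overline{\chi^{\pi^\zeta}}\,d\mu_G$. $\mathbb Y_n(\widehat G)$ is the set of maps $\Lambda$ from $\widehat G$ to Young diagrams with $\sum_\zeta|\Lambda(\zeta)|=n$; $\mathbb Y_0(\widehat G)=\{\emptyset\}$; $\mathbb Y(\widehat G)=\bigsqcup_{n\ge0}\mathbb Y_n(\widehat G)$. For a Young diagram $\lambda$, $\dim\lambda$ is the dimension of the irreducible representation of $S_{|\lambda|}$ labelled by $\lambda$ (number of standard tableaux); for a box $\Box=(i,j)$, $c(\Box)=j-i$, $h(\Box)=\lambda_i-i+\lambda'_j-j+1$. $M\nearrow\Lambda$ ($M\in\mathbb Y_{n-1}(\widehat G)$, $\Lambda\in\mathbb Y_n(\widehat G)$) means there is a (unique) $\zeta_{M,\Lambda}\in\widehat G$ such that $\Lambda(\zeta_{M,\Lambda})$ is obtained from $M(\zeta_{M,\Lambda})$ by adding one box and $\Lambda(\zeta)=M(\zeta)$ for $\zeta\ne\zeta_{M,\Lambda}$. *)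

theory Defs
  imports "HOL-Analysis.Analysis" "HOL-Algebra.Group" "HOL-Library.FuncSet"
begin

definition compact_group :: "('g, 'b) monoid_scheme \<Rightarrow> 'g topology \<Rightarrow> bool" where
  "compact_group G T \<longleftrightarrow> group G \<and> topspace T = carrier G \<and> compact_space T
     \<and> Hausdorff_space T
     \<and> continuous_map (prod_topology T T) T (\<lambda>(x, y). x \<otimes>\<^bsub>G\<^esub> y)
     \<and> continuous_map T T (\<lambda>x. inv\<^bsub>G\<^esub> x)"

definition normalized_haar :: "('g, 'b) monoid_scheme \<Rightarrow> 'g topology \<Rightarrow> 'g measure \<Rightarrow> bool" where
  "normalized_haar G T \<mu> \<longleftrightarrow> emeasure \<mu> (space \<mu>) = 1 \<and> space \<mu> = carrier G
     \<and> sets \<mu> = sigma_sets (topspace T) {U. openin T U}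
     \<and> (\<forall>g \<in> carrier G. \<forall>A \<in> sets \<mu>. (\<lambda>x. g \<otimes>\<^bsub>G\<^esub> x) ` A \<in> sets \<mu>
            \<and> measure \<mu> ((\<lambda>x. g \<otimes>\<^bsub>G\<^esub> x) ` A) = measure \<mu> A)"

text \<open>A representation of dimension d is a pair (d, \<pi>) where \<pi> g is a d x d complex
matrix, given as a function nat \<Rightarrow> nat \<Rightarrow> complex (only entries with indices < d matter).\<close>

type_synonym 'g rep = "nat \<times> ('g \<Rightarrow> nat \<Rightarrow> nat \<Rightarrow> complex)"

definition mat_mult :: "nat \<Rightarrow> (nat \<Rightarrow> nat \<Rightarrow> complex) \<Rightarrow> (nat \<Rightarrow> nat \<Rightarrow> complex) \<Rightarrow> nat \<Rightarrow> nat \<Rightarrow> complex" where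
  "mat_mult d A B = (\<lambda>i j. \<Sum>k<d. A i k * B k j)"

definition mat_vec :: "nat \<Rightarrow> (nat \<Rightarrow> nat \<Rightarrow> complex) \<Rightarrow> (nat \<Rightarrow> complex) \<Rightarrow> nat \<Rightarrow> complex" where
  "mat_vec d A v = (\<lambda>i. if i < d then (\<Sum>k<d. A i k * v k) else 0)"

definition is_unitary :: "nat \<Rightarrow> (nat \<Rightarrow> nat \<Rightarrow> complex) \<Rightarrow> bool" where
  "is_unitary d A \<longleftrightarrow> (\<forall>i<d. \<forall>j<d. (\<Sum>k<d. A i k * cnj (A j k)) = (if i = j then 1 else 0))"

definition unitary_rep :: "('g, 'b) monoid_scheme \<Rightarrow> 'g topology \<Rightarrow> 'g rep \<Rightarrow> bool" where
  "unitary_rep G T r \<longleftrightarrow> (case r of (d, \<pi>) \<Rightarrow>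
      (\<forall>g \<in> carrier G. is_unitary d (\<pi> g))
    \<and> (\<forall>g \<in> carrier G. \<forall>h \<in> carrier G. \<forall>i<d. \<forall>j<d.
          \<pi> (g \<otimes>\<^bsub>G\<^esub> h) i j = mat_mult d (\<pi> g) (\<pi> h) i j)
    \<and> (\<forall>i<d. \<forall>j<d. continuous_map T euclidean (\<lambda>g. \<pi> g i j)))"

definition cvecs :: "nat \<Rightarrow> (nat \<Rightarrow> complex) set" where
  "cvecs d = {v. \<forall>i\<ge>d. v i = 0}"

definition csubspace :: "nat \<Rightarrow> (nat \<Rightarrow> complex) set \<Rightarrow> bool" where
  "csubspace d W \<longleftrightarrow> W \<subseteq> cvecs d \<and> (\<lambda>_. 0) \<in> W
     \<and> (\<forall>v\<in>W. \<forall>w\<in>W. (\<lambda>i. v i + w i) \<in> W) \<and> (\<forall>c. \<forall>v\<in>W. (\<lambda>i. c * v i) \<in> W)"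

definition irreducible_rep :: "('g, 'b) monoid_scheme \<Rightarrow> 'g topology \<Rightarrow> 'g rep \<Rightarrow> bool" where
  "irreducible_rep G T r \<longleftrightarrow> unitary_rep G T r \<and> (case r of (d, \<pi>) \<Rightarrow> d \<ge> 1 \<and>
     (\<forall>W. csubspace d W \<and> (\<forall>g\<in>carrier G. \<forall>v\<in>W. mat_vec d (\<pi> g) v \<in> W)
          \<longrightarrow> W = {\<lambda>_. 0} \<or> W = cvecs d))"

definition rep_equiv :: "('g, 'b) monoid_scheme \<Rightarrow> 'g rep \<Rightarrow> 'g rep \<Rightarrow> bool" where
  "rep_equiv G r s \<longleftrightarrow> fst r = fst s \<and> (\<exists>U. is_unitary (fst r) U \<and>
     (\<forall>g\<in>carrier G. \<forall>i<fst r. \<forall>j<fst r.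
        mat_mult (fst r) U (snd r g) i j = mat_mult (fst r) (snd s g) U i j))"

definition unitary_dual :: "('g, 'b) monoid_scheme \<Rightarrow> 'g topology \<Rightarrow> 'g rep set set" where
  "unitary_dual G T = {{s. irreducible_rep G T s \<and> rep_equiv G r s} | r. irreducible_rep G T r}"

definition rep_of :: "'g rep set \<Rightarrow> 'g rep" where
  "rep_of \<zeta> = (SOME r. r \<in> \<zeta>)"

definition dim_class :: "'g rep set \<Rightarrow> nat" where
  "dim_class \<zeta> = fst (rep_of \<zeta>)"

definition character :: "'g rep set \<Rightarrow> 'g \<Rightarrow> complex" where
  "character \<zeta> g = (\<Sum>i<fst (rep_of \<zeta>). snd (rep_of \<zeta>) g i i)"

definition I_z :: "'g measure \<Rightarrow> ('g \<Rightarrow> complex) \<Rightarrow> real" where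
  "I_z \<mu> z = integral\<^sup>L \<mu> (\<lambda>g. (cmod (z g))\<^sup>2)"

definition alpha_z :: "'g measure \<Rightarrow> ('g \<Rightarrow> complex) \<Rightarrow> 'g rep set \<Rightarrow> complex" where
  "alpha_z \<mu> z \<zeta> = integral\<^sup>L \<mu> (\<lambda>g. z g * cnj (character \<zeta> g))"

definition young :: "nat list \<Rightarrow> bool" where
  "young lam \<longleftrightarrow> sorted_wrt (\<ge>) lam \<and> 0 \<notin> set lam"

definition ysize :: "nat list \<Rightarrow> nat" where
  "ysize lam = sum_list lam"

definition boxes :: "nat list \<Rightarrow> (nat \<times> nat) set" where
  "boxes lam = {(i, j). 1 \<le> i \<and> i \<le> length lam \<and> 1 \<le> j \<and> j \<le> lam ! (i - 1)}"

definition row_len :: "nat list \<Rightarrow> nat \<Rightarrow> nat" where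
  "row_len lam i = (if 1 \<le> i \<and> i \<le> length lam then lam ! (i - 1) else 0)"

definition col_len :: "nat list \<Rightarrow> nat \<Rightarrow> nat" where
  "col_len lam j = card {i. 1 \<le> i \<and> i \<le> length lam \<and> j \<le> lam ! (i - 1)}"

definition content :: "nat \<times> nat \<Rightarrow> int" where
  "content b = int (snd b) - int (fst b)"

definition hook :: "nat list \<Rightarrow> nat \<times> nat \<Rightarrow> int" where
  "hook lam b = int (row_len lam (fst b)) - int (fst b) + int (col_len lam (snd b)) - int (snd b) + 1"

definition standard_tableaux :: "nat list \<Rightarrow> (nat \<times> nat \<Rightarrow> nat) set" where
  "standard_tableaux lam = {T \<in> boxes lam \<rightarrow>\<^sub>E {1..ysize lam}. bij_betw T (boxes lam) {1..ysize lam}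
      \<and> (\<forall>i j. (i, j) \<in> boxes lam \<and> (i, j + 1) \<in> boxes lam \<longrightarrow> T (i, j) < T (i, j + 1))
      \<and> (\<forall>i j. (i, j) \<in> boxes lam \<and> (i + 1, j) \<in> boxes lam \<longrightarrow> T (i, j) < T (i + 1, j))}"

definition dim_young :: "nat list \<Rightarrow> nat" where
  "dim_young lam = card (standard_tableaux lam)"

definition add_box :: "nat list \<Rightarrow> nat list \<Rightarrow> bool" where
  "add_box \<mu> lam \<longleftrightarrow> boxes \<mu> \<subseteq> boxes lam \<and> card (boxes lam) = card (boxes \<mu>) + 1"

definition ysupp :: "('c \<Rightarrow> nat list) \<Rightarrow> 'c set" where
  "ysupp \<Lambda> = {\<zeta>. \<Lambda> \<zeta> \<noteq> []}"

definition Yn :: "'c set \<Rightarrow> nat \<Rightarrow> ('c \<Rightarrow> nat list) set" where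
  "Yn D n = {\<Lambda>. (\<forall>\<zeta>. \<zeta> \<notin> D \<longrightarrow> \<Lambda> \<zeta> = []) \<and> (\<forall>\<zeta>\<in>D. young (\<Lambda> \<zeta>))
     \<and> finite (ysupp \<Lambda>) \<and> (\<Sum>\<zeta>\<in>ysupp \<Lambda>. ysize (\<Lambda> \<zeta>)) = n}"

definition Ytotal :: "('c \<Rightarrow> nat list) \<Rightarrow> nat" where
  "Ytotal \<Lambda> = (\<Sum>\<zeta>\<in>ysupp \<Lambda>. ysize (\<Lambda> \<zeta>))"

definition Yedge :: "'c set \<Rightarrow> ('c \<Rightarrow> nat list) \<Rightarrow> ('c \<Rightarrow> nat list) \<Rightarrow> bool" where
  "Yedge D M \<Lambda> \<longleftrightarrow> (\<exists>\<zeta>\<in>D. add_box (M \<zeta>) (\<Lambda> \<zeta>) \<and> (\<forall>\<eta>. \<eta> \<noteq> \<zeta> \<longrightarrow> \<Lambda> \<eta> = M \<eta>))"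

definition edge_label :: "('c \<Rightarrow> nat list) \<Rightarrow> ('c \<Rightarrow> nat list) \<Rightarrow> 'c" where
  "edge_label M \<Lambda> = (THE \<zeta>. add_box (M \<zeta>) (\<Lambda> \<zeta>))"

definition M_z :: "'g measure \<Rightarrow> ('g \<Rightarrow> complex) \<Rightarrow> ('g rep set \<Rightarrow> nat list) \<Rightarrow> complex" where
  "M_z \<mu> z \<Lambda> = of_real (fact (Ytotal \<Lambda>) / pochhammer (I_z \<mu> z) (Ytotal \<Lambda>)) *
     (\<Prod>\<zeta>\<in>ysupp \<Lambda>. \<Prod>b\<in>boxes (\<Lambda> \<zeta>).
        (alpha_z \<mu> z \<zeta> + of_int (content b)) * (cnj (alpha_z \<mu> z \<zeta>) + of_int (content b))
        / (of_int (hook (\<Lambda> \<zeta>) b))\<^sup>2)"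

definition DIM_Y :: "('g rep set \<Rightarrow> nat list) \<Rightarrow> real" where
  "DIM_Y \<Lambda> = fact (Ytotal \<Lambda>) * (\<Prod>\<zeta>\<in>ysupp \<Lambda>.
      real (dim_class \<zeta>) ^ ysize (\<Lambda> \<zeta>) * real (dim_young (\<Lambda> \<zeta>)) / fact (ysize (\<Lambda> \<zeta>)))"

definition phi_z :: "'g measure \<Rightarrow> ('g \<Rightarrow> complex) \<Rightarrow> ('g rep set \<Rightarrow> nat list) \<Rightarrow> complex" where
  "phi_z \<mu> z \<Lambda> = M_z \<mu> z \<Lambda> / of_real (DIM_Y \<Lambda>)"

end

theory Submission
  imports Defs "Jordan_Normal_Form.Spectral_Radius"
begin

text \<open>By the hook length formula, \<open>\<phi>\<^sub>z(\<Lambda>)\<close> is \<open>1 / (I)\<^sub>n\<close> times a product over \<open>\<zeta>\<close> of factors depending only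
  on \<open>\<Lambda>(\<zeta>)\<close>. Adding a box to \<open>M(\<zeta>)\<close> changes one factor, and Kerov's identities for the transition
  measure of the Young graph show that the boxes added at \<open>\<zeta>\<close> contribute in total
  \<open>\<bar>\<alpha>(\<zeta>)\<bar>\<^sup>2 + |M(\<zeta>)|\<close> times \<open>\<phi>\<^sub>z(M) / (I + n - 1)\<close>. Summing over \<open>\<zeta>\<close>, harmonicity is exactly Parseval's
  identity \<open>\<Sum>\<bar>\<alpha>(\<zeta>)\<bar>\<^sup>2 = I\<close> for the central function \<open>z\<close>.

  Parseval's identity is the completeness of the irreducible characters (Peter--Weyl). If \<open>k\<close> is continuous,
  central, Hermitian and orthogonal to all of them, but nonzero, then the even convolution powers of \<open>k\<close>,
  normalised by their growth rate, converge uniformly to a nonzero eigenfunction of convolution by \<open>k * k\<close>.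
  The eigenspace is finite-dimensional and right-invariant, so it contains an irreducible representation, on which
  Schur's lemma forces convolution by \<open>k\<close> to vanish.\<close>

section \<open>Hook lengths and the Young graph\<close>

text \<open>Kerov's identities are read off one rational function: for the beta-numbers
  \<open>x\<close> of a diagram, the product of \<open>1 + 1 / (u - x j)\<close> has residue
  \<open>shift_coeff x J i\<close> at \<open>x i\<close>, which up to a linear factor is the ratio
  of hook products along an edge. Its first coefficients at infinity and its zero at u = -1 give the
  sums over added boxes; with the sign of \<open>x\<close> reversed it gives the sum over removed
  boxes, hence the hook length formula.

  Parseval concerns a series, completeness a single continuous function. The bridge is the
  autocorrelation of \<open>z\<close>: its value at the identity is I, its coefficient at a
  character of degree d is |\<alpha>|^2 / d. The series of |\<alpha>|^2 / d times the character has
  the same coefficients and converges uniformly, as a character is bounded by its degree and Bessel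
  bounds the sum of |\<alpha>|^2.

  G need not be metrizable, so continuous kernels on G x G need an argument to be measurable for the
  product of the sigma-algebras. A vertex may have infinitely many edges; their unconditional sum
  can be grouped by \<zeta> because all terms are nonnegative multiples of one constant.\<close>

definition shift_coeff :: "('i \<Rightarrow> 'a::field) \<Rightarrow> 'i set \<Rightarrow> 'i \<Rightarrow> 'a" where
  "shift_coeff x J i = (\<Prod>j\<in>J - {i}. 1 + 1 / (x i - x j))"

lemma shift_coeff_insert:
  assumes "finite J" "y \<notin> J" "i \<in> J"
  shows "shift_coeff x (insert y J) i = shift_coeff x J i * (1 + 1 / (x i - x y))"
proof -
  have "insert y J - {i} = insert y (J - {i})" using assms by auto
  then show ?thesis using assms by (simp add: shift_coeff_def mult.commute)
qed

lemma shift_coeff_insert_self: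
  assumes "y \<notin> J"
  shows "shift_coeff x (insert y J) y = (\<Prod>j\<in>J. 1 + 1 / (x y - x j))"
  using assms by (simp add: shift_coeff_def)

text \<open>With p = u - x i and q = u - x y, so that p - q = x y - x i, this rewrites the old term
  with its new residue factor as the old term times 1 + 1 / q, minus the share that goes into the
  residue at the new pole.\<close>

lemma partial_fraction_step:
  fixes a :: "'a::field"
  assumes "p \<noteq> 0" "q \<noteq> 0" "p - q \<noteq> 0"
  shows "a * (1 + 1 / (q - p)) / p = a / p + a / p * (1 / q) - a / (p - q) * (1 / q)"
proof -
  have "1 / (q - p) = - (1 / (p - q))" by (metis minus_diff_eq minus_divide_right)
  then have "a * (1 + 1 / (q - p)) / p = a * (1 - 1 / (p - q)) / p" by simp
  also have "\<dots> = a / p + a / p * (1 / q) - a / (p - q) * (1 / q)"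
    using assms by (simp add: divide_simps) (simp add: algebra_simps)
  finally show ?thesis .
qed

text \<open>\<open>shift_coeff x J i\<close> is the residue at the simple pole \<open>x i\<close> of
  the product on the left, which tends to 1 at infinity. A new point y brings one more factor, and
  the residue at the new pole is the old product evaluated at \<open>x y\<close>. The induction
  hypothesis is therefore used both at u and at \<open>x y\<close>, which is why u is
  generalised.\<close>

lemma shift_coeff_partial_fractions:
  fixes x :: "'i \<Rightarrow> 'a::field"
  assumes "finite J" "inj_on x J" "u \<notin> x ` J"
  shows "(\<Prod>j\<in>J. 1 + 1 / (u - x j)) = 1 + (\<Sum>i\<in>J. shift_coeff x J i / (u - x i))"
  using assms
proof (induction J arbitrary: u rule: finite_induct)
  case empty
  then show ?case by simp
next
  case (insert y J)
  have inj: "inj_on x J" and xy: "x y \<notin> x ` J" and u: "u \<notin> x ` J" "u \<noteq> x y"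
    using insert.prems insert.hyps by auto
  let ?A = "shift_coeff x J"
  have e: "?A i * (1 + 1 / (x i - x y)) / (u - x i) =
      ?A i / (u - x i) + ?A i / (u - x i) * (1 / (u - x y)) - ?A i / (x y - x i) * (1 / (u - x y))"
    if "i \<in> J" for i
  proof -
    have "x i \<noteq> x y" "u \<noteq> x i" using that xy u by (metis imageI)+
    then have "u - x i \<noteq> 0" "u - x y \<noteq> 0" "(u - x i) - (u - x y) \<noteq> 0" using u by auto
    then show ?thesis
      using partial_fraction_step[of "u - x i" "u - x y" "?A i"] by simp
  qed
  have "(\<Sum>i\<in>insert y J. shift_coeff x (insert y J) i / (u - x i)) =
      (\<Prod>j\<in>J. 1 + 1 / (x y - x j)) / (u - x y) + (\<Sum>i\<in>J. ?A i * (1 + 1 / (x i - x y)) / (u - x i))"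
    using insert.hyps by (simp add: shift_coeff_insert shift_coeff_insert_self)
  also have "(\<Sum>i\<in>J. ?A i * (1 + 1 / (x i - x y)) / (u - x i)) =
     (\<Sum>i\<in>J. ?A i / (u - x i)) + (\<Sum>i\<in>J. ?A i / (u - x i)) * (1 / (u - x y))
      - (\<Sum>i\<in>J. ?A i / (x y - x i)) * (1 / (u - x y))"
    by (simp only: e sum.distrib sum_subtractf sum_distrib_right cong: sum.cong)
  also have "(\<Prod>j\<in>J. 1 + 1 / (x y - x j)) = 1 + (\<Sum>i\<in>J. ?A i / (x y - x i))"
    by (rule insert.IH[OF inj xy])
  finally have "1 + (\<Sum>i\<in>insert y J. shift_coeff x (insert y J) i / (u - x i))
      = (1 + 1 / (u - x y)) * (1 + (\<Sum>i\<in>J. ?A i / (u - x i)))"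
    by (simp add: field_simps add_divide_distrib)
  also have "\<dots> = (\<Prod>j\<in>insert y J. 1 + 1 / (u - x j))"
    using insert.hyps by (simp add: insert.IH[OF inj u(1)])
  finally show ?case by simp
qed

text \<open>The coefficient of 1 / u at infinity in the partial fraction expansion: each of the
  \<open>card J\<close> factors contributes one.\<close>

lemma shift_coeff_sum:
  fixes x :: "'i \<Rightarrow> 'a::field"
  assumes "finite J" "inj_on x J"
  shows "(\<Sum>i\<in>J. shift_coeff x J i) = of_nat (card J)"
  using assms
proof (induction J rule: finite_induct)
  case (insert y J)
  have inj: "inj_on x J" and xy: "x y \<notin> x ` J"
    using insert.prems insert.hyps by auto
  let ?A = "shift_coeff x J"
  have e: "?A i * (1 + 1 / (x i - x y)) = ?A i - ?A i / (x y - x i)" if "i \<in> J" for i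
  proof -
    have "x i \<noteq> x y" using that xy by (metis imageI)
    then have "x y - x i \<noteq> 0" "x i - x y \<noteq> 0" by auto
    then show ?thesis by (simp add: field_simps)
  qed
  have "(\<Sum>i\<in>insert y J. shift_coeff x (insert y J) i) =
      (\<Prod>j\<in>J. 1 + 1 / (x y - x j)) + (\<Sum>i\<in>J. ?A i * (1 + 1 / (x i - x y)))"
    using insert.hyps by (simp add: shift_coeff_insert shift_coeff_insert_self)
  also have "\<dots> = 1 + (\<Sum>i\<in>J. ?A i)"
    by (simp add: shift_coeff_partial_fractions[OF insert.hyps(1) inj xy] e sum_subtractf cong: sum.cong)
  finally show ?case using insert inj by simp
qed simp

text \<open>The coefficient of 1 / u^2 at infinity: \<open>x j\<close> from the expansion of each
  factor, and one for every pair of distinct factors, hence the binomial coefficient.\<close>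

lemma shift_coeff_weighted_sum:
  fixes x :: "'i \<Rightarrow> 'a::field_char_0"
  assumes "finite J" "inj_on x J"
  shows "(\<Sum>i\<in>J. shift_coeff x J i * x i) = (\<Sum>i\<in>J. x i) + of_nat (card J) * (of_nat (card J) - 1) / 2"
  using assms
proof (induction J rule: finite_induct)
  case (insert y J)
  have inj: "inj_on x J" and xy: "x y \<notin> x ` J"
    using insert.prems insert.hyps by auto
  let ?A = "shift_coeff x J"
  have e: "?A i * (1 + 1 / (x i - x y)) * x i = ?A i * x i + ?A i - x y * (?A i / (x y - x i))" if "i \<in> J" for i
  proof -
    have "x i \<noteq> x y" using that xy by (metis imageI)
    then have "x y - x i \<noteq> 0" "x i - x y \<noteq> 0" by auto
    then show ?thesis by (simp add: field_simps)
  qed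
  have "(\<Sum>i\<in>insert y J. shift_coeff x (insert y J) i * x i) =
      (\<Prod>j\<in>J. 1 + 1 / (x y - x j)) * x y + (\<Sum>i\<in>J. ?A i * (1 + 1 / (x i - x y)) * x i)"
    using insert.hyps by (simp add: shift_coeff_insert shift_coeff_insert_self)
  also have "\<dots> = x y + (\<Sum>i\<in>J. ?A i * x i) + (\<Sum>i\<in>J. ?A i)"
    by (simp only: shift_coeff_partial_fractions[OF insert.hyps(1) inj xy] e sum_subtractf sum.distrib
        sum_distrib_left[symmetric] cong: sum.cong) (simp add: algebra_simps)
  also have "\<dots> = (\<Sum>i\<in>insert y J. x i) + of_nat (card (insert y J)) * (of_nat (card (insert y J)) - 1) / 2"
    using insert inj shift_coeff_sum[OF insert.hyps(1) inj] by (simp add: field_simps)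
  finally show ?case .
qed simp

text \<open>The partial fraction expansion at u = -1. The factor of the index with
  \<open>x k = 0\<close> is 1 + 1 / (-1) = 0 there, so the whole product vanishes. To have such an
  index, a diagram will be padded with one empty row.\<close>

lemma shift_coeff_reciprocal_sum:
  fixes x :: "'i \<Rightarrow> 'a::field"
  assumes "finite J" "inj_on x J" "0 \<in> x ` J" "-1 \<notin> x ` J"
  shows "(\<Sum>i\<in>J. shift_coeff x J i / (x i + 1)) = 1"
proof -
  obtain k where k: "k \<in> J" "x k = 0" using assms(3) by auto
  have "(\<Prod>j\<in>J. 1 + 1 / (-1 - x j)) = 0"
    using k assms(1) by (intro prod_zero) (auto intro!: bexI[of _ k])
  then have "1 + (\<Sum>i\<in>J. shift_coeff x J i / (-1 - x i)) = 0"
    using shift_coeff_partial_fractions[OF assms(1,2,4)] by simp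
  moreover have "shift_coeff x J i / (-1 - x i) = - (shift_coeff x J i / (x i + 1))" for i
    by (metis add.commute diff_conv_add_uminus minus_add_distrib minus_divide_right)
  ultimately show ?thesis by (simp add: sum_negf)
qed

section \<open>Young diagrams through their row lengths\<close>

lemma finite_boxes [simp]: "finite (boxes lam)"
proof -
  have "boxes lam \<subseteq> {0..length lam} \<times> {0..sum_list lam}"
    by (auto simp: boxes_def) (metis Suc_le_lessD diff_Suc_less elem_le_sum_list le_trans less_le_trans)
  then show ?thesis by (rule finite_subset) auto
qed

lemma mem_boxes_iff: "(i, j) \<in> boxes lam \<longleftrightarrow> 1 \<le> i \<and> 1 \<le> j \<and> j \<le> row_len lam i"
  by (auto simp: boxes_def row_len_def)

lemma row_len_0 [simp]: "row_len lam 0 = 0"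
  by (simp add: row_len_def)

lemma row_len_beyond: "length lam < i \<Longrightarrow> row_len lam i = 0"
  by (simp add: row_len_def)

lemma row_len_pos_iff:
  assumes "young lam"
  shows "0 < row_len lam i \<longleftrightarrow> 1 \<le> i \<and> i \<le> length lam"
proof -
  have "0 < lam ! (i - 1)" if "1 \<le> i" "i \<le> length lam"
    using that assms nth_mem[of "i - 1" lam] by (metis One_nat_def Suc_le_lessD diff_Suc_less
        gr0I less_le_trans young_def)
  then show ?thesis by (auto simp: row_len_def)
qed

lemma row_len_antimono:
  assumes "young lam" "1 \<le> i" "i \<le> k"
  shows "row_len lam k \<le> row_len lam i"
proof (cases "i = k")
  case False
  then show ?thesis
    using assms sorted_wrt_nth_less[of "(\<ge>)" lam "i - 1" "k - 1"] by (auto simp: row_len_def young_def)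
qed simp

lemma boxes_Sigma:
  assumes "length lam \<le> r"
  shows "boxes lam = (SIGMA i:{1..r}. {1..row_len lam i})"
  using assms by (auto simp: mem_boxes_iff row_len_def split: if_splits)

lemma ysize_eq_sum:
  assumes "length lam \<le> r"
  shows "ysize lam = (\<Sum>i=1..r. row_len lam i)"
proof -
  have "(\<Sum>i=1..r. row_len lam i) = (\<Sum>i=1..length lam. row_len lam i)"
    using assms by (intro sum.mono_neutral_right) (auto simp: row_len_def)
  also have "\<dots> = (\<Sum>i<length lam. lam ! i)"
    by (rule sum.reindex_bij_witness[of _ Suc "\<lambda>i. i - 1"]) (auto simp: row_len_def)
  finally show ?thesis
    by (simp add: ysize_def sum_list_sum_nth atLeast0LessThan)
qed

lemma card_boxes: "card (boxes lam) = ysize lam"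
  by (simp add: boxes_Sigma[OF order_refl] ysize_eq_sum[OF order_refl])

lemma row_len_inject:
  assumes "young lam" "young mu" "row_len lam = row_len mu"
  shows "lam = mu"
proof -
  have len: "length lam = length mu"
  proof (rule antisym)
    show "length lam \<le> length mu"
      using row_len_pos_iff[OF assms(1), of "length lam"] row_len_pos_iff[OF assms(2), of "length lam"] assms(3)
      by (cases "length lam") auto
    show "length mu \<le> length lam"
      using row_len_pos_iff[OF assms(1), of "length mu"] row_len_pos_iff[OF assms(2), of "length mu"] assms(3)
      by (cases "length mu") auto
  qed
  show ?thesis
  proof (rule nth_equalityI[OF len])
    fix i assume "i < length lam"
    then show "lam ! i = mu ! i"
      using fun_cong[OF assms(3), of "Suc i"] len by (simp add: row_len_def)
  qed
qed

text \<open>Boxes are added or removed by updating one value of the row-length function; this lemma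
  turns the updated function back into a list. The induction on the bound n discards empty rows
  until the last row is nonempty.\<close>

lemma ex_young_row_len:
  fixes R :: "nat \<Rightarrow> nat"
  assumes "R 0 = 0" "\<And>i k. 1 \<le> i \<Longrightarrow> i \<le> k \<Longrightarrow> R k \<le> R i" "\<And>i. n < i \<Longrightarrow> R i = 0"
  shows "\<exists>lam. young lam \<and> row_len lam = R"
  using assms(3)
proof (induction n)
  case 0
  then have "row_len [] = R" using assms(1)
    by (intro ext) (metis row_len_def bot_nat_0.not_eq_extremum le_zero_eq list.size(3) not_one_le_zero)
  then show ?case by (intro exI[of _ "[]"]) (auto simp: young_def)
next
  case (Suc n)
  show ?case
  proof (cases "R (Suc n) = 0")
    case True
    then show ?thesis using Suc by (metis Suc_lessI)
  next
    case False
    let ?l = "map R [1..<Suc (Suc n)]"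
    have "young ?l"
      unfolding young_def
    proof
      show "sorted_wrt (\<ge>) ?l"
        unfolding sorted_wrt_iff_nth_less
        by (auto simp del: upt_Suc intro!: assms(2))
      show "0 \<notin> set ?l"
        using assms(2)[of _ "Suc n"] False by (fastforce simp del: upt_Suc)
    qed
    moreover have "row_len ?l i = R i" for i
      using Suc.prems assms(1) by (auto simp: row_len_def simp del: upt_Suc) (cases i, auto)
    ultimately show ?thesis by blast
  qed
qed

text \<open>\<open>add_box\<close> compares box sets only. Every position of a row beyond its old
  length and up to its new one is an extra box; as there is exactly one extra box, one row grows by
  one and the others stay.\<close>

lemma add_box_iff:
  assumes "young lam" "young mu"
  shows "add_box lam mu \<longleftrightarrow> (\<exists>s\<ge>1. row_len mu = (row_len lam)(s := Suc (row_len lam s)))"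
proof
  assume "add_box lam mu"
  then have sub: "boxes lam \<subseteq> boxes mu" and "card (boxes mu - boxes lam) = 1"
    by (auto simp: add_box_def card_Diff_subset)
  then obtain b where b: "boxes mu - boxes lam = {b}" by (auto simp: card_1_singleton_iff)
  obtain s j where sj: "b = (s, j)" by (cases b)
  have bs: "1 \<le> s" "1 \<le> j" "j \<le> row_len mu s" "row_len lam s < j"
    using b sj mem_boxes_iff[of s j mu] mem_boxes_iff[of s j lam] by auto
  have le: "row_len lam i \<le> row_len mu i" for i
  proof (cases "row_len lam i = 0 \<or> i = 0")
    case False
    then have "(i, row_len lam i) \<in> boxes lam" by (auto simp: mem_boxes_iff)
    then have "(i, row_len lam i) \<in> boxes mu" using sub by blast
    then show ?thesis by (simp add: mem_boxes_iff)
  qed auto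
  have uniq: "i = s \<and> k = j" if "1 \<le> i" "row_len lam i < k" "k \<le> row_len mu i" for i k
  proof -
    have "(i, k) \<in> boxes mu - boxes lam" using that by (auto simp: mem_boxes_iff)
    then show ?thesis using b sj by auto
  qed
  have "row_len mu i = ((row_len lam)(s := Suc (row_len lam s))) i" for i
  proof (cases "i = s")
    case True
    have "row_len mu s = j" "Suc (row_len lam s) = j"
      using uniq[of s "row_len mu s"] uniq[of s "Suc (row_len lam s)"] bs by auto
    then show ?thesis using True by simp
  next
    case False
    then have "\<not> row_len lam i < row_len mu i" if "1 \<le> i" using uniq[OF that] by blast
    then show ?thesis using le[of i] False by (cases "i = 0") auto
  qed
  then show "\<exists>s\<ge>1. row_len mu = (row_len lam)(s := Suc (row_len lam s))"
    using bs(1) by blast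
next
  assume "\<exists>s\<ge>1. row_len mu = (row_len lam)(s := Suc (row_len lam s))"
  then obtain s where s: "1 \<le> s" "row_len mu = (row_len lam)(s := Suc (row_len lam s))" by blast
  have "boxes mu = insert (s, Suc (row_len lam s)) (boxes lam)"
    using s by (auto simp: mem_boxes_iff split: if_splits)
  moreover have "(s, Suc (row_len lam s)) \<notin> boxes lam" by (simp add: mem_boxes_iff)
  ultimately show "add_box lam mu" by (auto simp: add_box_def)
qed

lemma boxes_add:
  assumes "1 \<le> s" "row_len mu = (row_len lam)(s := Suc (row_len lam s))"
  shows "boxes mu = insert (s, Suc (row_len lam s)) (boxes lam)" "(s, Suc (row_len lam s)) \<notin> boxes lam"
  using assms by (auto simp: mem_boxes_iff split: if_splits)

section \<open>Beta-numbers and hook products\<close>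

lemma le_col_len_iff:
  assumes "young lam" "1 \<le> j" "1 \<le> k"
  shows "k \<le> col_len lam j \<longleftrightarrow> j \<le> row_len lam k"
proof -
  let ?S = "{i. 1 \<le> i \<and> i \<le> length lam \<and> j \<le> lam ! (i - 1)}"
  have S: "?S = {i. 1 \<le> i \<and> j \<le> row_len lam i}" using assms(2) by (auto simp: row_len_def)
  have fin: "finite ?S" by (rule finite_subset[of _ "{..length lam}"]) auto
  show ?thesis
  proof
    assume "j \<le> row_len lam k"
    then have "{1..k} \<subseteq> ?S" unfolding S using row_len_antimono[OF assms(1)] by (fastforce intro: order_trans)
    then show "k \<le> col_len lam j" using card_mono[OF fin, of "{1..k}"] by (simp add: col_len_def)
  next
    assume k: "k \<le> col_len lam j"
    show "j \<le> row_len lam k"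
    proof (rule ccontr)
      assume n: "\<not> j \<le> row_len lam k"
      have "?S \<subseteq> {1..<k}" unfolding S
      proof
        fix i assume i: "i \<in> {i. 1 \<le> i \<and> j \<le> row_len lam i}"
        have "i < k"
        proof (rule ccontr)
          assume "\<not> i < k"
          then show False using row_len_antimono[OF assms(1,3), of i] n i by simp
        qed
        then show "i \<in> {1..<k}" using i by simp
      qed
      then have "col_len lam j \<le> k - 1" using card_mono[of "{1..<k}" ?S] by (simp add: col_len_def)
      then show False using k assms(3) by simp
    qed
  qed
qed

text \<open>For i from 1 to r these are the first-column hook lengths of the diagram padded with
  empty rows to r rows. The shift r - i turns weakly decreasing rows into distinct numbers.\<close>

definition beta_num :: "nat list \<Rightarrow> nat \<Rightarrow> nat \<Rightarrow> nat" where
  "beta_num lam r i = row_len lam i + (r - i)"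

lemma beta_num_strict:
  assumes "young lam" "1 \<le> i" "i < k" "k \<le> r"
  shows "beta_num lam r k < beta_num lam r i"
  using row_len_antimono[OF assms(1,2), of k] assms by (simp add: beta_num_def)

lemma beta_num_inj:
  assumes "young lam"
  shows "inj_on (beta_num lam r) {1..r}"
proof (rule inj_onI)
  fix i k assume "i \<in> {1..r}" "k \<in> {1..r}" "beta_num lam r i = beta_num lam r k"
  then show "i = k" using beta_num_strict[OF assms, of i k r] beta_num_strict[OF assms, of k i r]
    by (cases i k rule: linorder_cases) auto
qed

lemma beta_num_sum:
  assumes "length lam \<le> r"
  shows "(\<Sum>i=1..r. real (beta_num lam r i)) = real (ysize lam) + real r * (real r - 1) / 2"
proof -
  have "(\<Sum>i=1..r. real (r - i)) = (\<Sum>i<r. real i)"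
    by (rule sum.reindex_bij_witness[of _ "\<lambda>i. r - i" "\<lambda>i. r - i"]) auto
  also have "\<dots> = real r * (real r - 1) / 2"
    by (induction r) (auto simp: field_simps)
  finally have "(\<Sum>i=1..r. real (r - i)) = real r * (real r - 1) / 2" .
  then show ?thesis
    unfolding beta_num_def of_nat_add sum.distrib ysize_eq_sum[OF assms] of_nat_sum by (simp only:)
qed

text \<open>The hook lengths in row i and the differences to the later beta-numbers split {1..b i}.
  Both families lie in that interval and consist of distinct values, so disjointness and a count
  suffice: the length of row i plus r - i is \<open>b i\<close>.\<close>

lemma row_hook_union:
  assumes y: "young lam" and r: "length lam \<le> r" and i: "1 \<le> i" "i \<le> r"
  defines "b \<equiv> beta_num lam r"
  defines "h \<equiv> \<lambda>j. hook lam (i, j)" and "d \<equiv> \<lambda>k. int (b i) - int (b k)"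
  shows "h ` {1..row_len lam i} \<union> d ` {i<..r} = {1..int (b i)}"
    and "h ` {1..row_len lam i} \<inter> d ` {i<..r} = {}"
    and "inj_on h {1..row_len lam i}" "inj_on d {i<..r}"
proof -
  have h: "h j = int (row_len lam i) - int i + int (col_len lam j) - int j + 1" for j
    by (simp add: h_def hook_def)
  have d: "d k = int (row_len lam i) - int i - int (row_len lam k) + int k" if "k \<in> {i<..r}" for k
    using that i by (simp add: d_def b_def beta_num_def)
  have coli: "i \<le> col_len lam j" if "j \<in> {1..row_len lam i}" for j
    using that le_col_len_iff[OF y _ i(1), of j] by simp
  have colr: "col_len lam j \<le> r" if "1 \<le> j" for j
  proof -
    have "col_len lam j \<le> card {1..length lam}"
      unfolding col_len_def by (intro card_mono) auto
    then show ?thesis using r by simp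
  qed
  have anti: "col_len lam j' \<le> col_len lam j" if "j \<le> j'" for j j'
    unfolding col_len_def
  proof (rule card_mono)
    show "finite {i. 1 \<le> i \<and> i \<le> length lam \<and> j \<le> lam ! (i - 1)}"
      by (rule finite_subset[of _ "{..length lam}"]) auto
  qed (use that in auto)
  show hi: "inj_on h {1..row_len lam i}"
  proof (rule inj_onI)
    fix j j' assume "j \<in> {1..row_len lam i}" "j' \<in> {1..row_len lam i}" "h j = h j'"
    then show "j = j'" using anti[of j j'] anti[of j' j] by (cases j j' rule: linorder_cases) (auto simp: h)
  qed
  show di: "inj_on d {i<..r}"
  proof (rule inj_onI)
    fix k k' assume "k \<in> {i<..r}" "k' \<in> {i<..r}" "d k = d k'"
    then show "k = k'" using inj_onD[OF beta_num_inj[OF y, of r], of k k'] i by (simp add: d_def b_def)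
  qed
  show disj: "h ` {1..row_len lam i} \<inter> d ` {i<..r} = {}"
  proof (rule ccontr)
    assume "h ` {1..row_len lam i} \<inter> d ` {i<..r} \<noteq> {}"
    then obtain j k where jk: "j \<in> {1..row_len lam i}" "k \<in> {i<..r}" and e: "h j = d k" by blast
    \<comment> \<open>That is, col_len j - k + 1 = j - row_len k. Column j reaches row k exactly
      when row k reaches column j, so one side is positive and the other is not.\<close>
    have "int (col_len lam j) - int j + 1 = int k - int (row_len lam k)"
      using e h[of j] d[OF jk(2)] by simp
    then show False using le_col_len_iff[OF y, of j k] jk by (cases "j \<le> row_len lam k") auto
  qed
  have sub: "h ` {1..row_len lam i} \<union> d ` {i<..r} \<subseteq> {1..int (b i)}"
  proof
    fix v assume "v \<in> h ` {1..row_len lam i} \<union> d ` {i<..r}"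
    then consider (a) j where "j \<in> {1..row_len lam i}" "v = h j" | (b) k where "k \<in> {i<..r}" "v = d k" by auto
    then show "v \<in> {1..int (b i)}"
    proof cases
      case a
      then show ?thesis using coli[of j] colr[of j] i by (auto simp: h b_def beta_num_def)
    next
      case b
      then show ?thesis using beta_num_strict[OF y i(1), of k r] by (auto simp: d_def b_def)
    qed
  qed
  show "h ` {1..row_len lam i} \<union> d ` {i<..r} = {1..int (b i)}"
  proof (rule card_subset_eq[OF _ sub])
    show "card (h ` {1..row_len lam i} \<union> d ` {i<..r}) = card {1..int (b i)}"
      using i by (subst card_Un_disjoint[OF _ _ disj])
        (simp_all add: card_image[OF hi] card_image[OF di] b_def beta_num_def del: One_nat_def)
  qed simp
qed

lemma row_hook_prod:
  assumes "young lam" "length lam \<le> r" "1 \<le> i" "i \<le> r"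
  shows "(\<Prod>j=1..row_len lam i. hook lam (i, j)) * (\<Prod>k\<in>{i<..r}. int (beta_num lam r i) - int (beta_num lam r k))
     = fact (beta_num lam r i)"
proof -
  note u = row_hook_union[OF assms]
  have "(\<Prod>j=1..row_len lam i. hook lam (i, j)) * (\<Prod>k\<in>{i<..r}. int (beta_num lam r i) - int (beta_num lam r k))
    = \<Prod>{1..int (beta_num lam r i)}"
    unfolding u(1)[symmetric]
    by (subst prod.union_disjoint[OF _ _ u(2)]) (simp_all only: finite_imageI finite_atLeastAtMost
        finite_greaterThanAtMost prod.reindex[OF u(3)] prod.reindex[OF u(4)] o_def)
  also have "{1..int (beta_num lam r i)} = int ` {1..beta_num lam r i}"
    by (simp add: image_int_atLeastAtMost)
  also have "\<Prod>(int ` {1..beta_num lam r i}) = fact (beta_num lam r i)"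
    by (simp add: prod.reindex fact_prod)
  finally show ?thesis .
qed

lemma hook_pos:
  assumes "young lam" "b \<in> boxes lam"
  shows "0 < hook lam b"
proof -
  obtain i j where ij: "b = (i, j)" by (cases b)
  have "1 \<le> i" "i \<le> length lam" "j \<in> {1..row_len lam i}"
    using assms(2) ij by (auto simp: boxes_def row_len_def)
  then have "hook lam (i, j) \<in> {1..int (beta_num lam (length lam) i)}"
    unfolding row_hook_union(1)[OF assms(1) order_refl \<open>1 \<le> i\<close> \<open>i \<le> length lam\<close>, symmetric] by blast
  then show ?thesis using ij by simp
qed

definition hook_prod :: "nat list \<Rightarrow> real" where
  "hook_prod lam = (\<Prod>b\<in>boxes lam. of_int (hook lam b))"

lemma hook_prod_pos: "young lam \<Longrightarrow> 0 < hook_prod lam"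
  unfolding hook_prod_def by (intro prod_pos) (auto dest: hook_pos)

text \<open>Frobenius' form of the hook product. It is valid for every r that is at least the number
  of rows, so two diagrams with different numbers of rows can be compared using one r.\<close>

lemma hook_prod_eq:
  assumes "young lam" "length lam \<le> r"
  defines "x \<equiv> \<lambda>i. real (beta_num lam r i)"
  shows "hook_prod lam = (\<Prod>i=1..r. fact (beta_num lam r i) / (\<Prod>k\<in>{i<..r}. x i - x k))"
proof -
  have "hook_prod lam = (\<Prod>i=1..r. \<Prod>j=1..row_len lam i. of_int (hook lam (i, j)))"
    by (simp add: hook_prod_def boxes_Sigma[OF assms(2)] prod.Sigma)
  also have "\<dots> = (\<Prod>i=1..r. fact (beta_num lam r i) / (\<Prod>k\<in>{i<..r}. x i - x k))"
  proof (rule prod.cong[OF refl])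
    fix i assume i: "i \<in> {1..r}"
    then have "real_of_int ((\<Prod>j=1..row_len lam i. hook lam (i, j)) * (\<Prod>k\<in>{i<..r}. int (beta_num lam r i) - int (beta_num lam r k)))
     = fact (beta_num lam r i)"
      by (subst row_hook_prod[OF assms(1,2)]) auto
    moreover have "(\<Prod>k\<in>{i<..r}. x i - x k) \<noteq> 0"
      using beta_num_strict[OF assms(1), of i _ r] i by (fastforce simp: x_def)
    ultimately show "(\<Prod>j=1..row_len lam i. real_of_int (hook lam (i, j))) = fact (beta_num lam r i) / (\<Prod>k\<in>{i<..r}. x i - x k)"
      by (simp add: x_def field_simps)
  qed
  finally show ?thesis .
qed

text \<open>Adding a box in row s raises the single beta-number \<open>x s\<close> by one. Every
  other index j contributes one factor 1 + 1 / (x s - x j), coming from the differences of row j if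
  j < s and from those of row s if j > s; the factorial of row s gives the denominator.\<close>

lemma hook_prod_ratio:
  assumes "young lam" "young mu" "1 \<le> s" "s \<le> r" "length lam \<le> r" "length mu \<le> r"
    and mu: "row_len mu = (row_len lam)(s := Suc (row_len lam s))"
  defines "x \<equiv> \<lambda>i. real (beta_num lam r i)"
  shows "hook_prod lam / hook_prod mu = shift_coeff x {1..r} s / (x s + 1)"
proof -
  define y where "y = (\<lambda>i. real (beta_num mu r i))"
  have yx: "y i = (if i = s then x s + 1 else x i)" for i
    by (simp add: y_def x_def beta_num_def mu)
  have xi: "x i \<noteq> x k" if "i \<in> {1..r}" "k \<in> {1..r}" "i \<noteq> k" for i k
    using inj_onD[OF beta_num_inj[OF assms(1), of r], of i k] that by (simp add: x_def) blast
  define F where "F i = (\<Prod>k\<in>{i<..r}. x i - x k)" for i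
  define F' where "F' i = (\<Prod>k\<in>{i<..r}. y i - y k)" for i
  have F0: "F i \<noteq> 0" if "i \<in> {1..r}" for i using that xi by (auto simp: F_def)
  have F'0: "F' i \<noteq> 0" if "i \<in> {1..r}" for i
    using that beta_num_strict[OF assms(2), of i _ r] by (fastforce simp: F'_def y_def)
  let ?g = "\<lambda>j. 1 + 1 / (x s - x j)"
  have ratio: "(fact (beta_num lam r i) / F i) / (fact (beta_num mu r i) / F' i)
      = (if i < s then ?g i else if i = s then (\<Prod>j\<in>{s<..r}. ?g j) / (x s + 1) else 1)"
    if i: "i \<in> {1..r}" for i
  proof -
    consider "i < s" | "i = s" | "s < i" by linarith
    then show ?thesis
    proof cases
      case 1
      have "F' i = (\<Prod>k\<in>{i<..r} - {s}. x i - x k) * (x i - (x s + 1))"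
        unfolding F'_def using 1 assms(4) by (subst prod.remove[of _ s]) (auto simp: yx)
      moreover have "F i = (\<Prod>k\<in>{i<..r} - {s}. x i - x k) * (x i - x s)"
        unfolding F_def using 1 assms(4) by (subst prod.remove[of _ s]) auto
      moreover have "beta_num mu r i = beta_num lam r i" using 1 by (simp add: beta_num_def mu)
      moreover have "x i - x s \<noteq> 0" "x s - x i \<noteq> 0" using xi[of i s] i 1 assms by auto
      moreover note F0[OF i] F'0[OF i]
      ultimately have "F' i / F i = (x i - (x s + 1)) / (x i - x s)" "(fact (beta_num lam r i) / F i) / (fact (beta_num mu r i) / F' i) = F' i / F i"
        by simp_all
      moreover have "(x i - (x s + 1)) / (x i - x s) = ?g i"
        using \<open>x i - x s \<noteq> 0\<close> \<open>x s - x i \<noteq> 0\<close> by (simp add: divide_simps) (simp add: algebra_simps)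
      ultimately show ?thesis using 1 by simp
    next
      case 2
      have "F' s = (\<Prod>k\<in>{s<..r}. (x s - x k) * ?g k)"
        unfolding F'_def
      proof (rule prod.cong[OF refl])
        fix k assume "k \<in> {s<..r}"
        then show "y s - y k = (x s - x k) * ?g k" using xi[of s k] assms(3,4) by (simp add: yx field_simps)
      qed
      also have "\<dots> = F s * (\<Prod>j\<in>{s<..r}. ?g j)" by (simp add: F_def prod.distrib)
      finally have "F' s = F s * (\<Prod>j\<in>{s<..r}. ?g j)" .
      moreover have "fact (beta_num mu r s) = (x s + 1) * fact (beta_num lam r s)"
        by (simp add: beta_num_def mu x_def algebra_simps)
      moreover have "x s + 1 \<noteq> 0" by (simp add: x_def add_nonneg_eq_0_iff)
      ultimately show ?thesis using F0[OF i] 2 by simp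
    next
      case 3
      then have "F' i = F i" "beta_num mu r i = beta_num lam r i"
        by (auto simp: F_def F'_def yx beta_num_def mu)
      then show ?thesis using 3 F0[OF i] by simp
    qed
  qed
  have "hook_prod lam / hook_prod mu = (\<Prod>i=1..r. (fact (beta_num lam r i) / F i) / (fact (beta_num mu r i) / F' i))"
    by (simp only: hook_prod_eq[OF assms(1,5)] hook_prod_eq[OF assms(2,6)] F_def F'_def x_def y_def prod_dividef)
  also have "\<dots> = (\<Prod>i=1..r. if i < s then ?g i else if i = s then (\<Prod>j\<in>{s<..r}. ?g j) / (x s + 1) else 1)"
    by (rule prod.cong[OF refl ratio])
  also have "\<dots> = (\<Prod>i\<in>{1..<s} \<union> {s}. if i < s then ?g i else if i = s then (\<Prod>j\<in>{s<..r}. ?g j) / (x s + 1) else 1)"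
    using assms(3,4) by (intro prod.mono_neutral_right) auto
  also have "\<dots> = (\<Prod>i\<in>{1..<s}. ?g i) * ((\<Prod>j\<in>{s<..r}. ?g j) / (x s + 1))"
    by (subst prod.union_disjoint) auto
  also have "\<dots> = (\<Prod>i\<in>{1..<s} \<union> {s<..r}. ?g i) / (x s + 1)"
    by (subst prod.union_disjoint) auto
  also have "{1..<s} \<union> {s<..r} = {1..r} - {s}" using assms(3,4) by auto
  finally show ?thesis by (simp add: shift_coeff_def)
qed

text \<open>Kerov's identity, with parameters a and b that later become \<alpha> and its conjugate.
  The factor contributed by the new box is quadratic in its content, so three sums of
  \<open>shift_coeff\<close> determine the result: plain, weighted by \<open>x\<close> and weighted
  by 1 / (x + 1).\<close>

lemma hook_prod_add_sum:
  fixes a b :: complex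
  assumes y: "young lam"
  defines "P \<equiv> \<lambda>mu. \<Prod>c\<in>boxes mu. (a + of_int (content c)) * (b + of_int (content c))"
  shows "(\<Sum>mu | young mu \<and> add_box lam mu. P mu / of_real (hook_prod mu)) =
    (a * b + of_nat (ysize lam)) * (P lam / of_real (hook_prod lam))"
    and "finite {mu. young mu \<and> add_box lam mu}"
proof -
  \<comment> \<open>One row more than \<open>lam\<close> has: this leaves room for a box in a new
    row and makes \<open>x r = 0\<close>, as the reciprocal sum requires.\<close>
  define r where "r = Suc (length lam)"
  define x where "x = (\<lambda>i. real (beta_num lam r i))"
  define R where "R = row_len lam"
  define S where "S = {s\<in>{1..r}. s = 1 \<or> R s < R (s - 1)}"
  define up where "up s = (SOME mu. young mu \<and> row_len mu = R(s := Suc (R s)))" for s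
  have ex: "\<exists>mu. young mu \<and> row_len mu = R(s := Suc (R s))" if s: "s \<in> S" for s
  proof (rule ex_young_row_len)
    show "(R(s := Suc (R s))) 0 = 0" using s by (auto simp: S_def R_def)
    show "(R(s := Suc (R s))) i = 0" if "r < i" for i
      using that s by (auto simp: S_def R_def r_def row_len_beyond)
    fix i k :: nat assume ik: "1 \<le> i" "i \<le> k"
    have a: "R k \<le> R i" using row_len_antimono[OF y ik] by (simp add: R_def)
    have "Suc (R s) \<le> R i" if "i < s"
    proof -
      have "R s < R (s - 1)" using s that ik by (auto simp: S_def)
      also have "R (s - 1) \<le> R i" using row_len_antimono[OF y, of i "s - 1"] ik that by (simp add: R_def)
      finally show ?thesis by simp
    qed
    then show "(R(s := Suc (R s))) k \<le> (R(s := Suc (R s))) i" using a ik by auto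
  qed
  have up: "young (up s)" "row_len (up s) = R(s := Suc (R s))" if "s \<in> S" for s
    using someI_ex[OF ex[OF that]] by (auto simp: up_def)
  have set_eq: "{mu. young mu \<and> add_box lam mu} = up ` S"
  proof (intro equalityI subsetI)
    fix mu assume "mu \<in> {mu. young mu \<and> add_box lam mu}"
    then obtain s where mu: "young mu" and s: "1 \<le> s" "row_len mu = R(s := Suc (R s))"
      using add_box_iff[OF y] by (auto simp: R_def)
    have "R s < R (s - 1)" if "s \<noteq> 1"
    proof -
      have "s - 1 \<noteq> s" "1 \<le> s - 1" using s(1) that by auto
      then show ?thesis using row_len_antimono[OF mu, of "s - 1" s] s(2) by simp
    qed
    moreover have "s \<le> r"
    proof (rule ccontr)
      assume "\<not> s \<le> r"
      then have "R (s - 1) = 0" "s \<noteq> 1" by (auto simp: R_def r_def row_len_beyond)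
      then show False using calculation by simp
    qed
    ultimately have sS: "s \<in> S" using s by (auto simp: S_def)
    then have "mu = up s" using up[OF sS] mu s by (intro row_len_inject) auto
    then show "mu \<in> up ` S" using sS by blast
  next
    fix mu assume "mu \<in> up ` S"
    then show "mu \<in> {mu. young mu \<and> add_box lam mu}"
      using up add_box_iff[OF y] by (auto simp: R_def S_def)
  qed
  have inj: "inj_on up S"
  proof (rule inj_onI)
    fix s t assume st: "s \<in> S" "t \<in> S" "up s = up t"
    then have "(R(s := Suc (R s))) s = (R(t := Suc (R t))) s" using up(2)[of s] up(2)[of t] by simp
    then show "s = t" by (simp split: if_splits)
  qed
  have [simp]: "finite S" by (simp add: S_def)
  show "finite {mu. young mu \<and> add_box lam mu}" by (simp add: set_eq)
  let ?J = "{1..r}"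
  have xinj: "inj_on x ?J"
  proof (rule inj_onI)
    fix i k assume "i \<in> ?J" "k \<in> ?J" "x i = x k"
    then show "i = k" using inj_onD[OF beta_num_inj[OF y, of r], of i k] by (simp add: x_def)
  qed
  have xr: "x r = 0" by (simp add: x_def beta_num_def r_def row_len_beyond)
  have xn: "-1 \<notin> x ` ?J" by (auto simp: x_def)
  let ?A = "shift_coeff x ?J"
  \<comment> \<open>If row s is as long as the row above it, then \<open>x (s - 1) = x s + 1\<close>
    and one factor of \<open>shift_coeff\<close> vanishes. Rows that cannot be extended drop out by
    themselves, so sums over \<open>S\<close> become sums over {1..r}.\<close>
  have A0: "?A s = 0" if "s \<in> ?J" "s \<notin> S" for s
  proof -
    have s: "1 \<le> s - 1" "s - 1 \<in> ?J - {s}" "\<not> R s < R (s - 1)" using that by (auto simp: S_def)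
    then have "R s = R (s - 1)" using row_len_antimono[OF y, of "s - 1" s] by (simp add: R_def)
    then have "x s - x (s - 1) = -1" using that s by (auto simp: x_def beta_num_def R_def[symmetric])
    then show ?thesis unfolding shift_coeff_def using s(2) by (intro prod_zero) (auto intro!: bexI[of _ "s - 1"])
  qed
  \<comment> \<open>The content of the box added in row s is \<open>x s + 1 - r\<close>.\<close>
  define q :: "real \<Rightarrow> complex" where "q v = (a + of_real (v + 1 - real r)) * (b + of_real (v + 1 - real r))" for v
  have tm: "P (up s) / of_real (hook_prod (up s)) = P lam / of_real (hook_prod lam) * (of_real (?A s / (x s + 1)) * q (x s))"
    if s: "s \<in> S" for s
  proof -
    have s1: "1 \<le> s" "s \<le> r" using s by (auto simp: S_def)
    have "length (up s) \<le> r"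
    proof (rule ccontr)
      assume "\<not> length (up s) \<le> r"
      then have "row_len (up s) (length (up s)) = 0" using up(2)[OF s] s1
        by (auto simp: R_def r_def row_len_beyond)
      moreover have "1 \<le> length (up s)" using \<open>\<not> length (up s) \<le> r\<close> by (simp add: r_def)
      ultimately show False using row_len_pos_iff[OF up(1)[OF s], of "length (up s)"] by simp
    qed
    then have h: "hook_prod lam / hook_prod (up s) = ?A s / (x s + 1)"
      using hook_prod_ratio[OF y up(1)[OF s] s1, of] up(2)[OF s] by (simp add: r_def R_def x_def)
    have bx: "boxes (up s) = insert (s, Suc (R s)) (boxes lam)" "(s, Suc (R s)) \<notin> boxes lam"
      using boxes_add[of s "up s" lam] s1 up(2)[OF s] by (auto simp: R_def)
    have "of_int (content (s, Suc (R s))) = (of_real (x s + 1 - real r) :: complex)"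
      using s1 by (simp add: content_def x_def beta_num_def R_def)
    then have "P (up s) = P lam * q (x s)"
      by (simp add: P_def bx q_def)
    moreover have "complex_of_real (hook_prod lam) / of_real (hook_prod (up s)) = of_real (?A s / (x s + 1))"
      by (metis h of_real_divide)
    moreover have "hook_prod lam \<noteq> 0" using hook_prod_pos[OF y] by simp
    moreover from this have "P lam * q (x s) / of_real (hook_prod (up s)) =
        P lam / of_real (hook_prod lam) * (of_real (hook_prod lam) / of_real (hook_prod (up s)) * q (x s))"
      by simp
    ultimately show ?thesis by simp
  qed
  \<comment> \<open>Dividing the quadratic \<open>q\<close> by t = x s + 1 leaves a combination of
    t, 1 and 1 / t; writing t as (t - 1) + 1 matches the three sums evaluated next.\<close>
  have qs: "of_real (?A s / (x s + 1)) * q (x s) =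
     of_real (?A s * x s) + (1 + a + b - 2 * of_nat r) * of_real (?A s) + (a - of_nat r) * (b - of_nat r) * of_real (?A s / (x s + 1))"
    if "s \<in> ?J" for s
  proof -
    define t where "t = complex_of_real (x s + 1)"
    have "x s + 1 \<noteq> 0" by (simp add: x_def add_nonneg_eq_0_iff)
    then have t0: "t \<noteq> 0" unfolding t_def by (metis of_real_eq_0_iff)
    have q: "q (x s) = (a + t - of_nat r) * (b + t - of_nat r)" by (simp add: q_def t_def algebra_simps)
    have "of_real (?A s * x s) = of_real (?A s) * (t - 1)" "of_real (?A s / (x s + 1)) = of_real (?A s) / t"
      by (simp_all add: t_def)
    moreover have "A / t * ((a + t - of_nat r) * (b + t - of_nat r)) =
        A * (t - 1) + (1 + a + b - 2 * of_nat r) * A + (a - of_nat r) * (b - of_nat r) * (A / t)" for A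
      using t0 by (simp add: field_simps)
    ultimately show ?thesis unfolding q by (simp only:)
  qed
  have sums: "(\<Sum>s\<in>?J. ?A s) = real r" "(\<Sum>s\<in>?J. ?A s * x s) = real (ysize lam) + real r * (real r - 1)"
    "(\<Sum>s\<in>?J. ?A s / (x s + 1)) = 1"
  proof -
    show "(\<Sum>s\<in>?J. ?A s) = real r" using shift_coeff_sum[OF _ xinj] by simp
    show "(\<Sum>s\<in>?J. ?A s / (x s + 1)) = 1"
      using xr xn by (intro shift_coeff_reciprocal_sum xinj) (auto intro!: rev_image_eqI[of r] simp: r_def)
    have "(\<Sum>s\<in>?J. x s) = real (ysize lam) + real r * (real r - 1) / 2"
      using beta_num_sum[of lam r] by (simp add: x_def r_def)
    then show "(\<Sum>s\<in>?J. ?A s * x s) = real (ysize lam) + real r * (real r - 1)"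
      using shift_coeff_weighted_sum[OF _ xinj] by simp
  qed
  have "(\<Sum>mu | young mu \<and> add_box lam mu. P mu / of_real (hook_prod mu)) = (\<Sum>s\<in>S. P (up s) / of_real (hook_prod (up s)))"
    by (simp add: set_eq sum.reindex[OF inj])
  also have "\<dots> = P lam / of_real (hook_prod lam) * (\<Sum>s\<in>S. of_real (?A s / (x s + 1)) * q (x s))"
    by (simp add: tm sum_distrib_left)
  also have "(\<Sum>s\<in>S. of_real (?A s / (x s + 1)) * q (x s)) = (\<Sum>s\<in>?J. of_real (?A s / (x s + 1)) * q (x s))"
  proof (rule sum.mono_neutral_left)
    show "S \<subseteq> ?J" by (auto simp: S_def)
  qed (use A0 in auto)
  also have "\<dots> = of_real (\<Sum>s\<in>?J. ?A s * x s) + (1 + a + b - 2 * of_nat r) * of_real (\<Sum>s\<in>?J. ?A s)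
      + (a - of_nat r) * (b - of_nat r) * of_real (\<Sum>s\<in>?J. ?A s / (x s + 1))"
    by (simp only: qs sum.distrib sum_distrib_left of_real_sum cong: sum.cong)
  also have "\<dots> = a * b + of_nat (ysize lam)"
    unfolding sums by (simp add: algebra_simps)
  finally show "(\<Sum>mu | young mu \<and> add_box lam mu. P mu / of_real (hook_prod mu)) =
    (a * b + of_nat (ysize lam)) * (P lam / of_real (hook_prod lam))" by (simp add: mult.commute)
qed

text \<open>This is the branching recursion for |lam|! / \<open>hook_prod lam\<close>. Lowering
  \<open>x s\<close> by one raises \<open>- x s\<close> by one, so the weights are the
  \<open>shift_coeff\<close> of the negated beta-numbers.\<close>

lemma hook_prod_remove_sum:
  assumes y: "young lam"
  shows "(\<Sum>nu | young nu \<and> add_box nu lam. 1 / hook_prod nu) = real (ysize lam) / hook_prod lam"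
    and "finite {nu. young nu \<and> add_box nu lam}"
proof -
  define r where "r = length lam"
  define x where "x = (\<lambda>i. real (beta_num lam r i))"
  define R where "R = row_len lam"
  define S where "S = {s\<in>{1..r}. R (Suc s) < R s}"
  define dn where "dn s = (SOME mu. young mu \<and> row_len mu = R(s := R s - 1))" for s
  have ex: "\<exists>mu. young mu \<and> row_len mu = R(s := R s - 1)" if s: "s \<in> S" for s
  proof (rule ex_young_row_len)
    show "(R(s := R s - 1)) 0 = 0" using s by (auto simp: S_def R_def)
    show "(R(s := R s - 1)) i = 0" if "r < i" for i
      using that s by (auto simp: S_def R_def r_def row_len_beyond)
    fix i k :: nat assume ik: "1 \<le> i" "i \<le> k"
    have a: "R k \<le> R i" using row_len_antimono[OF y ik] by (simp add: R_def)
    have "R k \<le> R s - 1" if "s < k"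
    proof -
      have "R (Suc s) < R s" using s by (auto simp: S_def)
      moreover have "R k \<le> R (Suc s)" using row_len_antimono[OF y, of "Suc s" k] that by (simp add: R_def)
      ultimately show ?thesis by simp
    qed
    then show "(R(s := R s - 1)) k \<le> (R(s := R s - 1)) i" using a ik by auto
  qed
  have dn: "young (dn s)" "row_len (dn s) = R(s := R s - 1)" if "s \<in> S" for s
    using someI_ex[OF ex[OF that]] by (auto simp: dn_def)
  have bk: "R = (row_len (dn s))(s := Suc (row_len (dn s) s))" if s: "s \<in> S" for s
    using dn(2)[OF s] s by (auto simp: S_def)
  have set_eq: "{nu. young nu \<and> add_box nu lam} = dn ` S"
  proof (intro equalityI subsetI)
    fix nu assume "nu \<in> {nu. young nu \<and> add_box nu lam}"
    then obtain s where nu: "young nu" and s: "1 \<le> s" "R = (row_len nu)(s := Suc (row_len nu s))"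
      using add_box_iff[OF _ y, of nu] by (auto simp: R_def)
    have "R (Suc s) < R s"
      using row_len_antimono[OF nu, of s "Suc s"] s by simp
    moreover have "s \<le> r"
      using row_len_pos_iff[OF y, of s] calculation by (simp add: R_def r_def)
    ultimately have sS: "s \<in> S" using s by (auto simp: S_def)
    have "row_len nu = R(s := R s - 1)" using s by auto
    then have "nu = dn s" using dn[OF sS] nu by (intro row_len_inject) auto
    then show "nu \<in> dn ` S" using sS by blast
  next
    fix nu assume "nu \<in> dn ` S"
    then obtain s where s: "s \<in> S" "nu = dn s" by blast
    have "1 \<le> s" using s by (simp add: S_def)
    then show "nu \<in> {nu. young nu \<and> add_box nu lam}"
      using dn(1)[OF s(1)] bk[OF s(1)] s(2) add_box_iff[OF _ y, of nu] R_def by auto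
  qed
  have inj: "inj_on dn S"
  proof (rule inj_onI)
    fix s t assume st: "s \<in> S" "t \<in> S" "dn s = dn t"
    then have "(R(s := R s - 1)) s = (R(t := R t - 1)) s" using dn(2)[of s] dn(2)[of t] by simp
    then show "s = t" using st by (simp add: S_def split: if_splits)
  qed
  have [simp]: "finite S" by (simp add: S_def)
  show "finite {nu. young nu \<and> add_box nu lam}" by (simp add: set_eq)
  let ?J = "{1..r}"
  have xinj: "inj_on (\<lambda>i. - x i) ?J"
  proof (rule inj_onI)
    fix i k assume "i \<in> ?J" "k \<in> ?J" "- x i = - x k"
    then show "i = k" using inj_onD[OF beta_num_inj[OF y, of r], of i k] by (simp add: x_def)
  qed
  let ?A = "shift_coeff (\<lambda>i. - x i) ?J"
  \<comment> \<open>The last row is nonempty, hence always removable. Otherwise equal rows s and s +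
    1 give \<open>x s = x (s + 1) + 1\<close>, which kills one factor of
    \<open>?A s\<close>.\<close>
  have A0: "?A s * x s = 0" if "s \<in> ?J" "s \<notin> S" for s
  proof (cases "s = r")
    case True
    moreover have "R (Suc r) = 0" by (simp add: R_def r_def row_len_beyond)
    ultimately have "R s = 0" using that by (simp add: S_def)
    then show ?thesis using row_len_pos_iff[OF y, of s] that True by (simp add: R_def r_def)
  next
    case False
    then have s: "Suc s \<in> ?J - {s}" "\<not> R (Suc s) < R s" using that by (auto simp: S_def)
    then have "R s = R (Suc s)" using row_len_antimono[OF y, of s "Suc s"] that by (simp add: R_def)
    then have "- x s - - x (Suc s) = -1" using that s by (auto simp: x_def beta_num_def R_def[symmetric])
    then have "?A s = 0" unfolding shift_coeff_def using s(1) by (intro prod_zero) (auto intro!: bexI[of _ "Suc s"])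
    then show ?thesis by simp
  qed
  have tm: "1 / hook_prod (dn s) = ?A s * x s / hook_prod lam"
    if s: "s \<in> S" for s
  proof -
    have s1: "1 \<le> s" "s \<le> r" using s by (auto simp: S_def)
    have len: "length (dn s) \<le> r"
    proof (rule ccontr)
      assume "\<not> length (dn s) \<le> r"
      then have "row_len (dn s) (length (dn s)) = 0" using dn(2)[OF s] s1
        by (auto simp: R_def r_def row_len_beyond)
      moreover have "1 \<le> length (dn s)" using \<open>\<not> length (dn s) \<le> r\<close> s1 by linarith
      ultimately show False using row_len_pos_iff[OF dn(1)[OF s], of "length (dn s)"] by simp
    qed
    define w where "w = (\<lambda>i. real (beta_num (dn s) r i))"
    have w: "w i = (if i = s then x s - 1 else x i)" for i
    proof -
      have "0 < R s" using s by (simp add: S_def)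
      then show ?thesis by (auto simp: w_def x_def beta_num_def dn(2)[OF s] R_def[symmetric])
    qed
    have h: "hook_prod (dn s) / hook_prod lam = shift_coeff w ?J s / (w s + 1)"
      using hook_prod_ratio[OF dn(1)[OF s] y s1 len] bk[OF s] by (simp add: r_def R_def w_def)
    \<comment> \<open>Both factors are quotients of x s - x j and x s - 1 - x j, one the inverse of
      the other.\<close>
    have inv: "(1 + 1 / (w s - w j)) * (1 + 1 / (- x s - - x j)) = 1" if j: "j \<in> ?J - {s}" for j
    proof -
      have "x s \<noteq> x j" using inj_onD[OF xinj, of s j] s1 j by auto
      moreover have "w s \<noteq> w j"
        using inj_onD[OF beta_num_inj[OF dn(1)[OF s], of r], of s j] s1 j by (auto simp: w_def)
      ultimately have "x s - x j \<noteq> 0" "x j - x s \<noteq> 0" "x s - 1 - x j \<noteq> 0" "w s - w j = x s - 1 - x j"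
        using w[of s] w[of j] j by auto
      then show ?thesis by (simp add: divide_simps) (simp add: algebra_simps)
    qed
    have "shift_coeff w ?J s * ?A s = 1"
      unfolding shift_coeff_def prod.distrib[symmetric] by (rule prod.neutral) (use inv in blast)
    moreover have "hook_prod (dn s) = shift_coeff w ?J s / x s * hook_prod lam"
      using h hook_prod_pos[OF y] by (simp add: w field_simps)
    moreover have "hook_prod (dn s) > 0" "hook_prod lam > 0" using hook_prod_pos dn(1)[OF s] y by auto
    moreover have "x s \<noteq> 0" using w[of s] by (simp add: w_def)
    ultimately have "hook_prod (dn s) * (?A s * x s) = hook_prod lam * (shift_coeff w ?J s * ?A s)"
      by simp
    then have "hook_prod (dn s) * (?A s * x s) = hook_prod lam"
      unfolding \<open>shift_coeff w ?J s * ?A s = 1\<close> by (simp only: mult_1_right)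
    then show ?thesis using \<open>hook_prod (dn s) > 0\<close> \<open>hook_prod lam > 0\<close> by (simp add: field_simps)
  qed
  have "(\<Sum>s\<in>?J. x s) = real (ysize lam) + real r * (real r - 1) / 2"
    using beta_num_sum[of lam r] by (simp add: x_def r_def)
  \<comment> \<open>The two binomial terms r (r - 1) / 2, from the beta-numbers and from the
    weighted sum, cancel and leave the number of boxes.\<close>
  then have sums: "(\<Sum>s\<in>?J. ?A s * x s) = real (ysize lam)"
    using shift_coeff_weighted_sum[OF _ xinj] by (simp add: sum_negf)
  have "(\<Sum>nu | young nu \<and> add_box nu lam. 1 / hook_prod nu) = (\<Sum>s\<in>S. 1 / hook_prod (dn s))"
    by (simp add: set_eq sum.reindex[OF inj])
  also have "\<dots> = (\<Sum>s\<in>S. ?A s * x s) / hook_prod lam"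
    by (simp add: tm sum_divide_distrib)
  also have "(\<Sum>s\<in>S. ?A s * x s) = (\<Sum>s\<in>?J. ?A s * x s)"
    by (rule sum.mono_neutral_left) (use A0 in \<open>auto simp: S_def\<close>)
  finally show "(\<Sum>nu | young nu \<and> add_box nu lam. 1 / hook_prod nu) = real (ysize lam) / hook_prod lam"
    unfolding sums .
qed

section \<open>Standard tableaux and the hook length formula\<close>

definition box_diff :: "nat list \<Rightarrow> nat list \<Rightarrow> nat \<times> nat" where
  "box_diff nu lam = (THE b. b \<in> boxes lam - boxes nu)"

lemma box_diff:
  assumes "add_box nu lam"
  shows "boxes lam = insert (box_diff nu lam) (boxes nu)" "box_diff nu lam \<notin> boxes nu"
proof -
  have "card (boxes lam - boxes nu) = 1" "boxes nu \<subseteq> boxes lam"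
    using assms by (auto simp: add_box_def card_Diff_subset)
  then obtain b where b: "boxes lam - boxes nu = {b}" by (auto simp: card_1_singleton_iff)
  then have "box_diff nu lam = b" by (auto simp: box_diff_def)
  then show "boxes lam = insert (box_diff nu lam) (boxes nu)" "box_diff nu lam \<notin> boxes nu"
    using b \<open>boxes nu \<subseteq> boxes lam\<close> by auto
qed

text \<open>The added box ends both its row and its column; hence the largest entry can be placed
  there without violating the order conditions of a tableau.\<close>

lemma box_diff_corner:
  assumes "young nu" "young lam" "add_box nu lam" "box_diff nu lam = (i, j)"
  shows "(i, j + 1) \<notin> boxes lam" "(i + 1, j) \<notin> boxes lam"
proof -
  note d = box_diff[OF assms(3)]
  have ij: "1 \<le> i" "1 \<le> j" "(i, j) \<notin> boxes nu" using d assms(4) mem_boxes_iff[of i j lam] by auto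
  have "(i, j + 1) \<notin> boxes nu" "(i + 1, j) \<notin> boxes nu"
    using ij row_len_antimono[OF assms(1), of i "i + 1"] by (auto simp: mem_boxes_iff)
  then show "(i, j + 1) \<notin> boxes lam" "(i + 1, j) \<notin> boxes lam" using d assms(4) by auto
qed

lemma finite_standard_tableaux [simp]: "finite (standard_tableaux lam)"
  by (rule finite_subset[of _ "boxes lam \<rightarrow>\<^sub>E {1..ysize lam}"]) (auto simp: standard_tableaux_def intro: finite_PiE)

text \<open>Tableaux are classified by the box holding the largest entry m. Nothing lies to the
  right of it or below it, so deleting it leaves a diagram \<open>nu\<close>, and restriction to the
  boxes of \<open>nu\<close> is a bijection onto the tableaux of \<open>nu\<close>.\<close>

lemma dim_young_recursion:
  assumes y: "young lam" and pos: "0 < ysize lam"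
  shows "dim_young lam = (\<Sum>nu | young nu \<and> add_box nu lam. dim_young nu)"
proof -
  define m where "m = ysize lam"
  define N where "N = {nu. young nu \<and> add_box nu lam}"
  define F where "F nu = {T \<in> standard_tableaux lam. T (box_diff nu lam) = m}" for nu
  have finN: "finite N" using hook_prod_remove_sum(2)[OF y] by (simp add: N_def)
  have bij: "bij_betw T (boxes lam) {1..m}" and ext: "T \<in> extensional (boxes lam)"
    and row: "\<And>i j. (i, j) \<in> boxes lam \<Longrightarrow> (i, j + 1) \<in> boxes lam \<Longrightarrow> T (i, j) < T (i, j + 1)"
    and col: "\<And>i j. (i, j) \<in> boxes lam \<Longrightarrow> (i + 1, j) \<in> boxes lam \<Longrightarrow> T (i, j) < T (i + 1, j)"
    if "T \<in> standard_tableaux lam" for T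
    using that by (auto simp: standard_tableaux_def m_def PiE_def)
  have "standard_tableaux lam \<subseteq> (\<Union>nu\<in>N. F nu)"
  proof
    fix T assume T: "T \<in> standard_tableaux lam"
    have "m \<in> T ` boxes lam" using bij[OF T] pos by (auto simp: bij_betw_def m_def)
    then obtain i j where b: "(i, j) \<in> boxes lam" "T (i, j) = m" by auto
    have le: "T c \<le> m" if "c \<in> boxes lam" for c using bij[OF T] that by (auto simp: bij_betw_def)
    have n1: "(i, j + 1) \<notin> boxes lam"
    proof
      assume "(i, j + 1) \<in> boxes lam"
      then show False using row[OF T b(1)] le[of "(i, j + 1)"] b(2) by simp
    qed
    have n2: "(i + 1, j) \<notin> boxes lam"
    proof
      assume "(i + 1, j) \<in> boxes lam"
      then show False using col[OF T b(1)] le[of "(i + 1, j)"] b(2) by simp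
    qed
    define R where "R = row_len lam"
    have ij: "1 \<le> i" "1 \<le> j" "R i = j" "R (i + 1) < j"
      using b(1) n1 n2 by (auto simp: mem_boxes_iff R_def)
    have "\<exists>mu. young mu \<and> row_len mu = R(i := j - 1)"
    proof (rule ex_young_row_len)
      show "(R(i := j - 1)) 0 = 0" using ij by (auto simp: R_def)
      show "(R(i := j - 1)) k = 0" if "length lam + i < k" for k
        using that by (auto simp: R_def row_len_beyond)
      fix k l :: nat assume kl: "1 \<le> k" "k \<le> l"
      have a: "R l \<le> R k" using row_len_antimono[OF y kl] by (simp add: R_def)
      have "R l \<le> j - 1" if "i < l"
        using row_len_antimono[OF y, of "i + 1" l] that ij by (simp add: R_def)
      then show "(R(i := j - 1)) l \<le> (R(i := j - 1)) k" using a kl ij by auto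
    qed
    then obtain nu where nu: "young nu" "row_len nu = R(i := j - 1)" by blast
    have R: "row_len lam = (row_len nu)(i := Suc (row_len nu i))"
      using nu(2) ij by (auto simp: R_def)
    then have add: "add_box nu lam" using add_box_iff[OF nu(1) y] ij(1) by blast
    have "boxes lam = insert (i, j) (boxes nu)" "(i, j) \<notin> boxes nu"
      using boxes_add[OF ij(1) R] nu(2) ij by auto
    then have "box_diff nu lam = (i, j)" using box_diff[OF add] by auto
    then have "T \<in> F nu" using T b by (simp add: F_def)
    then show "T \<in> (\<Union>nu\<in>N. F nu)" using nu add by (auto simp: N_def)
  qed
  then have "standard_tableaux lam = (\<Union>nu\<in>N. F nu)" by (auto simp: F_def)
  \<comment> \<open>A tableau is injective, so it takes the value m in one box only, and the deleted
    box determines the smaller diagram.\<close>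
  moreover have "F nu \<inter> F nu' = {}" if n: "nu \<in> N" "nu' \<in> N" "nu \<noteq> nu'" for nu nu'
  proof (rule ccontr)
    assume "F nu \<inter> F nu' \<noteq> {}"
    then obtain T where "T \<in> F nu" "T \<in> F nu'" by blast
    then have T: "T \<in> standard_tableaux lam" "T (box_diff nu lam) = T (box_diff nu' lam)"
      by (simp_all add: F_def)
    note d = box_diff[of nu lam] and d' = box_diff[of nu' lam]
    have "add_box nu lam" "add_box nu' lam" using n by (auto simp: N_def)
    then have "box_diff nu lam = box_diff nu' lam"
      using inj_onD[OF bij_betw_imp_inj_on[OF bij[OF T(1)]] T(2)] d(1) d'(1) by blast
    then have "boxes nu = boxes nu'" using \<open>add_box nu lam\<close> \<open>add_box nu' lam\<close> d d'
      by (metis insert_ident)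
    then have "row_len nu i = row_len nu' i" for i
      using mem_boxes_iff[of i _ nu] mem_boxes_iff[of i _ nu']
      by (cases "i = 0") (simp, metis One_nat_def Suc_leI leI le_refl neq0_conv not_less_eq_eq order_antisym)
    then show False using row_len_inject[of nu nu'] n by (auto simp: N_def)
  qed
  ultimately have "card (standard_tableaux lam) = (\<Sum>nu\<in>N. card (F nu))"
    using finN by (simp only:) (rule card_UN_disjoint, auto simp: F_def)
  also have "\<dots> = (\<Sum>nu\<in>N. dim_young nu)"
  proof (rule sum.cong[OF refl])
    fix nu assume "nu \<in> N"
    then have nu: "young nu" "add_box nu lam" by (auto simp: N_def)
    define b where "b = box_diff nu lam"
    note d = box_diff[OF nu(2), folded b_def]
    have sz: "ysize lam = Suc (ysize nu)" using d by (simp add: card_boxes[symmetric])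
    have iv: "{1..m} = insert m {1..ysize nu}" "m \<notin> {1..ysize nu}" using sz by (auto simp: m_def)
    have corner: "(i, j + 1) \<notin> boxes lam" "(i + 1, j) \<notin> boxes lam" if "b = (i, j)" for i j
      using box_diff_corner[OF nu(1) y nu(2)] that by (auto simp: b_def)
    have "bij_betw (\<lambda>T. restrict T (boxes nu)) (F nu) (standard_tableaux nu)"
    proof (rule bij_betw_byWitness[where f' = "\<lambda>T. T(b := m)"])
      \<comment> \<open>Tableaux are \<open>undefined\<close> off their boxes, so restricting and
        then assigning m at \<open>b\<close> recovers the same function everywhere.\<close>
      show "\<forall>T\<in>F nu. (restrict T (boxes nu))(b := m) = T"
      proof
        fix T assume T: "T \<in> F nu"
        then have "T \<in> extensional (boxes lam)" "T b = m" by (auto simp: F_def b_def intro: ext)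
        then show "(restrict T (boxes nu))(b := m) = T"
          using d by (auto simp: fun_eq_iff restrict_def extensional_def)
      qed
      show "\<forall>T\<in>standard_tableaux nu. restrict (T(b := m)) (boxes nu) = T"
        using d by (auto simp: standard_tableaux_def fun_eq_iff restrict_def PiE_def extensional_def)
      show "(\<lambda>T. restrict T (boxes nu)) ` F nu \<subseteq> standard_tableaux nu"
      proof
        fix T' assume "T' \<in> (\<lambda>T. restrict T (boxes nu)) ` F nu"
        then obtain T where T: "T \<in> standard_tableaux lam" "T b = m" "T' = restrict T (boxes nu)"
          by (auto simp: F_def b_def)
        have "bij_betw T (insert b (boxes nu)) (insert m {1..ysize nu})"
          using bij[OF T(1)] d(1) iv(1) by simp
        then have bn: "bij_betw T (boxes nu) {1..ysize nu}"
          using d(2) iv(2) T(2) notIn_Un_bij_betw3[of b "boxes nu" T "{1..ysize nu}"] by simp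
        then have bn': "bij_betw T' (boxes nu) {1..ysize nu}"
          unfolding T(3) by (rule bij_betw_cong[THEN iffD1, rotated]) auto
        have "T' \<in> boxes nu \<rightarrow>\<^sub>E {1..ysize nu}"
          using bn by (auto simp: T(3) bij_betw_def)
        moreover have "\<forall>i j. (i, j) \<in> boxes nu \<and> (i, j + 1) \<in> boxes nu \<longrightarrow> T' (i, j) < T' (i, j + 1)"
          "\<forall>i j. (i, j) \<in> boxes nu \<and> (i + 1, j) \<in> boxes nu \<longrightarrow> T' (i, j) < T' (i + 1, j)"
          using row[OF T(1)] col[OF T(1)] d(1) by (auto simp: T(3))
        ultimately show "T' \<in> standard_tableaux nu" using bn' by (simp add: standard_tableaux_def)
      qed
      show "(\<lambda>T. T(b := m)) ` standard_tableaux nu \<subseteq> F nu"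
      proof
        fix T' assume "T' \<in> (\<lambda>T. T(b := m)) ` standard_tableaux nu"
        then obtain T where T: "T \<in> standard_tableaux nu" "T' = T(b := m)" by blast
        have bn: "bij_betw T (boxes nu) {1..ysize nu}" and ex: "T \<in> extensional (boxes nu)"
          and rw: "\<And>i j. (i, j) \<in> boxes nu \<Longrightarrow> (i, j + 1) \<in> boxes nu \<Longrightarrow> T (i, j) < T (i, j + 1)"
          and cl: "\<And>i j. (i, j) \<in> boxes nu \<Longrightarrow> (i + 1, j) \<in> boxes nu \<Longrightarrow> T (i, j) < T (i + 1, j)"
          using T(1) by (auto simp: standard_tableaux_def PiE_def)
        have lt: "T c < m" if "c \<in> boxes nu" for c
          using bij_betwE[OF bn] that sz by (force simp: m_def)
        have "bij_betw T' (boxes nu) {1..ysize nu}"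
          using bn d(2) unfolding T(2) by (subst bij_betw_cong[of _ _ T]) auto
        then have bl: "bij_betw T' (boxes lam) {1..m}"
          unfolding d(1) iv(1) using d(2) iv(2) notIn_Un_bij_betw3[of b "boxes nu" T' "{1..ysize nu}"] T(2) by simp
        have "T' \<in> extensional (boxes lam)" using ex d(1) by (auto simp: T(2) extensional_def)
        then have "T' \<in> boxes lam \<rightarrow>\<^sub>E {1..m}"
          using bl by (auto simp: bij_betw_def PiE_def)
        moreover have "\<forall>i j. (i, j) \<in> boxes lam \<and> (i, j + 1) \<in> boxes lam \<longrightarrow> T' (i, j) < T' (i, j + 1)"
        proof (intro allI impI, elim conjE)
          fix i j assume ij: "(i, j) \<in> boxes lam" "(i, j + 1) \<in> boxes lam"
          then have "(i, j) \<noteq> b" using corner(1)[of i j] by auto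
          then have "(i, j) \<in> boxes nu" using ij(1) d(1) by auto
          then show "T' (i, j) < T' (i, j + 1)"
            using \<open>(i, j) \<noteq> b\<close> ij(2) d(1) rw[of i j] lt[of "(i, j)"] by (auto simp: T(2))
        qed
        moreover have "\<forall>i j. (i, j) \<in> boxes lam \<and> (i + 1, j) \<in> boxes lam \<longrightarrow> T' (i, j) < T' (i + 1, j)"
        proof (intro allI impI, elim conjE)
          fix i j assume ij: "(i, j) \<in> boxes lam" "(i + 1, j) \<in> boxes lam"
          then have "(i, j) \<noteq> b" using corner(2)[of i j] by auto
          then have "(i, j) \<in> boxes nu" using ij(1) d(1) by auto
          then show "T' (i, j) < T' (i + 1, j)"
            using \<open>(i, j) \<noteq> b\<close> ij(2) d(1) cl[of i j] lt[of "(i, j)"] by (auto simp: T(2))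
        qed
        ultimately have "T' \<in> standard_tableaux lam"
          using bl by (simp add: standard_tableaux_def m_def)
        then show "T' \<in> F nu" by (simp add: F_def b_def[symmetric] T(2))
      qed
    qed
    then show "card (F nu) = dim_young nu" by (simp add: dim_young_def bij_betw_same_card)
  qed
  finally show ?thesis by (simp add: dim_young_def N_def)
qed

text \<open>Both sides obey the same recursion over removed boxes,
  \<open>dim_young_recursion\<close> on the left and \<open>hook_prod_remove_sum\<close> on the
  right. The empty diagram has one tableau, the everywhere undefined function.\<close>

theorem hook_length_formula:
  assumes "young lam"
  shows "real (dim_young lam) = fact (ysize lam) / hook_prod lam"
  using assms
proof (induction "ysize lam" arbitrary: lam)
  case 0
  then have "boxes lam = {}" by (metis card_0_eq card_boxes finite_boxes)
  moreover from this have "standard_tableaux lam = {\<lambda>_. undefined}"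
    using 0 by (auto simp: standard_tableaux_def bij_betw_def)
  ultimately show ?case using 0(1) by (simp add: dim_young_def hook_prod_def)
next
  case (Suc m)
  have "real (dim_young lam) = (\<Sum>nu | young nu \<and> add_box nu lam. real (dim_young nu))"
    using dim_young_recursion[OF Suc.prems] Suc.hyps(2) by simp
  also have "\<dots> = (\<Sum>nu | young nu \<and> add_box nu lam. fact m * (1 / hook_prod nu))"
  proof (rule sum.cong[OF refl])
    fix nu assume "nu \<in> {nu. young nu \<and> add_box nu lam}"
    then have nu: "young nu" "add_box nu lam" by auto
    then have "m = ysize nu" using Suc.hyps(2) by (simp add: add_box_def card_boxes)
    then show "real (dim_young nu) = fact m * (1 / hook_prod nu)" using Suc.hyps(1) nu(1) by simp
  qed
  also have "\<dots> = fact m * (real (ysize lam) / hook_prod lam)"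
    by (simp only: sum_distrib_left[symmetric] hook_prod_remove_sum(1)[OF Suc.prems])
  finally show ?case using Suc.hyps(2)[symmetric] by (simp add: mult.commute)
qed

section \<open>Invariant integration\<close>

lemma continuous_map_cmult [continuous_intros]:
  fixes f g :: "'a \<Rightarrow> complex"
  assumes "continuous_map X euclidean f" "continuous_map X euclidean g"
  shows "continuous_map X euclidean (\<lambda>x. f x * g x)"
  using assms by (simp add: continuous_map_atin tendsto_mult)

lemma continuous_map_cnj [continuous_intros]:
  "continuous_map X euclidean f \<Longrightarrow> continuous_map X euclidean (\<lambda>x. cnj (f x))"
  by (simp add: continuous_map_atin tendsto_cnj)

text \<open>Uniform limits of continuous functions are continuous, by the three-epsilon argument. It
  serves twice: for the limit of convolution powers and for the sum of a character series.\<close>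

lemma continuous_map_approx:
  fixes f :: "'a \<Rightarrow> 'b::metric_space"
  assumes "\<And>e. 0 < e \<Longrightarrow> \<exists>g. continuous_map X euclidean g \<and> (\<forall>x\<in>topspace X. dist (g x) (f x) < e)"
  shows "continuous_map X euclidean f"
proof -
  have "\<exists>U. openin X U \<and> x \<in> U \<and> (\<forall>y\<in>U. f y \<in> ball (f x) e)" if x: "x \<in> topspace X" and e: "0 < e" for x e
  proof -
    obtain g where g: "continuous_map X euclidean g" "\<And>y. y \<in> topspace X \<Longrightarrow> dist (g y) (f y) < e / 3"
      using assms[of "e / 3"] e by auto
    let ?U = "{y \<in> topspace X. g y \<in> ball (g x) (e / 3)}"
    have "openin X ?U" by (rule openin_continuous_map_preimage[OF g(1)]) simp
    moreover have "f y \<in> ball (f x) e" if "y \<in> ?U" for y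
    proof -
      have "dist (f x) (f y) \<le> dist (g x) (f x) + dist (g x) (g y) + dist (g y) (f y)"
        using dist_triangle[of "f x" "f y" "g x"] dist_triangle[of "g x" "f y" "g y"] by (simp add: dist_commute)
      then show ?thesis using g(2)[OF x] g(2)[of y] that by simp
    qed
    ultimately show ?thesis using x e by (intro exI[of _ ?U]) auto
  qed
  then show ?thesis
    using Metric_space.continuous_map_to_metric[OF Met_TC.Metric_space_axioms, of X f] by simp
qed

section \<open>Haar integrals of continuous functions\<close>

locale haar_group = group G for G :: "('g, 'b) monoid_scheme" (structure) +
  fixes T :: "'g topology" and \<mu> :: "'g measure"
  assumes compact: "compact_group G T" and haar: "normalized_haar G T \<mu>"
begin

abbreviation cont :: "('g \<Rightarrow> complex) \<Rightarrow> bool" where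
  "cont f \<equiv> continuous_map T euclidean f"

lemma topspace_eq [simp]: "topspace T = carrier G"
  and space_eq [simp]: "space \<mu> = carrier G"
  and compact_T: "compact_space T"
  using compact haar by (auto simp: compact_group_def normalized_haar_def)

sublocale finite_measure \<mu>
  using haar by (intro finite_measureI) (simp add: normalized_haar_def)

lemma measure_carrier [simp]: "measure \<mu> (carrier G) = 1"
  using haar by (simp add: normalized_haar_def measure_def)

lemma openin_sets: "openin T U \<Longrightarrow> U \<in> sets \<mu>"
  using haar by (auto simp: normalized_haar_def)

lemma finite_subcover:
  assumes "\<And>a. a \<in> carrier G \<Longrightarrow> openin T (U a)" "carrier G \<subseteq> (\<Union>a\<in>carrier G. U a)"
  shows "\<exists>A. finite A \<and> A \<subseteq> carrier G \<and> carrier G \<subseteq> (\<Union>a\<in>A. U a)"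
proof -
  have "\<forall>V\<in>U ` carrier G. openin T V" "topspace T \<subseteq> \<Union>(U ` carrier G)" using assms by auto
  then obtain \<F> where F: "finite \<F>" "\<F> \<subseteq> U ` carrier G" "topspace T \<subseteq> \<Union>\<F>"
    using compact_T unfolding compact_space_alt by meson
  then obtain A where "A \<subseteq> carrier G" "finite A" "\<F> = U ` A" using finite_subset_image[OF F(1,2)] by blast
  then show ?thesis using F(3) by auto
qed

lemma cm_mult [continuous_intros]:
  assumes "continuous_map Z T a" "continuous_map Z T b"
  shows "continuous_map Z T (\<lambda>z. a z \<otimes> b z)"
  using continuous_map_compose[OF continuous_map_pairedI[OF assms], of T "\<lambda>(x, y). x \<otimes> y"] compact
  by (auto simp: compact_group_def o_def)

lemma cm_inv [continuous_intros]:
  assumes "continuous_map Z T a"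
  shows "continuous_map Z T (\<lambda>z. inv (a z))"
  using continuous_map_compose[OF assms, of T "\<lambda>x. inv x"] compact by (auto simp: compact_group_def o_def)

lemma cm_comp:
  assumes "cont f" "continuous_map Z T a"
  shows "continuous_map Z euclidean (\<lambda>z. f (a z))"
  using continuous_map_compose[OF assms(2,1)] by (simp add: o_def)

lemma cm_const [continuous_intros]: "g \<in> carrier G \<Longrightarrow> continuous_map Z T (\<lambda>z. g)"
  by simp

lemma cm_id [continuous_intros]: "continuous_map T T (\<lambda>z. z)"
  using continuous_map_id[of T] by (simp add: id_def)

lemma cm_borel:
  fixes f :: "'g \<Rightarrow> 'c::topological_space"
  assumes "continuous_map T euclidean f"
  shows "f \<in> borel_measurable \<mu>"
proof (rule borel_measurableI)
  fix S :: "'c set" assume "open S"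
  then have "openin T {x \<in> topspace T. f x \<in> S}"
    by (intro openin_continuous_map_preimage[OF assms]) simp
  moreover have "{x \<in> topspace T. f x \<in> S} = f -` S \<inter> space \<mu>" by auto
  ultimately show "f -` S \<inter> space \<mu> \<in> sets \<mu>" using openin_sets by metis
qed

lemma cm_bounded:
  fixes f :: "'c \<Rightarrow> 'd::real_normed_vector"
  assumes "compact_space X" "continuous_map X euclidean f"
  shows "\<exists>B. \<forall>x\<in>topspace X. norm (f x) \<le> B"
proof -
  have "compact (f ` topspace X)"
    using image_compactin[of X "topspace X" euclidean f] assms by (simp add: compact_space_def)
  then show ?thesis using compact_imp_bounded bounded_iff by (metis imageI)
qed

lemma cm_integrable:
  fixes f :: "'g \<Rightarrow> 'c::{banach, second_countable_topology}"
  assumes "continuous_map T euclidean f"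
  shows "integrable \<mu> f"
proof -
  obtain B where "\<forall>x\<in>carrier G. norm (f x) \<le> B" using cm_bounded[OF compact_T assms] by auto
  then show ?thesis by (intro integrable_const_bound[of _ B] cm_borel[OF assms]) auto
qed

lemma integral_le_const:
  fixes f :: "'g \<Rightarrow> real"
  assumes "continuous_map T euclidean f" "\<And>x. x \<in> carrier G \<Longrightarrow> f x \<le> c"
  shows "(\<integral>x. f x \<partial>\<mu>) \<le> c"
  using integral_mono[OF cm_integrable[OF assms(1)], of "\<lambda>_. c"] assms(2) by simp

lemma integral_ge_const:
  fixes f :: "'g \<Rightarrow> real"
  assumes "continuous_map T euclidean f" "\<And>x. x \<in> carrier G \<Longrightarrow> c \<le> f x"
  shows "c \<le> (\<integral>x. f x \<partial>\<mu>)"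
  using integral_mono[OF _ cm_integrable[OF assms(1)], of "\<lambda>_. c"] assms(2) by simp

lemma norm_integral_le:
  fixes f :: "'g \<Rightarrow> complex"
  assumes "cont f" "\<And>x. x \<in> carrier G \<Longrightarrow> norm (f x) \<le> c"
  shows "norm (\<integral>x. f x \<partial>\<mu>) \<le> c"
proof -
  have "norm (\<integral>x. f x \<partial>\<mu>) \<le> (\<integral>x. norm (f x) \<partial>\<mu>)" by (rule integral_norm_bound)
  also have "\<dots> \<le> c" using assms by (intro integral_le_const continuous_map_norm) auto
  finally show ?thesis .
qed

text \<open>\<open>normalized_haar\<close> states invariance for images of measurable sets. The
  preimage under translation by g is the image under translation by \<open>inv g\<close>, so the
  push-forward of the measure is the measure itself.\<close>

lemma integral_left_invariant:
  fixes f :: "'g \<Rightarrow> complex"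
  assumes "cont f" "g \<in> carrier G"
  shows "(\<integral>x. f (g \<otimes> x) \<partial>\<mu>) = (\<integral>x. f x \<partial>\<mu>)"
proof -
  have img: "(\<lambda>x. h \<otimes> x) ` A \<in> sets \<mu>" "measure \<mu> ((\<lambda>x. h \<otimes> x) ` A) = measure \<mu> A"
    if "h \<in> carrier G" "A \<in> sets \<mu>" for h A
    using haar that by (auto simp: normalized_haar_def)
  have vim: "(\<lambda>x. g \<otimes> x) -` A \<inter> space \<mu> = (\<lambda>x. inv g \<otimes> x) ` A" if "A \<in> sets \<mu>" for A
  proof -
    have A: "A \<subseteq> carrier G" using sets.sets_into_space[OF that] by simp
    show ?thesis
    proof (intro equalityI subsetI)
      fix x assume x: "x \<in> (\<lambda>x. g \<otimes> x) -` A \<inter> space \<mu>"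
      then have "x = inv g \<otimes> (g \<otimes> x)" using assms(2) by (simp add: m_assoc[symmetric])
      then show "x \<in> (\<lambda>x. inv g \<otimes> x) ` A" using x by blast
    next
      fix x assume "x \<in> (\<lambda>x. inv g \<otimes> x) ` A"
      then obtain y where "y \<in> A" "x = inv g \<otimes> y" by blast
      then show "x \<in> (\<lambda>x. g \<otimes> x) -` A \<inter> space \<mu>" using assms(2) A by (auto simp: m_assoc[symmetric])
    qed
  qed
  have meas: "(\<lambda>x. g \<otimes> x) \<in> measurable \<mu> \<mu>"
  proof (rule measurableI)
    fix A assume "A \<in> sets \<mu>"
    then show "(\<lambda>x. g \<otimes> x) -` A \<inter> space \<mu> \<in> sets \<mu>" using vim img assms(2) by simp
  qed (use assms in auto)
  have "distr \<mu> \<mu> (\<lambda>x. g \<otimes> x) = \<mu>"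
  proof (rule measure_eqI)
    fix A assume "A \<in> sets (distr \<mu> \<mu> (\<lambda>x. g \<otimes> x))"
    then have A: "A \<in> sets \<mu>" by simp
    show "emeasure (distr \<mu> \<mu> (\<lambda>x. g \<otimes> x)) A = emeasure \<mu> A"
      using img[of "inv g" A] assms(2) A unfolding emeasure_distr[OF meas A] vim[OF A]
      by (simp add: emeasure_eq_measure)
  qed simp
  then have "(\<integral>x. f x \<partial>\<mu>) = (\<integral>x. f x \<partial>distr \<mu> \<mu> (\<lambda>x. g \<otimes> x))" by simp
  also have "\<dots> = (\<integral>x. f (g \<otimes> x) \<partial>\<mu>)"
    by (rule integral_distr[OF meas cm_borel[OF assms(1)]])
  finally show ?thesis ..
qed

section \<open>Continuous kernels in two variables\<close>

lemma tube:
  fixes F :: "'g \<times> 'g \<Rightarrow> complex"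
  assumes "continuous_map (prod_topology T T) euclidean F" "x0 \<in> carrier G" "0 < e"
  shows "\<exists>U. openin T U \<and> x0 \<in> U \<and> (\<forall>x\<in>U. \<forall>y\<in>carrier G. norm (F (x, y) - F (x0, y)) < e)"
proof -
  let ?P = "prod_topology T T"
  have "continuous_map ?P ?P (\<lambda>z. (x0, snd z))"
    using assms(2) by (intro continuous_map_pairedI continuous_map_snd cm_const)
  then have "continuous_map ?P euclidean (\<lambda>z. F (x0, snd z))"
    using continuous_map_compose[OF _ assms(1)] by (fastforce simp: o_def)
  then have "continuous_map ?P euclidean (\<lambda>z. norm (F z - F (x0, snd z)))"
    using assms(1) by (intro continuous_intros)
  then have cl: "closedin ?P {z \<in> topspace ?P. norm (F z - F (x0, snd z)) \<in> {e..}}"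
    by (intro closedin_continuous_map_preimage) auto
  let ?C = "{z \<in> topspace ?P. norm (F z - F (x0, snd z)) \<in> {e..}}"
  \<comment> \<open>Compactness of the second factor makes the first projection a closed map, so the
    x for which some y violates the estimate form a closed set.\<close>
  have "closedin T (fst ` ?C)"
    using closed_map_fst[OF compact_T, of T] cl by (simp add: closed_map_def)
  then have "openin T (carrier G - fst ` ?C)" by (simp add: closedin_def)
  moreover have "x0 \<in> carrier G - fst ` ?C" using assms(2,3) by force
  moreover have "norm (F (x, y) - F (x0, y)) < e" if "x \<in> carrier G - fst ` ?C" "y \<in> carrier G" for x y
  proof (rule ccontr)
    assume "\<not> norm (F (x, y) - F (x0, y)) < e"
    then have "(x, y) \<in> ?C" using that by simp
    then have "fst (x, y) \<in> fst ` ?C" by (rule imageI)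
    then show False using that(1) by (simp only: fst_conv) blast
  qed
  ultimately show ?thesis by (intro exI[of _ "carrier G - fst ` ?C"]) blast
qed

lemma cm_section:
  fixes F :: "'g \<times> 'g \<Rightarrow> 'c::topological_space"
  assumes "continuous_map (prod_topology T T) euclidean F" "x \<in> carrier G"
  shows "continuous_map T euclidean (\<lambda>y. F (x, y))" "continuous_map T euclidean (\<lambda>y. F (y, x))"
  using continuous_map_compose[OF continuous_map_pairedI[OF cm_const[OF assms(2)] cm_id] assms(1)]
    continuous_map_compose[OF continuous_map_pairedI[OF cm_id cm_const[OF assms(2)]] assms(1)]
  by (auto simp: o_def)

text \<open>The estimate of \<open>tube\<close> is uniform in y and therefore survives integration
  against a measure of total mass 1.\<close>

lemma cont_param_integral:
  fixes F :: "'g \<times> 'g \<Rightarrow> complex"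
  assumes "continuous_map (prod_topology T T) euclidean F"
  shows "cont (\<lambda>x. \<integral>y. F (x, y) \<partial>\<mu>)"
proof -
  let ?f = "\<lambda>x. \<integral>y. F (x, y) \<partial>\<mu>"
  have "\<exists>U. openin T U \<and> x \<in> U \<and> (\<forall>y\<in>U. ?f y \<in> ball (?f x) e)" if x: "x \<in> carrier G" and e: "0 < e" for x e
  proof -
    obtain U where U: "openin T U" "x \<in> U" "\<And>x' y. x' \<in> U \<Longrightarrow> y \<in> carrier G \<Longrightarrow> norm (F (x', y) - F (x, y)) < e / 2"
      using tube[OF assms x, of "e / 2"] e by auto
    have "?f x' \<in> ball (?f x) e" if x': "x' \<in> U" for x'
    proof -
      have "x' \<in> carrier G" using openin_subset[OF U(1)] x' by auto
      then have c: "cont (\<lambda>y. F (x, y))" "cont (\<lambda>y. F (x', y))" using cm_section[OF assms] x by auto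
      have "norm (?f x' - ?f x) = norm (\<integral>y. F (x', y) - F (x, y) \<partial>\<mu>)"
        using c by (simp add: cm_integrable)
      also have "\<dots> \<le> e / 2" using c U(3)[OF x'] by (intro norm_integral_le continuous_map_diff) (auto intro: less_imp_le)
      finally show ?thesis using e by (simp add: dist_norm norm_minus_commute)
    qed
    then show ?thesis using U by blast
  qed
  then show ?thesis
    using Metric_space.continuous_map_to_metric[OF Met_TC.Metric_space_axioms, of T ?f] by simp
qed

text \<open>Without a countable base the Borel sets of G x G may exceed the product sigma-algebra,
  so continuity alone does not give this. By \<open>tube\<close> and compactness, F is uniformly
  close to functions equal to F (a, y) for x in a piece of a finite partition into measurable sets,
  and those are measurable for the product.\<close>

lemma cont2_measurable:
  fixes F :: "'g \<times> 'g \<Rightarrow> complex"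
  assumes F: "continuous_map (prod_topology T T) euclidean F"
  shows "F \<in> borel_measurable (\<mu> \<Otimes>\<^sub>M \<mu>)"
proof -
  have "\<exists>H. H \<in> borel_measurable (\<mu> \<Otimes>\<^sub>M \<mu>) \<and> (\<forall>x\<in>carrier G. \<forall>y\<in>carrier G. dist (H (x, y)) (F (x, y)) < e)"
    if e: "0 < e" for e
  proof -
    obtain U where U: "\<And>a. a \<in> carrier G \<Longrightarrow> openin T (U a)" "\<And>a. a \<in> carrier G \<Longrightarrow> a \<in> U a"
      "\<And>a x y. a \<in> carrier G \<Longrightarrow> x \<in> U a \<Longrightarrow> y \<in> carrier G \<Longrightarrow> norm (F (x, y) - F (a, y)) < e"
      using tube[OF F _ e] by metis
    have "carrier G \<subseteq> (\<Union>a\<in>carrier G. U a)" using U(2) by blast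
    then obtain A where A: "finite A" "A \<subseteq> carrier G" "carrier G \<subseteq> (\<Union>a\<in>A. U a)"
      using finite_subcover[of U] U(1) by blast
    obtain xs where xs: "set xs = A" using finite_list[OF A(1)] by blast
    \<comment> \<open>The fold selects the first a in the list whose neighbourhood contains the
      first coordinate. The default 0 is not reached on G when the neighbourhoods cover G.\<close>
    define H where "H ys z = foldr (\<lambda>a r. if fst z \<in> U a then F (a, snd z) else r) ys 0" for ys z
    have "H ys \<in> borel_measurable (\<mu> \<Otimes>\<^sub>M \<mu>)" if "set ys \<subseteq> carrier G" for ys
      using that
    proof (induction ys)
      case Nil
      have "H [] = (\<lambda>z. 0)" by (simp add: H_def fun_eq_iff)
      then show ?case by simp
    next
      case (Cons a ys)
      have a: "a \<in> carrier G" using Cons.prems by simp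
      have [measurable]: "U a \<in> sets \<mu>" using openin_sets[OF U(1)[OF a]] .
      have [measurable]: "(\<lambda>y. F (a, y)) \<in> borel_measurable \<mu>" using cm_borel[OF cm_section(1)[OF F a]] .
      have [measurable]: "H ys \<in> borel_measurable (\<mu> \<Otimes>\<^sub>M \<mu>)" using Cons by simp
      have "H (a # ys) = (\<lambda>z. if fst z \<in> U a then F (a, snd z) else H ys z)" by (simp add: H_def fun_eq_iff)
      then show ?case by simp
    qed
    moreover have "dist (H ys (x, y)) (F (x, y)) < e"
      if "set ys \<subseteq> carrier G" "x \<in> (\<Union>a\<in>set ys. U a)" "y \<in> carrier G" for ys x y
      using that
    proof (induction ys)
      case (Cons a ys)
      then show ?case using U(3)[of a x y] by (auto simp: H_def dist_norm norm_minus_commute)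
    qed simp
    ultimately show ?thesis using A xs by (intro exI[of _ "H xs"]) blast
  qed
  then have "\<forall>n. \<exists>H. H \<in> borel_measurable (\<mu> \<Otimes>\<^sub>M \<mu>) \<and> (\<forall>x\<in>carrier G. \<forall>y\<in>carrier G. dist (H (x, y)) (F (x, y)) < inverse (real (Suc n)))"
    by simp
  then obtain H where H: "\<And>n. H n \<in> borel_measurable (\<mu> \<Otimes>\<^sub>M \<mu>)"
    "\<And>n x y. x \<in> carrier G \<Longrightarrow> y \<in> carrier G \<Longrightarrow> dist (H n (x, y)) (F (x, y)) < inverse (real (Suc n))"
    by metis
  show ?thesis
  proof (rule borel_measurable_LIMSEQ_metric[OF H(1)])
    fix z assume "z \<in> space (\<mu> \<Otimes>\<^sub>M \<mu>)"
    then have "dist (H n z) (F z) \<le> inverse (real (Suc n))" for n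
      using H(2)[of "fst z" "snd z" n] by (auto simp: space_pair_measure)
    then show "(\<lambda>n. H n z) \<longlonglongrightarrow> F z"
      unfolding tendsto_dist_iff[of _ "F z"]
      by (intro tendsto_sandwich[OF _ _ tendsto_const LIMSEQ_inverse_real_of_nat]) auto
  qed
qed

lemma fubini:
  fixes F :: "'g \<times> 'g \<Rightarrow> complex"
  assumes F: "continuous_map (prod_topology T T) euclidean F"
  shows "(\<integral>y. (\<integral>x. F (x, y) \<partial>\<mu>) \<partial>\<mu>) = (\<integral>x. (\<integral>y. F (x, y) \<partial>\<mu>) \<partial>\<mu>)"
proof -
  interpret pair_sigma_finite \<mu> \<mu> ..
  interpret P: finite_measure "\<mu> \<Otimes>\<^sub>M \<mu>"
    by (rule finite_measure_pair_measure) unfold_locales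
  have "compact_space (prod_topology T T)" using compact_T by (simp add: compact_space_prod_topology)
  from cm_bounded[OF this F] obtain B where B: "\<And>x y. x \<in> carrier G \<Longrightarrow> y \<in> carrier G \<Longrightarrow> norm (F (x, y)) \<le> B"
    by auto
  have "integrable (\<mu> \<Otimes>\<^sub>M \<mu>) F"
    using B by (intro P.integrable_const_bound[of _ B] cont2_measurable[OF F]) (auto simp: space_pair_measure)
  then show ?thesis using Fubini_integral[of "\<lambda>x y. F (x, y)"] by simp
qed

text \<open>Consider the double integral of f (inv y x). Integrating over x first gives the integral
  of f, integrating over y first gives that of f (inv y); both inner integrals are evaluated by left
  invariance, and the total mass is 1.\<close>

lemma integral_inv:
  fixes f :: "'g \<Rightarrow> complex"
  assumes f: "cont f"
  shows "(\<integral>x. f (inv x) \<partial>\<mu>) = (\<integral>x. f x \<partial>\<mu>)"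
proof -
  let ?F = "\<lambda>z. f (inv (snd z) \<otimes> fst z)"
  have F: "continuous_map (prod_topology T T) euclidean ?F"
    by (intro cm_comp[OF f] continuous_intros continuous_map_fst continuous_map_snd)
  have "(\<integral>x. f x \<partial>\<mu>) = (\<integral>y. (\<integral>x. f (inv y \<otimes> x) \<partial>\<mu>) \<partial>\<mu>)"
  proof -
    have "(\<integral>y. (\<integral>x. f (inv y \<otimes> x) \<partial>\<mu>) \<partial>\<mu>) = (\<integral>y. (\<integral>x. f x \<partial>\<mu>) \<partial>\<mu>)"
      by (rule Bochner_Integration.integral_cong[OF refl]) (simp add: integral_left_invariant[OF f])
    then show ?thesis by simp
  qed
  also have "\<dots> = (\<integral>x. (\<integral>y. f (inv y \<otimes> x) \<partial>\<mu>) \<partial>\<mu>)"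
    using fubini[OF F] by simp
  also have "\<dots> = (\<integral>x. (\<integral>y. f (inv y) \<partial>\<mu>) \<partial>\<mu>)"
  proof (rule Bochner_Integration.integral_cong[OF refl])
    fix x assume "x \<in> space \<mu>"
    then have x: "x \<in> carrier G" by simp
    have "cont (\<lambda>y. f (inv y))" by (intro cm_comp[OF f] continuous_intros)
    then have "(\<integral>y. f (inv y) \<partial>\<mu>) = (\<integral>y. f (inv (inv x \<otimes> y)) \<partial>\<mu>)"
      using integral_left_invariant[of "\<lambda>y. f (inv y)" "inv x"] x by simp
    also have "\<dots> = (\<integral>y. f (inv y \<otimes> x) \<partial>\<mu>)"
      using x by (intro Bochner_Integration.integral_cong) (auto simp: inv_mult_group)
    finally show "(\<integral>y. f (inv y \<otimes> x) \<partial>\<mu>) = (\<integral>y. f (inv y) \<partial>\<mu>)" ..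
  qed
  finally show ?thesis by simp
qed

lemma integral_right_invariant:
  fixes f :: "'g \<Rightarrow> complex"
  assumes f: "cont f" and g: "g \<in> carrier G"
  shows "(\<integral>x. f (x \<otimes> g) \<partial>\<mu>) = (\<integral>x. f x \<partial>\<mu>)"
proof -
  have c: "cont (\<lambda>x. f (x \<otimes> g))" "cont (\<lambda>x. f (inv x))"
    by (intro cm_comp[OF f] continuous_intros g)+
  have "(\<integral>x. f (x \<otimes> g) \<partial>\<mu>) = (\<integral>x. f (inv x \<otimes> g) \<partial>\<mu>)"
    using integral_inv[OF c(1)] by simp
  also have "\<dots> = (\<integral>x. f (inv (inv g \<otimes> x)) \<partial>\<mu>)"
    using g by (intro Bochner_Integration.integral_cong) (auto simp: inv_mult_group)
  also have "\<dots> = (\<integral>x. f (inv x) \<partial>\<mu>)"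
    using integral_left_invariant[OF c(2), of "inv g"] g by simp
  finally show ?thesis using integral_inv[OF f] by simp
qed

lemma integral_conj_invariant:
  fixes f :: "'g \<Rightarrow> complex"
  assumes f: "cont f" and g: "g \<in> carrier G"
  shows "(\<integral>x. f (g \<otimes> x \<otimes> inv g) \<partial>\<mu>) = (\<integral>x. f x \<partial>\<mu>)"
proof -
  have "cont (\<lambda>x. f (x \<otimes> inv g))" using g by (intro cm_comp[OF f] continuous_intros) auto
  from integral_left_invariant[OF this g] show ?thesis
    using integral_right_invariant[OF f, of "inv g"] g by simp
qed

text \<open>Translates of the open set where |f|^2 exceeds half its value at a cover G, and finitely
  many suffice. The corresponding translates of |f|^2 all have integral zero, while their sum is
  bounded below by a positive constant on G.\<close>

lemma integral_zero_imp_zero: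
  fixes f :: "'g \<Rightarrow> complex"
  assumes f: "cont f" and nz: "(\<integral>x. (cmod (f x))\<^sup>2 \<partial>\<mu>) = 0" and a: "a \<in> carrier G"
  shows "f a = 0"
proof (rule ccontr)
  assume "f a \<noteq> 0"
  define g where "g = (\<lambda>x. (cmod (f x))\<^sup>2)"
  have g: "continuous_map T euclidean g" unfolding g_def by (intro continuous_intros f)
  define e where "e = g a / 2"
  have e: "0 < e" "e < g a" using \<open>f a \<noteq> 0\<close> by (auto simp: e_def g_def)
  define V where "V y = {x \<in> topspace T. g (y \<otimes> x) \<in> {e<..}}" for y
  have cg: "continuous_map T euclidean (\<lambda>x. g (y \<otimes> x))" if "y \<in> carrier G" for y
    using continuous_map_compose[OF cm_mult[OF cm_const[OF that] cm_id] g] by (simp add: o_def)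
  have V: "openin T (V y)" if "y \<in> carrier G" for y
    unfolding V_def by (intro openin_continuous_map_preimage[OF cg[OF that]]) simp
  have "carrier G \<subseteq> (\<Union>y\<in>carrier G. V y)"
  proof
    fix x assume x: "x \<in> carrier G"
    then have "x \<in> V (a \<otimes> inv x)" using a e by (simp add: V_def m_assoc)
    moreover have "a \<otimes> inv x \<in> carrier G" using a x by simp
    ultimately show "x \<in> (\<Union>y\<in>carrier G. V y)" by blast
  qed
  then obtain Y where Y: "finite Y" "Y \<subseteq> carrier G" "carrier G \<subseteq> (\<Union>y\<in>Y. V y)"
    using finite_subcover[of V] V by blast
  have "e \<le> (\<integral>x. (\<Sum>y\<in>Y. g (y \<otimes> x)) \<partial>\<mu>)"
  proof (rule integral_ge_const)
    show "continuous_map T euclidean (\<lambda>x. \<Sum>y\<in>Y. g (y \<otimes> x))"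
      using Y by (intro continuous_map_sum cg) auto
    fix x assume "x \<in> carrier G"
    then obtain y where y: "y \<in> Y" "x \<in> V y" using Y(3) by blast
    then have "e \<le> g (y \<otimes> x)" by (simp add: V_def)
    also have "\<dots> \<le> (\<Sum>y\<in>Y. g (y \<otimes> x))"
      using y Y(1) by (intro member_le_sum) (auto simp: g_def)
    finally show "e \<le> (\<Sum>y\<in>Y. g (y \<otimes> x))" .
  qed
  also have "\<dots> = (\<Sum>y\<in>Y. \<integral>x. g (y \<otimes> x) \<partial>\<mu>)"
    using Y cg by (intro Bochner_Integration.integral_sum cm_integrable) auto
  also have "\<dots> = 0"
  proof (rule sum.neutral, rule ballI)
    fix y assume "y \<in> Y"
    then have y: "y \<in> carrier G" using Y by auto
    have c: "cont (\<lambda>x. complex_of_real (g x))"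
      using g by (simp add: continuous_map_atin tendsto_of_real)
    have "complex_of_real (\<integral>x. g (y \<otimes> x) \<partial>\<mu>) = of_real (\<integral>x. g x \<partial>\<mu>)"
      using integral_left_invariant[OF c y] by simp
    then show "(\<integral>x. g (y \<otimes> x) \<partial>\<mu>) = 0" using nz by (simp add: g_def)
  qed
  finally show False using e by simp
qed

end

section \<open>Schur's lemma\<close>

text \<open>Matrices are functions on all pairs of indices, with arbitrary values outside the
  relevant block. Equality on the m x n block therefore takes the place of equality.\<close>

definition meq :: "nat \<Rightarrow> nat \<Rightarrow> (nat \<Rightarrow> nat \<Rightarrow> complex) \<Rightarrow> (nat \<Rightarrow> nat \<Rightarrow> complex) \<Rightarrow> bool" where
  "meq m n A B \<longleftrightarrow> (\<forall>i<m. \<forall>j<n. A i j = B i j)"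

definition adj :: "(nat \<Rightarrow> nat \<Rightarrow> complex) \<Rightarrow> nat \<Rightarrow> nat \<Rightarrow> complex" where
  "adj A = (\<lambda>i j. cnj (A j i))"

definition smat :: "complex \<Rightarrow> nat \<Rightarrow> nat \<Rightarrow> complex" where
  "smat c = (\<lambda>i j. if i = j then c else 0)"

lemma meq_refl [simp]: "meq m n A A" by (simp add: meq_def)
lemma meq_sym: "meq m n A B \<Longrightarrow> meq m n B A" by (simp add: meq_def)
lemma meq_trans [trans]: "meq m n A B \<Longrightarrow> meq m n B C \<Longrightarrow> meq m n A C" by (simp add: meq_def)
lemma meqD: "meq m n A B \<Longrightarrow> i < m \<Longrightarrow> j < n \<Longrightarrow> A i j = B i j" by (simp add: meq_def)
lemma meq_adj: "meq m n A B \<Longrightarrow> meq n m (adj A) (adj B)" by (simp add: meq_def adj_def)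

lemma meq_mult: "meq m k A A' \<Longrightarrow> meq k n B B' \<Longrightarrow> meq m n (mat_mult k A B) (mat_mult k A' B')"
  by (simp add: meq_def mat_mult_def)

lemma adj_adj [simp]: "adj (adj A) = A" by (simp add: adj_def)

lemma adj_mult: "adj (mat_mult d A B) = mat_mult d (adj B) (adj A)"
  by (simp add: adj_def mat_mult_def mult.commute)

lemma mat_mult_assoc: "mat_mult d (mat_mult e A B) C = mat_mult e A (mat_mult d B C)"
  unfolding mat_mult_def sum_distrib_left sum_distrib_right
  by (intro ext, subst sum.swap) (simp add: mult.assoc)

lemma smat_mult_left: "meq m n (mat_mult m (smat c) A) (\<lambda>i j. c * A i j)"
proof -
  have "(\<Sum>k<m. (if i = k then c else 0) * A k j) = c * A i j" if "i < m" for i j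
    using that by (subst sum.remove[of _ i]) (auto intro!: sum.neutral)
  then show ?thesis by (simp add: meq_def mat_mult_def smat_def)
qed

lemma smat_mult_right: "meq m n (mat_mult n A (smat c)) (\<lambda>i j. c * A i j)"
proof -
  have "(\<Sum>k<n. A i k * (if k = j then c else 0)) = c * A i j" if "j < n" for i j
    using that by (subst sum.remove[of _ j]) (auto intro!: sum.neutral)
  then show ?thesis by (simp add: meq_def mat_mult_def smat_def)
qed

lemma meq_one_right: "meq m n (mat_mult n A (smat 1)) A"
  using smat_mult_right[of m n A 1] by simp

lemma meq_one_left: "meq m n (mat_mult m (smat 1) A) A"
  using smat_mult_left[of m n 1 A] by simp

lemma is_unitary_iff: "is_unitary d A \<longleftrightarrow> meq d d (mat_mult d A (adj A)) (smat 1)"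
  by (simp add: is_unitary_def meq_def mat_mult_def adj_def smat_def)

text \<open>\<open>is_unitary\<close> states orthonormality of the rows. That of the columns comes
  from finite dimension: a one-sided inverse of a square matrix is two-sided.\<close>

lemma unitary_left_inverse:
  assumes "is_unitary d A"
  shows "meq d d (mat_mult d (adj A) A) (smat 1)"
proof -
  let ?M = "\<lambda>A. mat d d (\<lambda>(i, j). A i j)"
  have mult: "?M A * ?M B = ?M (mat_mult d A B)" for A B
    by (rule eq_matI) (auto simp: mat_mult_def scalar_prod_def atLeast0LessThan)
  have one: "1\<^sub>m d = ?M (smat 1)" by (rule eq_matI) (auto simp: smat_def)
  have "?M A * ?M (adj A) = 1\<^sub>m d"
    unfolding mult one by (rule eq_matI) (use assms in \<open>auto simp: is_unitary_iff meq_def\<close>)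
  then have e: "?M (adj A) * ?M A = 1\<^sub>m d"
    by (rule mat_mult_left_right_inverse[rotated 2]) auto
  have "mat_mult d (adj A) A i j = smat 1 i j" if "i < d" "j < d" for i j
    using arg_cong[OF e, of "\<lambda>X. X $$ (i, j)"] that unfolding mult one by simp
  then show ?thesis by (simp add: meq_def)
qed

lemma mat_vec_mult: "mat_vec d A (mat_vec d B v) = mat_vec d (mat_mult d A B) v"
  unfolding mat_vec_def mat_mult_def
  by (rule ext) (auto simp: sum_distrib_left sum_distrib_right mult.assoc intro: trans[OF sum.swap])

text \<open>This is where algebraic closedness of the complex numbers enters Schur's lemma.\<close>

lemma ex_eigenvector:
  assumes "0 < d"
  shows "\<exists>c v. v \<in> cvecs d \<and> v \<noteq> (\<lambda>_. 0) \<and> mat_vec d A v = (\<lambda>i. c * v i)"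
proof -
  let ?M = "mat d d (\<lambda>(i, j). A i j)"
  have "spectrum ?M \<noteq> {}" by (rule spectrum_non_empty[of _ d]) (use assms in auto)
  then obtain c w where "eigenvector ?M w c" by (auto simp: spectrum_def eigenvalue_def)
  then have w: "w \<in> carrier_vec d" "w \<noteq> 0\<^sub>v d" "?M *\<^sub>v w = c \<cdot>\<^sub>v w"
    by (auto simp: eigenvector_def)
  define v where "v i = (if i < d then vec_index w i else 0)" for i
  have "v \<noteq> (\<lambda>_. 0)"
  proof
    assume v0: "v = (\<lambda>_. 0)"
    have "vec_index w i = 0" if "i < d" for i using fun_cong[OF v0, of i] that by (simp add: v_def)
    then show False using w(1,2) by auto
  qed
  moreover have "mat_vec d A v i = c * v i" for i
  proof (cases "i < d")
    case True
    have "vec_index (?M *\<^sub>v w) i = c * vec_index w i" using w True by simp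
    then show ?thesis using True w(1) by (simp add: mat_vec_def v_def scalar_prod_def atLeast0LessThan)
  qed (simp add: mat_vec_def v_def)
  moreover have "v \<in> cvecs d" by (simp add: cvecs_def v_def)
  ultimately show ?thesis by blast
qed

section \<open>Unitary representations and intertwiners\<close>

context group
begin

context
  fixes T :: "'a topology" and d :: nat and \<pi> :: "'a \<Rightarrow> nat \<Rightarrow> nat \<Rightarrow> complex"
  assumes rep: "unitary_rep G T (d, \<pi>)"
begin

lemma rep_unitary: "g \<in> carrier G \<Longrightarrow> is_unitary d (\<pi> g)"
  using rep by (simp add: unitary_rep_def)

lemma rep_mult:
  "g \<in> carrier G \<Longrightarrow> h \<in> carrier G \<Longrightarrow> meq d d (\<pi> (g \<otimes> h)) (mat_mult d (\<pi> g) (\<pi> h))"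
  using rep by (simp add: unitary_rep_def meq_def)

lemma rep_cont: "i < d \<Longrightarrow> j < d \<Longrightarrow> continuous_map T euclidean (\<lambda>g. \<pi> g i j)"
  using rep by (simp add: unitary_rep_def)

lemma rep_mult_adj: "g \<in> carrier G \<Longrightarrow> meq d d (mat_mult d (\<pi> g) (adj (\<pi> g))) (smat 1)"
  using rep_unitary by (simp add: is_unitary_iff)

text \<open>\<open>unitary_rep\<close> speaks of products only; the values at the unit and at
  inverses are obtained by cancelling \<open>\<pi> g\<close> against its adjoint.\<close>

lemma rep_cancel:
  assumes "g \<in> carrier G"
  shows "meq m d A (mat_mult d (mat_mult d A (\<pi> g)) (adj (\<pi> g)))"
proof -
  have "meq m d A (mat_mult d A (smat 1))" by (rule meq_sym[OF meq_one_right])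
  also have "meq m d \<dots> (mat_mult d A (mat_mult d (\<pi> g) (adj (\<pi> g))))"
    by (rule meq_mult[OF meq_refl meq_sym[OF rep_mult_adj[OF assms]]])
  finally show ?thesis by (simp add: mat_mult_assoc)
qed

lemma rep_one: "meq d d (\<pi> \<one>) (smat 1)"
proof -
  have "meq d d (\<pi> \<one>) (mat_mult d (mat_mult d (\<pi> \<one>) (\<pi> \<one>)) (adj (\<pi> \<one>)))"
    by (rule rep_cancel) simp
  also have "meq d d \<dots> (mat_mult d (\<pi> \<one>) (adj (\<pi> \<one>)))"
    using rep_mult[of \<one> \<one>] by (intro meq_mult meq_refl) (simp add: meq_sym)
  also have "meq d d \<dots> (smat 1)" by (rule rep_mult_adj) simp
  finally show ?thesis .
qed

lemma rep_inv:
  assumes "g \<in> carrier G"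
  shows "meq d d (\<pi> (inv g)) (adj (\<pi> g))"
proof -
  have "meq d d (\<pi> (inv g)) (mat_mult d (mat_mult d (\<pi> (inv g)) (\<pi> g)) (adj (\<pi> g)))"
    by (rule rep_cancel[OF assms])
  also have "meq d d \<dots> (mat_mult d (smat 1) (adj (\<pi> g)))"
    using rep_mult[of "inv g" g] rep_one assms
    by (intro meq_mult meq_refl) (simp, blast intro: meq_sym meq_trans)
  also have "meq d d \<dots> (adj (\<pi> g))" by (rule meq_one_left)
  finally show ?thesis .
qed

lemma rep_inv_entry:
  assumes "g \<in> carrier G" "i < d" "j < d"
  shows "\<pi> (inv g) i j = cnj (\<pi> g j i)"
  using meqD[OF rep_inv[OF assms(1)] assms(2,3)] by (simp add: adj_def)

lemma rep_mult_entry: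
  assumes "g \<in> carrier G" "h \<in> carrier G" "i < d" "j < d"
  shows "\<pi> (g \<otimes> h) i j = (\<Sum>k<d. \<pi> g i k * \<pi> h k j)"
  using meqD[OF rep_mult[OF assms(1,2)] assms(3,4)] by (simp add: mat_mult_def)

lemma rep_adj_mult: "g \<in> carrier G \<Longrightarrow> meq d d (mat_mult d (adj (\<pi> g)) (\<pi> g)) (smat 1)"
  by (rule unitary_left_inverse[OF rep_unitary])

end

text \<open>An eigenspace of A is nonzero and invariant under the representation, hence by
  irreducibility the whole space.\<close>

lemma schur_scalar:
  assumes irr: "irreducible_rep G T (d, \<pi>)"
    and comm: "\<And>g. g \<in> carrier G \<Longrightarrow> meq d d (mat_mult d A (\<pi> g)) (mat_mult d (\<pi> g) A)"
  shows "\<exists>c. meq d d A (smat c)"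
proof -
  have d: "0 < d" using irr by (simp add: irreducible_rep_def)
  obtain c v where v: "v \<in> cvecs d" "v \<noteq> (\<lambda>_. 0)" "mat_vec d A v = (\<lambda>i. c * v i)"
    using ex_eigenvector[OF d] by blast
  define W where "W = {v \<in> cvecs d. mat_vec d A v = (\<lambda>i. c * v i)}"
  have W: "csubspace d W"
    unfolding csubspace_def
  proof (intro conjI ballI allI)
    show "W \<subseteq> cvecs d" "(\<lambda>_. 0) \<in> W" by (auto simp: W_def cvecs_def mat_vec_def)
    fix v assume v: "v \<in> W"
    show "(\<lambda>i. v i + w i) \<in> W" if "w \<in> W" for w
    proof -
      have "mat_vec d A (\<lambda>i. v i + w i) i = mat_vec d A v i + mat_vec d A w i" for i
        by (simp add: mat_vec_def distrib_left sum.distrib)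
      then show ?thesis using v that by (auto simp: W_def cvecs_def distrib_left)
    qed
    show "(\<lambda>i. a * v i) \<in> W" for a
    proof -
      have "mat_vec d A (\<lambda>i. a * v i) i = a * mat_vec d A v i" for i
        by (simp add: mat_vec_def sum_distrib_left mult.left_commute)
      then show ?thesis using v by (auto simp: W_def cvecs_def mult.left_commute)
    qed
  qed
  have "mat_vec d (\<pi> g) v \<in> W" if g: "g \<in> carrier G" and "v \<in> W" for g v
  proof -
    have v: "mat_vec d A v = (\<lambda>i. c * v i)" using that by (simp add: W_def)
    have "mat_vec d (mat_mult d A (\<pi> g)) v = mat_vec d (mat_mult d (\<pi> g) A) v"
      using comm[OF g] by (auto simp: mat_vec_def meq_def)
    then have "mat_vec d A (mat_vec d (\<pi> g) v) = mat_vec d (\<pi> g) (\<lambda>i. c * v i)"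
      by (simp add: mat_vec_mult[symmetric] v)
    also have "\<dots> = (\<lambda>i. c * mat_vec d (\<pi> g) v i)"
      by (auto simp: mat_vec_def sum_distrib_left mult.left_commute)
    finally show ?thesis by (simp add: W_def cvecs_def mat_vec_def)
  qed
  then have "W = {\<lambda>_. 0} \<or> W = cvecs d"
    using irr W by (simp add: irreducible_rep_def)
  moreover have "v \<in> W" using v by (simp add: W_def)
  ultimately have Wall: "W = cvecs d" using v(2) by auto
  have "A i j = smat c i j" if ij: "i < d" "j < d" for i j
  proof -
    have "(\<lambda>k. if k = j then 1 else 0) \<in> W" unfolding Wall using ij by (auto simp: cvecs_def)
    then have "mat_vec d A (\<lambda>k. if k = j then 1 else 0) i = c * (if i = j then 1 else 0)" by (auto simp: W_def)
    moreover have "mat_vec d A (\<lambda>k. if k = j then 1 else 0) i = A i j"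
      using ij by (simp add: mat_vec_def if_distrib cong: if_cong)
    ultimately show ?thesis by (simp add: smat_def)
  qed
  then show ?thesis by (auto simp: meq_def)
qed

text \<open>The product of B with its adjoint, in either order, commutes with a representation and
  so is a scalar, c or c'. Computing B (adj B) B in two ways gives c = c', comparing traces gives d
  = e, and the adjoint divided by the square root of c is a unitary equivalence.\<close>

lemma schur_equiv:
  assumes r: "irreducible_rep G T (d, \<pi>)" and s: "irreducible_rep G T (e, \<sigma>)"
    and comm: "\<And>g. g \<in> carrier G \<Longrightarrow> meq d e (mat_mult d (\<pi> g) B) (mat_mult e B (\<sigma> g))"
    and nz: "\<not> meq d e B (\<lambda>i j. 0)"
  shows "rep_equiv G (d, \<pi>) (e, \<sigma>)"
proof -
  have ur: "unitary_rep G T (d, \<pi>)" and us: "unitary_rep G T (e, \<sigma>)"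
    using r s by (auto simp: irreducible_rep_def)
  have comm': "meq e d (mat_mult d (adj B) (\<pi> g)) (mat_mult e (\<sigma> g) (adj B))" if g: "g \<in> carrier G" for g
  proof -
    have "meq d d (\<pi> g) (adj (\<pi> (inv g)))" and "meq e e (\<sigma> g) (adj (\<sigma> (inv g)))"
      using rep_inv[OF ur, of "inv g"] rep_inv[OF us, of "inv g"] g by simp_all
    then have "meq e d (mat_mult d (adj B) (\<pi> g)) (mat_mult d (adj B) (adj (\<pi> (inv g))))"
      "meq e d (mat_mult e (adj (\<sigma> (inv g))) (adj B)) (mat_mult e (\<sigma> g) (adj B))"
      by (auto intro: meq_mult meq_sym)
    moreover have "meq e d (mat_mult d (adj B) (adj (\<pi> (inv g)))) (mat_mult e (adj (\<sigma> (inv g))) (adj B))"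
      using meq_adj[OF comm[of "inv g"]] g by (simp add: adj_mult)
    ultimately show ?thesis by (blast intro: meq_trans)
  qed
  have "\<exists>c. meq d d (mat_mult e B (adj B)) (smat c)"
  proof (rule schur_scalar[OF r])
    fix g assume g: "g \<in> carrier G"
    have "meq d d (mat_mult d (mat_mult e B (adj B)) (\<pi> g)) (mat_mult e B (mat_mult e (\<sigma> g) (adj B)))"
      unfolding mat_mult_assoc by (rule meq_mult[OF meq_refl comm'[OF g]])
    also have "meq d d \<dots> (mat_mult d (\<pi> g) (mat_mult e B (adj B)))"
      unfolding mat_mult_assoc[symmetric] by (rule meq_mult[OF meq_sym[OF comm[OF g]] meq_refl])
    finally show "meq d d (mat_mult d (mat_mult e B (adj B)) (\<pi> g)) (mat_mult d (\<pi> g) (mat_mult e B (adj B)))" .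
  qed
  then obtain c where c: "meq d d (mat_mult e B (adj B)) (smat c)" by blast
  have "\<exists>c. meq e e (mat_mult d (adj B) B) (smat c)"
  proof (rule schur_scalar[OF s])
    fix g assume g: "g \<in> carrier G"
    have "meq e e (mat_mult e (mat_mult d (adj B) B) (\<sigma> g)) (mat_mult d (adj B) (mat_mult d (\<pi> g) B))"
      unfolding mat_mult_assoc by (rule meq_mult[OF meq_refl meq_sym[OF comm[OF g]]])
    also have "meq e e \<dots> (mat_mult e (\<sigma> g) (mat_mult d (adj B) B))"
      unfolding mat_mult_assoc[symmetric] by (rule meq_mult[OF comm'[OF g] meq_refl])
    finally show "meq e e (mat_mult e (mat_mult d (adj B) B) (\<sigma> g)) (mat_mult e (\<sigma> g) (mat_mult d (adj B) B))" .
  qed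
  then obtain c' where c': "meq e e (mat_mult d (adj B) B) (smat c')" by blast
  \<comment> \<open>The squared Hilbert-Schmidt norm of B is the trace of both products, so n = d c
    = e c'; it is positive as B is nonzero.\<close>
  define n where "n = (\<Sum>i<d. \<Sum>j<e. (cmod (B i j))\<^sup>2)"
  have mod: "of_real ((cmod z)\<^sup>2) = z * cnj z" for z
    by (rule complex_norm_square)
  have "(\<Sum>i<d. mat_mult e B (adj B) i i) = of_nat d * c"
    using c by (simp add: meq_def smat_def)
  then have n1: "of_real n = of_nat d * c"
    by (simp add: n_def mat_mult_def adj_def mod del: of_real_power)
  have "(\<Sum>j<e. mat_mult d (adj B) B j j) = of_nat e * c'"
    using c' by (simp add: meq_def smat_def)
  then have n2: "of_real n = of_nat e * c'"
    unfolding n_def by (subst sum.swap) (simp add: mat_mult_def adj_def mod mult.commute del: of_real_power)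
  obtain i j where ij: "i < d" "j < e" "B i j \<noteq> 0" using nz by (auto simp: meq_def)
  have "0 < (cmod (B i j))\<^sup>2" using ij by simp
  also have "\<dots> \<le> (\<Sum>j<e. (cmod (B i j))\<^sup>2)" using ij by (intro member_le_sum) auto
  also have "\<dots> \<le> n" unfolding n_def using ij by (intro member_le_sum[of i "{..<d}" "\<lambda>i. \<Sum>j<e. (cmod (B i j))\<^sup>2"] ) (auto intro: sum_nonneg)
  finally have n: "0 < n" .
  have "meq d e (\<lambda>i j. c * B i j) (mat_mult d (mat_mult e B (adj B)) B)"
    by (rule meq_trans[OF meq_sym[OF smat_mult_left]], rule meq_mult[OF meq_sym[OF c] meq_refl])
  also have "meq d e \<dots> (\<lambda>i j. c' * B i j)"
    unfolding mat_mult_assoc by (rule meq_trans[OF _ smat_mult_right], rule meq_mult[OF meq_refl c'])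
  finally have "c * B i j = c' * B i j" using ij(1,2) unfolding meq_def by blast
  then have cc: "c = c'" using ij by simp
  have d0: "0 < d" using r by (simp add: irreducible_rep_def)
  have c_eq: "c = of_real (n / real d)" using n1 d0 by (simp add: field_simps)
  have "c \<noteq> 0" using c_eq n d0 by simp
  have de: "d = e"
  proof -
    note \<open>c \<noteq> 0\<close>
    moreover have "of_nat d * c = of_nat e * c" using n1 n2 cc by metis
    ultimately show ?thesis by simp
  qed
  \<comment> \<open>Since c = n / d, this is the square root of c, which normalises the adjoint of B
    to a unitary matrix.\<close>
  define t where "t = sqrt (n / real d)"
  have t: "0 < t" "c = of_real t * of_real t"
    using n d0 by (simp_all add: t_def c_eq flip: of_real_mult)
  define U where "U = (\<lambda>i j. adj B i j / of_real t)"
  have "is_unitary d U"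
    unfolding is_unitary_iff meq_def
  proof (intro allI impI)
    fix i j assume "i < d" "j < d"
    have "mat_mult d U (adj U) i j = mat_mult d (adj B) B i j / c"
      by (simp add: mat_mult_def U_def adj_def t(2) sum_divide_distrib)
    also have "\<dots> = smat 1 i j"
      using meqD[OF c', of i j] \<open>i < d\<close> \<open>j < d\<close> de cc \<open>c \<noteq> 0\<close> by (simp add: smat_def)
    finally show "mat_mult d U (adj U) i j = smat 1 i j" .
  qed
  moreover have "mat_mult d U (\<pi> g) i j = mat_mult d (\<sigma> g) U i j" if "g \<in> carrier G" "i < d" "j < d" for g i j
    using meqD[OF comm'[OF that(1)], of i j] that de
    by (simp add: mat_mult_def U_def sum_divide_distrib[symmetric])
  ultimately show ?thesis using de by (auto simp: rep_equiv_def)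
qed

section \<open>Unitary equivalence, characters and the dual\<close>

lemma rep_equiv_iff:
  "rep_equiv G (d, \<pi>) (e, \<sigma>) \<longleftrightarrow> d = e \<and> (\<exists>U. is_unitary d U \<and>
     (\<forall>g\<in>carrier G. meq d d (mat_mult d U (\<pi> g)) (mat_mult d (\<sigma> g) U)))"
  by (auto simp: rep_equiv_def meq_def)

lemma rep_equiv_refl: "rep_equiv G r r"
proof -
  obtain d \<pi> where r: "r = (d, \<pi>)" by (cases r)
  have "is_unitary d (smat 1)"
    using smat_mult_left[of d d 1 "adj (smat 1)"] by (simp add: is_unitary_iff) (simp add: adj_def smat_def meq_def)
  moreover have "meq d d (mat_mult d (smat 1) (\<pi> g)) (mat_mult d (\<pi> g) (smat 1))" for g
    using meq_trans[OF smat_mult_left[of d d 1 "\<pi> g"] meq_sym[OF smat_mult_right[of d d "\<pi> g" 1]]] .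
  ultimately show ?thesis unfolding r rep_equiv_iff by blast
qed

lemma rep_equiv_sym:
  assumes "rep_equiv G r s"
  shows "rep_equiv G s r"
proof -
  obtain d \<pi> \<sigma> where r: "r = (d, \<pi>)" and s: "s = (d, \<sigma>)"
    using assms by (cases r, cases s) (auto simp: rep_equiv_def)
  obtain U where U: "is_unitary d U" "\<And>g. g \<in> carrier G \<Longrightarrow> meq d d (mat_mult d U (\<pi> g)) (mat_mult d (\<sigma> g) U)"
    using assms unfolding r s rep_equiv_iff by blast
  have "is_unitary d (adj U)" using unitary_left_inverse[OF U(1)] by (simp add: is_unitary_iff)
  moreover have "meq d d (mat_mult d (adj U) (\<sigma> g)) (mat_mult d (\<pi> g) (adj U))" if g: "g \<in> carrier G" for g
  proof -
    have "meq d d (mat_mult d (adj U) (\<sigma> g)) (mat_mult d (mat_mult d (adj U) (\<sigma> g)) (mat_mult d U (adj U)))"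
      by (rule meq_trans[OF meq_sym[OF meq_one_right] meq_mult[OF meq_refl meq_sym[OF U(1)[unfolded is_unitary_iff]]]])
    also have "\<dots> = mat_mult d (adj U) (mat_mult d (mat_mult d (\<sigma> g) U) (adj U))" by (simp add: mat_mult_assoc)
    also have "meq d d \<dots> (mat_mult d (adj U) (mat_mult d (mat_mult d U (\<pi> g)) (adj U)))"
      by (intro meq_mult meq_refl meq_sym[OF U(2)[OF g]])
    also have "\<dots> = mat_mult d (mat_mult d (adj U) U) (mat_mult d (\<pi> g) (adj U))" by (simp add: mat_mult_assoc)
    also have "meq d d \<dots> (mat_mult d (\<pi> g) (adj U))"
      by (rule meq_trans[OF meq_mult[OF unitary_left_inverse[OF U(1)] meq_refl] meq_one_left])
    finally show ?thesis .
  qed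
  ultimately show ?thesis unfolding r s rep_equiv_iff by blast
qed

lemma rep_equiv_trans:
  assumes "rep_equiv G r s" "rep_equiv G s t"
  shows "rep_equiv G r t"
proof -
  define d \<pi> \<sigma> \<tau> where "d = fst r" "\<pi> = snd r" "\<sigma> = snd s" "\<tau> = snd t"
  then have r: "r = (d, \<pi>)" and s: "s = (d, \<sigma>)" and t: "t = (d, \<tau>)"
    using assms by (simp_all add: rep_equiv_def prod_eq_iff)
  obtain U where U: "is_unitary d U" "\<And>g. g \<in> carrier G \<Longrightarrow> meq d d (mat_mult d U (\<pi> g)) (mat_mult d (\<sigma> g) U)"
    using assms(1) unfolding r s rep_equiv_iff by blast
  obtain V where V: "is_unitary d V" "\<And>g. g \<in> carrier G \<Longrightarrow> meq d d (mat_mult d V (\<sigma> g)) (mat_mult d (\<tau> g) V)"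
    using assms(2) unfolding s t rep_equiv_iff by blast
  have "meq d d (mat_mult d V (mat_mult d (mat_mult d U (adj U)) (adj V))) (mat_mult d V (adj V))"
    by (rule meq_mult[OF meq_refl meq_trans[OF meq_mult[OF U(1)[unfolded is_unitary_iff] meq_refl] meq_one_left]])
  also have "meq d d (mat_mult d V (adj V)) (smat 1)" using V(1) by (simp add: is_unitary_iff)
  finally have "is_unitary d (mat_mult d V U)" by (simp add: is_unitary_iff adj_mult mat_mult_assoc)
  moreover have "meq d d (mat_mult d (mat_mult d V U) (\<pi> g)) (mat_mult d (\<tau> g) (mat_mult d V U))" if g: "g \<in> carrier G" for g
  proof -
    have "meq d d (mat_mult d V (mat_mult d U (\<pi> g))) (mat_mult d V (mat_mult d (\<sigma> g) U))"
      by (intro meq_mult meq_refl U(2) g)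
    also have "\<dots> = mat_mult d (mat_mult d V (\<sigma> g)) U" by (simp add: mat_mult_assoc)
    also have "meq d d \<dots> (mat_mult d (mat_mult d (\<tau> g) V) U)" by (intro meq_mult meq_refl V(2) g)
    finally show ?thesis by (simp add: mat_mult_assoc)
  qed
  ultimately show ?thesis unfolding r t rep_equiv_iff by blast
qed

definition rep_char :: "'a rep \<Rightarrow> 'a \<Rightarrow> complex" where
  "rep_char r g = (\<Sum>i<fst r. snd r g i i)"

lemma trace_mult_commute: "(\<Sum>i<d. mat_mult d A B i i) = (\<Sum>i<d. mat_mult d B A i i)"
  unfolding mat_mult_def by (subst sum.swap) (simp add: mult.commute)

lemma rep_equiv_char:
  assumes "rep_equiv G r s" "g \<in> carrier G"
  shows "rep_char r g = rep_char s g"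
proof -
  obtain d \<pi> \<sigma> where r: "r = (d, \<pi>)" and s: "s = (d, \<sigma>)"
    using assms(1) by (cases r, cases s) (auto simp: rep_equiv_def)
  obtain U where U: "is_unitary d U" "meq d d (mat_mult d U (\<pi> g)) (mat_mult d (\<sigma> g) U)"
    using assms unfolding r s rep_equiv_iff by blast
  have tr: "(\<Sum>i<d. A i i) = (\<Sum>i<d. B i i)" if "meq d d A B" for A B
    using that by (simp add: meq_def)
  have "(\<Sum>i<d. \<pi> g i i) = (\<Sum>i<d. mat_mult d (mat_mult d (adj U) U) (\<pi> g) i i)"
    by (rule tr, rule meq_sym, rule meq_trans[OF meq_mult[OF unitary_left_inverse[OF U(1)] meq_refl] meq_one_left])
  also have "\<dots> = (\<Sum>i<d. mat_mult d (adj U) (mat_mult d (\<sigma> g) U) i i)"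
    unfolding mat_mult_assoc by (rule tr, rule meq_mult[OF meq_refl U(2)])
  also have "\<dots> = (\<Sum>i<d. mat_mult d (\<sigma> g) (mat_mult d U (adj U)) i i)"
    by (subst trace_mult_commute) (simp add: mat_mult_assoc)
  also have "\<dots> = (\<Sum>i<d. \<sigma> g i i)"
    by (rule tr, rule meq_trans[OF meq_mult[OF meq_refl U(1)[unfolded is_unitary_iff]] meq_one_right])
  finally show ?thesis by (simp add: rep_char_def r s)
qed

lemma character_eq: "character \<zeta> = rep_char (rep_of \<zeta>)"
  by (simp add: character_def rep_char_def fun_eq_iff)

text \<open>\<open>rep_of\<close> picks an arbitrary member of the class. As unitary equivalence is
  an equivalence relation, the class is recovered from that member, and any choice serves for degree
  and character.\<close>

lemma unitary_dual_rep:
  assumes "\<zeta> \<in> unitary_dual G T"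
  shows "irreducible_rep G T (rep_of \<zeta>)" and "\<zeta> = {s. irreducible_rep G T s \<and> rep_equiv G (rep_of \<zeta>) s}"
proof -
  obtain r where r: "irreducible_rep G T r" "\<zeta> = {s. irreducible_rep G T s \<and> rep_equiv G r s}"
    using assms by (auto simp: unitary_dual_def)
  then have "r \<in> \<zeta>" using rep_equiv_refl by blast
  then have "rep_of \<zeta> \<in> \<zeta>" unfolding rep_of_def by (rule someI)
  then have "irreducible_rep G T (rep_of \<zeta>)" "rep_equiv G r (rep_of \<zeta>)" using r by auto
  then show "irreducible_rep G T (rep_of \<zeta>)" "\<zeta> = {s. irreducible_rep G T s \<and> rep_equiv G (rep_of \<zeta>) s}"
    using r rep_equiv_sym rep_equiv_trans by blast+
qed

lemma unitary_dual_eqI: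
  assumes "\<zeta> \<in> unitary_dual G T" "\<eta> \<in> unitary_dual G T" "rep_equiv G (rep_of \<zeta>) (rep_of \<eta>)"
  shows "\<zeta> = \<eta>"
  using unitary_dual_rep(2)[OF assms(1)] unitary_dual_rep(2)[OF assms(2)] assms(3)
    rep_equiv_sym rep_equiv_trans by blast

lemma unitary_dual_cover:
  assumes "irreducible_rep G T r"
  shows "\<exists>\<zeta>\<in>unitary_dual G T. rep_equiv G (rep_of \<zeta>) r"
proof -
  let ?z = "{s. irreducible_rep G T s \<and> rep_equiv G r s}"
  have "?z \<in> unitary_dual G T" using assms unfolding unitary_dual_def by blast
  moreover have "rep_equiv G (rep_of ?z) r"
    using unitary_dual_rep(2)[OF calculation] assms rep_equiv_refl by blast
  ultimately show ?thesis by blast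
qed

end

section \<open>Orthogonality relations\<close>

context haar_group
begin

lemma integral_sum_cont:
  fixes f :: "'i \<Rightarrow> 'g \<Rightarrow> complex"
  assumes "\<And>i. i \<in> I \<Longrightarrow> cont (f i)"
  shows "(\<integral>x. (\<Sum>i\<in>I. f i x) \<partial>\<mu>) = (\<Sum>i\<in>I. \<integral>x. f i x \<partial>\<mu>)"
  using assms by (intro Bochner_Integration.integral_sum cm_integrable)

text \<open>B is the average over g of \<open>\<pi> g\<close> E \<open>adj (\<sigma> g)\<close>,
  where E is the matrix unit at (a, b). Left invariance of the integral makes every such average an
  intertwiner.\<close>

lemma schur_intertwiner:
  assumes r: "irreducible_rep G T (d, \<pi>)" and s: "irreducible_rep G T (e, \<sigma>)"
    and ab: "a < d" "b < e" and h: "h \<in> carrier G"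
  defines "B \<equiv> \<lambda>i j. \<integral>g. \<pi> g i a * cnj (\<sigma> g j b) \<partial>\<mu>"
  shows "meq d e (mat_mult d (\<pi> h) B) (mat_mult e B (\<sigma> h))"
  unfolding meq_def
proof (intro allI impI)
  fix i j assume ij: "i < d" "j < e"
  have ur: "unitary_rep G T (d, \<pi>)" and us: "unitary_rep G T (e, \<sigma>)"
    using r s by (auto simp: irreducible_rep_def)
  note c = rep_cont[OF ur _ ab(1)] continuous_map_cnj[OF rep_cont[OF us _ ab(2)]]
  have c': "cont (\<lambda>g. \<pi> g k a * cnj (\<sigma> g l b))" if "k < d" "l < e" for k l
    using that by (intro continuous_map_cmult c)
  have "mat_mult d (\<pi> h) B i j = (\<Sum>k<d. \<integral>g. \<pi> h i k * (\<pi> g k a * cnj (\<sigma> g j b)) \<partial>\<mu>)"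
    by (simp add: mat_mult_def B_def)
  also have "\<dots> = (\<integral>g. (\<Sum>k<d. \<pi> h i k * (\<pi> g k a * cnj (\<sigma> g j b))) \<partial>\<mu>)"
    using ij by (intro integral_sum_cont[symmetric] continuous_map_cmult[OF continuous_map_canonical_const] c') auto
  \<comment> \<open>Writing g as inv h (h g) in the second factor makes the integrand a function of
    h g alone, ready for left invariance.\<close>
  also have "\<dots> = (\<integral>g. \<pi> (h \<otimes> g) i a * cnj (\<sigma> (inv h \<otimes> (h \<otimes> g)) j b) \<partial>\<mu>)"
  proof (rule Bochner_Integration.integral_cong[OF refl])
    fix g assume "g \<in> space \<mu>"
    then show "(\<Sum>k<d. \<pi> h i k * (\<pi> g k a * cnj (\<sigma> g j b))) = \<pi> (h \<otimes> g) i a * cnj (\<sigma> (inv h \<otimes> (h \<otimes> g)) j b)"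
      using h ij ab by (simp add: rep_mult_entry[OF ur] m_assoc[symmetric] sum_distrib_right mult.assoc)
  qed
  also have "\<dots> = (\<integral>g. \<pi> g i a * cnj (\<sigma> (inv h \<otimes> g) j b) \<partial>\<mu>)"
  proof -
    have "cont (\<lambda>g. \<sigma> (inv h \<otimes> g) j b)"
      using h by (intro cm_comp[OF rep_cont[OF us ij(2) ab(2)]] cm_mult cm_const cm_id) auto
    then have "cont (\<lambda>g. \<pi> g i a * cnj (\<sigma> (inv h \<otimes> g) j b))"
      using ij by (intro continuous_map_cmult c continuous_map_cnj)
    from integral_left_invariant[OF this h] show ?thesis .
  qed
  also have "\<dots> = (\<integral>g. (\<Sum>k<e. \<pi> g i a * cnj (\<sigma> g k b) * \<sigma> h k j) \<partial>\<mu>)"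
  proof (rule Bochner_Integration.integral_cong[OF refl])
    fix g assume "g \<in> space \<mu>"
    then show "\<pi> g i a * cnj (\<sigma> (inv h \<otimes> g) j b) = (\<Sum>k<e. \<pi> g i a * cnj (\<sigma> g k b) * \<sigma> h k j)"
      using h ij ab by (simp add: rep_mult_entry[OF us] rep_inv_entry[OF us] sum_distrib_left mult_ac)
  qed
  also have "\<dots> = (\<Sum>k<e. \<integral>g. \<pi> g i a * cnj (\<sigma> g k b) * \<sigma> h k j \<partial>\<mu>)"
    using ij by (intro integral_sum_cont continuous_map_cmult[OF c' continuous_map_canonical_const]) auto
  also have "\<dots> = mat_mult e B (\<sigma> h) i j"
    by (simp add: mat_mult_def B_def)
  finally show "mat_mult d (\<pi> h) B i j = mat_mult e B (\<sigma> h) i j" .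
qed

lemma schur_orth_inequiv:
  assumes r: "irreducible_rep G T (d, \<pi>)" and s: "irreducible_rep G T (e, \<sigma>)"
    and ne: "\<not> rep_equiv G (d, \<pi>) (e, \<sigma>)"
    and "i < d" "a < d" "j < e" "b < e"
  shows "(\<integral>g. \<pi> g i a * cnj (\<sigma> g j b) \<partial>\<mu>) = 0"
proof -
  have "meq d e (\<lambda>i j. \<integral>g. \<pi> g i a * cnj (\<sigma> g j b) \<partial>\<mu>) (\<lambda>i j. 0)"
    using schur_equiv[OF r s schur_intertwiner[OF r s \<open>a < d\<close> \<open>b < e\<close>]] ne by blast
  from meqD[OF this \<open>i < d\<close> \<open>j < e\<close>] show ?thesis .
qed

text \<open>By Schur's lemma the averaged matrix is a scalar c. Its trace d c is the integral of the
  inner product of columns a and b of a unitary matrix, hence 1 or 0.\<close>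

lemma schur_orth_same:
  assumes r: "irreducible_rep G T (d, \<pi>)"
    and "i < d" "a < d" "j < d" "b < d"
  shows "(\<integral>g. \<pi> g i a * cnj (\<pi> g j b) \<partial>\<mu>) = (if i = j \<and> a = b then 1 / of_nat d else 0)"
proof -
  have ur: "unitary_rep G T (d, \<pi>)" and d0: "0 < d" using r by (auto simp: irreducible_rep_def)
  let ?B = "\<lambda>i j. \<integral>g. \<pi> g i a * cnj (\<pi> g j b) \<partial>\<mu>"
  have "\<exists>c. meq d d ?B (smat c)"
    by (rule schur_scalar[OF r], rule meq_sym, rule schur_intertwiner[OF r r]) (use assms in auto)
  then obtain c where c: "\<And>i j. i < d \<Longrightarrow> j < d \<Longrightarrow> ?B i j = smat c i j" by (auto simp: meq_def)
  have "of_nat d * c = (\<Sum>k<d. ?B k k)" using c by (simp add: smat_def)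
  also have "\<dots> = (\<integral>g. (\<Sum>k<d. \<pi> g k a * cnj (\<pi> g k b)) \<partial>\<mu>)"
    using assms by (intro integral_sum_cont[symmetric] continuous_map_cmult continuous_map_cnj rep_cont[OF ur]) auto
  also have "\<dots> = (\<integral>g. (if a = b then 1 else 0) \<partial>\<mu>)"
  proof (rule Bochner_Integration.integral_cong[OF refl])
    fix g assume "g \<in> space \<mu>"
    then have "meq d d (mat_mult d (adj (\<pi> g)) (\<pi> g)) (smat 1)" by (intro rep_adj_mult[OF ur]) simp
    from meqD[OF this \<open>b < d\<close> \<open>a < d\<close>] show "(\<Sum>k<d. \<pi> g k a * cnj (\<pi> g k b)) = (if a = b then 1 else 0)"
      by (auto simp: mat_mult_def adj_def smat_def mult.commute)
  qed
  finally have "c = (if a = b then 1 / of_nat d else 0)"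
    using d0 by (simp add: field_simps split: if_splits)
  then show ?thesis using c[of i j] assms by (simp add: smat_def)
qed

lemma rep_char_cont:
  assumes "unitary_rep G T r"
  shows "cont (rep_char r)"
proof -
  obtain d \<pi> where r: "r = (d, \<pi>)" by (cases r)
  show ?thesis unfolding r
    unfolding rep_char_def[abs_def] fst_conv snd_conv
    by (intro continuous_map_sum rep_cont[OF assms[unfolded r]]) auto
qed

lemma rep_char_orth:
  assumes r: "irreducible_rep G T r" and s: "irreducible_rep G T s"
  shows "(\<not> rep_equiv G r s \<Longrightarrow> (\<integral>g. rep_char r g * cnj (rep_char s g) \<partial>\<mu>) = 0)"
    and "(\<integral>g. rep_char r g * cnj (rep_char r g) \<partial>\<mu>) = 1"
proof -
  obtain d \<pi> e \<sigma> where rs: "r = (d, \<pi>)" "s = (e, \<sigma>)" by (cases r, cases s)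
  have ur: "unitary_rep G T (d, \<pi>)" and us: "unitary_rep G T (e, \<sigma>)" and d0: "0 < d"
    using r s by (auto simp: irreducible_rep_def rs)
  have expand: "(\<integral>g. rep_char (d, \<pi>) g * cnj (rep_char (e', \<sigma>') g) \<partial>\<mu>) = (\<Sum>i<d. \<Sum>j<e'. \<integral>g. \<pi> g i i * cnj (\<sigma>' g j j) \<partial>\<mu>)"
    if u: "unitary_rep G T (e', \<sigma>')" for e' \<sigma>'
  proof -
    have c: "cont (\<lambda>g. \<pi> g i i * cnj (\<sigma>' g j j))" if "i < d" "j < e'" for i j
      using that by (intro continuous_map_cmult continuous_map_cnj rep_cont[OF ur] rep_cont[OF u])
    have "(\<integral>g. rep_char (d, \<pi>) g * cnj (rep_char (e', \<sigma>') g) \<partial>\<mu>) = (\<integral>g. (\<Sum>i<d. \<Sum>j<e'. \<pi> g i i * cnj (\<sigma>' g j j)) \<partial>\<mu>)"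
      by (simp add: rep_char_def sum_product)
    also have "\<dots> = (\<Sum>i<d. \<integral>g. (\<Sum>j<e'. \<pi> g i i * cnj (\<sigma>' g j j)) \<partial>\<mu>)"
      by (intro integral_sum_cont continuous_map_sum c) auto
    also have "\<dots> = (\<Sum>i<d. \<Sum>j<e'. \<integral>g. \<pi> g i i * cnj (\<sigma>' g j j) \<partial>\<mu>)"
      by (intro sum.cong refl integral_sum_cont c) auto
    finally show ?thesis .
  qed
  show "(\<integral>g. rep_char r g * cnj (rep_char s g) \<partial>\<mu>) = 0" if "\<not> rep_equiv G r s"
    unfolding rs expand[OF us]
    by (intro sum.neutral ballI schur_orth_inequiv[of d \<pi> e \<sigma>]) (use r s that rs in auto)
  have "(\<Sum>i<d. \<Sum>j<d. \<integral>g. \<pi> g i i * cnj (\<pi> g j j) \<partial>\<mu>) = (\<Sum>i<d. \<Sum>j<d. if i = j then 1 / of_nat d else 0)"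
    using r by (intro sum.cong refl) (simp add: schur_orth_same[of d \<pi>] rs)
  also have "\<dots> = 1" using d0 by simp
  finally show "(\<integral>g. rep_char r g * cnj (rep_char r g) \<partial>\<mu>) = 1"
    unfolding rs expand[OF ur] .
qed

section \<open>Central functions and their Fourier coefficients\<close>

definition central :: "('g \<Rightarrow> complex) \<Rightarrow> bool" where
  "central f \<longleftrightarrow> (\<forall>g\<in>carrier G. \<forall>h\<in>carrier G. f (g \<otimes> h) = f (h \<otimes> g))"

lemma centralD: "central f \<Longrightarrow> g \<in> carrier G \<Longrightarrow> h \<in> carrier G \<Longrightarrow> f (g \<otimes> h) = f (h \<otimes> g)"
  by (simp add: central_def)

lemma central_conj:
  assumes "central f" "g \<in> carrier G" "h \<in> carrier G"
  shows "f (h \<otimes> g \<otimes> inv h) = f g"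
  using centralD[OF assms(1), of "h \<otimes> g" "inv h"] assms(2,3) by (simp add: m_assoc[symmetric])

lemma rep_char_central:
  assumes "unitary_rep G T r"
  shows "central (rep_char r)"
  unfolding central_def
proof (intro ballI)
  fix g h assume gh: "g \<in> carrier G" "h \<in> carrier G"
  obtain d \<pi> where r: "r = (d, \<pi>)" by (cases r)
  have m: "rep_char r (g \<otimes> h) = (\<Sum>i<d. mat_mult d (\<pi> g) (\<pi> h) i i)" if "g \<in> carrier G" "h \<in> carrier G" for g h
    using meqD[OF rep_mult[OF assms[unfolded r] that]] by (simp add: rep_char_def r)
  show "rep_char r (g \<otimes> h) = rep_char r (h \<otimes> g)"
    unfolding m[OF gh] m[OF gh(2,1)] by (rule trace_mult_commute)
qed

text \<open>The integral of f(g) times \<open>\<pi> (inv g)\<close> commutes with the representation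
  because f is constant on conjugacy classes, so it is a scalar matrix, determined by its trace. A
  central function thus sees a representation only through its character.\<close>

lemma central_fourier_scalar:
  assumes r: "irreducible_rep G T (d, \<pi>)" and f: "cont f" "central f" and ij: "i < d" "j < d"
  shows "(\<integral>g. f g * cnj (\<pi> g i j) \<partial>\<mu>) =
    (if i = j then (\<integral>g. f g * cnj (rep_char (d, \<pi>) g) \<partial>\<mu>) / of_nat d else 0)"
proof -
  have ur: "unitary_rep G T (d, \<pi>)" and d0: "0 < d" using r by (auto simp: irreducible_rep_def)
  define R where "R = (\<lambda>i j. \<integral>g. f g * \<pi> (inv g) i j \<partial>\<mu>)"
  have cinv: "cont (\<lambda>g. \<pi> (inv g) i j)" if "i < d" "j < d" for i j
    using cm_comp[OF rep_cont[OF ur that] cm_inv[OF cm_id]] .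
  have R: "R i j = (\<integral>g. f g * cnj (\<pi> g j i) \<partial>\<mu>)" if "i < d" "j < d" for i j
    unfolding R_def by (rule Bochner_Integration.integral_cong[OF refl]) (simp add: rep_inv_entry[OF ur] that)
  have "\<exists>c. meq d d R (smat c)"
  proof (rule schur_scalar[OF r], unfold meq_def, intro allI impI)
    fix h i j assume h: "h \<in> carrier G" and ij: "i < d" "j < d"
    have "mat_mult d R (\<pi> h) i j = (\<Sum>k<d. \<integral>g. f g * \<pi> (inv g) i k * \<pi> h k j \<partial>\<mu>)"
      by (simp add: mat_mult_def R_def)
    also have "\<dots> = (\<integral>g. (\<Sum>k<d. f g * \<pi> (inv g) i k * \<pi> h k j) \<partial>\<mu>)"
      using ij by (intro integral_sum_cont[symmetric] continuous_map_cmult f cinv continuous_map_canonical_const) auto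
    also have "\<dots> = (\<integral>g. f g * \<pi> (inv g \<otimes> h) i j \<partial>\<mu>)"
      by (rule Bochner_Integration.integral_cong[OF refl])
        (simp add: rep_mult_entry[OF ur] h ij sum_distrib_left mult.assoc)
    \<comment> \<open>Conjugating the variable by h leaves f unchanged and moves h from the right of
      \<open>inv g\<close> to its left.\<close>
    also have "\<dots> = (\<integral>g. f (h \<otimes> g \<otimes> inv h) * \<pi> (inv (h \<otimes> g \<otimes> inv h) \<otimes> h) i j \<partial>\<mu>)"
    proof (rule integral_conj_invariant[symmetric])
      show "cont (\<lambda>g. f g * \<pi> (inv g \<otimes> h) i j)"
        using h by (intro continuous_map_cmult f cm_comp[OF rep_cont[OF ur ij]] cm_mult cm_inv cm_id cm_const)
    qed (use h in simp)
    also have "\<dots> = (\<integral>g. f g * \<pi> (h \<otimes> inv g) i j \<partial>\<mu>)"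
    proof (rule Bochner_Integration.integral_cong[OF refl])
      fix g assume "g \<in> space \<mu>"
      then have g: "g \<in> carrier G" by simp
      have "f (h \<otimes> g \<otimes> inv h) = f g" using central_conj[OF f(2) g h] .
      moreover have "inv (h \<otimes> g \<otimes> inv h) \<otimes> h = h \<otimes> inv g"
        using g h by (simp add: inv_mult_group m_assoc)
      ultimately show "f (h \<otimes> g \<otimes> inv h) * \<pi> (inv (h \<otimes> g \<otimes> inv h) \<otimes> h) i j = f g * \<pi> (h \<otimes> inv g) i j"
        by simp
    qed
    also have "\<dots> = (\<integral>g. (\<Sum>k<d. \<pi> h i k * (f g * \<pi> (inv g) k j)) \<partial>\<mu>)"
      by (rule Bochner_Integration.integral_cong[OF refl])
        (simp add: rep_mult_entry[OF ur] h ij sum_distrib_left mult_ac)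
    also have "\<dots> = (\<Sum>k<d. \<integral>g. \<pi> h i k * (f g * \<pi> (inv g) k j) \<partial>\<mu>)"
      using ij by (intro integral_sum_cont continuous_map_cmult f cinv continuous_map_canonical_const) auto
    also have "\<dots> = mat_mult d (\<pi> h) R i j"
      by (simp add: mat_mult_def R_def)
    finally show "mat_mult d R (\<pi> h) i j = mat_mult d (\<pi> h) R i j" .
  qed
  then obtain c where c: "\<And>i j. i < d \<Longrightarrow> j < d \<Longrightarrow> R i j = smat c i j" by (auto simp: meq_def)
  have "of_nat d * c = (\<Sum>k<d. R k k)" using c by (simp add: smat_def)
  also have "\<dots> = (\<Sum>k<d. \<integral>g. f g * cnj (\<pi> g k k) \<partial>\<mu>)" by (simp add: R)
  also have "\<dots> = (\<integral>g. (\<Sum>k<d. f g * cnj (\<pi> g k k)) \<partial>\<mu>)"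
    by (intro integral_sum_cont[symmetric] continuous_map_cmult f continuous_map_cnj rep_cont[OF ur]) auto
  also have "\<dots> = (\<integral>g. f g * cnj (rep_char (d, \<pi>) g) \<partial>\<mu>)"
    by (simp add: rep_char_def sum_distrib_left)
  finally have "c = (\<integral>g. f g * cnj (rep_char (d, \<pi>) g) \<partial>\<mu>) / of_nat d" using d0 by (simp add: field_simps)
  then show ?thesis using c[of j i] R[of j i] ij by (auto simp: smat_def)
qed

end

section \<open>Convolution and completeness of the characters\<close>

text \<open>The model is b n = sum of |t|^(2n + 2) over the eigenvalues t of a Hermitian convolution
  operator. Then lam is the largest |t|^2 and A its multiplicity, which explains the exponent
  \<open>Suc n\<close> and the bound 1 on A. The hypotheses express what Cauchy-Schwarz yields
  without knowledge of the spectrum.\<close>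

lemma power_growth_limit:
  fixes b :: "nat \<Rightarrow> real"
  assumes pos: "\<And>n. 0 < b n" and conv: "\<And>n. (b (Suc n))\<^sup>2 \<le> b n * b (Suc (Suc n))"
    and bdd: "\<And>n. b (Suc n) \<le> b 0 * b n" and dbl: "\<And>n. b (Suc (2 * n)) \<le> (b n)\<^sup>2"
  shows "\<exists>lam A. 0 < lam \<and> 1 \<le> A \<and> (\<lambda>n. b n / lam ^ Suc n) \<longlonglongrightarrow> A"
proof -
  define r where "r n = b (Suc n) / b n" for n
  have r_pos: "0 < r n" for n using pos by (simp add: r_def)
  have "r n \<le> r (Suc n)" for n
    using conv[of n] pos[of n] pos[of "Suc n"] by (simp add: r_def field_simps power2_eq_square)
  then have inc: "incseq r" by (rule incseq_SucI)
  have rb: "r n \<le> b 0" for n using bdd[of n] pos[of n] by (simp add: r_def field_simps)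
  obtain lam where lam: "r \<longlonglongrightarrow> lam" "\<And>n. r n \<le> lam"
    using incseq_convergent[OF inc, of "b 0"] rb by auto
  have lam_pos: "0 < lam" using r_pos[of 0] lam(2)[of 0] by linarith
  define c where "c n = b n / lam ^ Suc n" for n
  have c_pos: "0 < c n" for n using pos lam_pos by (simp add: c_def)
  have c_ratio: "c (Suc n) = c n * (r n / lam)" for n
    using pos[of n] lam_pos by (simp add: c_def r_def)
  have dec: "decseq c"
  proof (rule decseq_SucI)
    fix n
    have "r n / lam \<le> 1" using lam(2)[of n] lam_pos by simp
    then show "c (Suc n) \<le> c n" unfolding c_ratio using c_pos[of n] mult_left_le[of "r n / lam" "c n"] by simp
  qed
  obtain A where A: "c \<longlonglongrightarrow> A" "\<And>n. A \<le> c n"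
    using decseq_convergent[OF dec, of 0] less_imp_le[OF c_pos] by auto
  have c_dbl: "c (Suc (2 * n)) \<le> (c n)\<^sup>2" for n
  proof -
    have "(lam ^ Suc n)\<^sup>2 = lam ^ Suc (Suc (2 * n))" by (simp add: power2_eq_square power_add[symmetric] mult_2)
    then show ?thesis using dbl[of n] lam_pos by (simp add: c_def power_divide divide_right_mono del: power_Suc)
  qed
  \<comment> \<open>If some c m were q < 1, doubling would give c <= q^(2^j) at index (m + 1) 2^j -
    1, a geometric decay. The ratios of consecutive c tend to 1, which rules this out.\<close>
  have c1: "1 \<le> c m" for m
  proof (rule ccontr)
    assume "\<not> 1 \<le> c m"
    define q where "q = c m"
    have q: "0 < q" "q < 1" using \<open>\<not> 1 \<le> c m\<close> c_pos by (auto simp: q_def)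
    define N where "N j = Suc m * 2 ^ j - 1" for j :: nat
    have NS: "Suc (N j) = Suc m * 2 ^ j" for j by (simp add: N_def)
    have "N (Suc j) = Suc (2 * N j)" for j using NS[of j] NS[of "Suc j"] by simp
    then have up: "c (N j) \<le> q ^ (2 ^ j)" for j
    proof (induction j)
      case 0
      then show ?case by (simp add: N_def q_def)
    next
      case (Suc j)
      have "c (N (Suc j)) \<le> (c (N j))\<^sup>2" using Suc.prems c_dbl by simp
      also have "\<dots> \<le> (q ^ (2 ^ j))\<^sup>2" using Suc c_pos by (intro power_mono) (auto intro: less_imp_le)
      finally show ?case by (simp add: power_mult[symmetric] mult.commute)
    qed
    \<comment> \<open>Bernoulli's inequality for this u gives t^(m + 1) >= (1 + q) / 2 > q with t =
      1 - u < 1; a decay by at most the ratio t per step is then too slow for the doubling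
      bound.\<close>
    define u where "u = ((1 - q) / 2) / real (Suc m)"
    define t where "t = 1 - u"
    have u: "0 < u" "u < 1" using q by (auto simp: u_def field_simps)
    have t: "0 < t" "t < 1" using u by (auto simp: t_def)
    have "1 + real (Suc m) * (- u) \<le> (1 + - u) ^ Suc m"
      using u by (intro Bernoulli_inequality) simp
    moreover have "real (Suc m) * u = (1 - q) / 2" by (simp add: u_def del: of_nat_Suc)
    ultimately have tm: "q < t ^ Suc m" using q by (simp add: t_def)
    have "(\<lambda>n. r n / lam) \<longlonglongrightarrow> lam / lam" using lam(1) lam_pos by (intro tendsto_divide tendsto_const) auto
    then have "(\<lambda>n. r n / lam) \<longlonglongrightarrow> 1" using lam_pos by simp
    then have "eventually (\<lambda>n. t < r n / lam) sequentially" using t(2) by (rule order_tendstoD)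
    then obtain n0 where n0: "\<And>n. n0 \<le> n \<Longrightarrow> t < r n / lam" by (auto simp: eventually_sequentially)
    have low: "c n0 * t ^ (n - n0) \<le> c n" if "n0 \<le> n" for n
      using that
    proof (induction n rule: dec_induct)
      case (step n)
      have "c n0 * t ^ (Suc n - n0) = (c n0 * t ^ (n - n0)) * t" using step by (simp add: Suc_diff_le)
      also have "\<dots> \<le> c n * (r n / lam)"
        using step n0[of n] t c_pos by (intro mult_mono) (auto intro: less_imp_le)
      finally show ?case by (simp add: c_ratio)
    qed simp
    define C where "C = c n0"
    have C: "0 < C" using c_pos by (simp add: C_def)
    have key: "C * (t ^ Suc m / q) ^ (2 ^ j) \<le> 1" if j: "n0 \<le> N j" for j
    proof -
      have "C * (t ^ Suc m) ^ (2 ^ j) = C * t ^ (Suc (N j))" unfolding NS power_mult ..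
      also have "\<dots> \<le> C * t ^ (N j - n0)"
        using C t by (intro mult_left_mono power_decreasing) auto
      also have "\<dots> \<le> c (N j)" using low[OF j] by (simp add: C_def)
      also have "\<dots> \<le> q ^ (2 ^ j)" by (rule up)
      finally show ?thesis using q by (simp add: power_divide field_simps)
    qed
    have "1 < t ^ Suc m / q" using tm q by (simp add: field_simps)
    then obtain M where M: "1 / C < (t ^ Suc m / q) ^ M" using real_arch_pow by blast
    define j where "j = M + n0"
    have "j < 2 ^ j" "M \<le> j" "n0 \<le> j" by (simp_all add: j_def less_exp)
    then have Mj: "M \<le> 2 ^ j" "n0 < 2 ^ j" by linarith+
    have "(2::nat) ^ j \<le> Suc m * 2 ^ j" by simp
    then have "n0 \<le> N j" using Mj by (simp add: N_def)
    from key[OF this] have "(t ^ Suc m / q) ^ (2 ^ j) \<le> 1 / C" using C by (simp add: field_simps)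
    moreover have "(t ^ Suc m / q) ^ M \<le> (t ^ Suc m / q) ^ (2 ^ j)"
      using \<open>1 < t ^ Suc m / q\<close> Mj by (intro power_increasing) auto
    ultimately show False using M by linarith
  qed
  have "1 \<le> A" using A(1) c1 by (intro LIMSEQ_le_const) auto
  then show ?thesis using A(1) lam_pos by (auto simp: c_def[abs_def])
qed

context haar_group
begin

section \<open>Convolution, inner product and Bessel's inequality\<close>

definition conv :: "('g \<Rightarrow> complex) \<Rightarrow> ('g \<Rightarrow> complex) \<Rightarrow> 'g \<Rightarrow> complex" where
  "conv f g x = (\<integral>y. f y * g (inv y \<otimes> x) \<partial>\<mu>)"

definition ip :: "('g \<Rightarrow> complex) \<Rightarrow> ('g \<Rightarrow> complex) \<Rightarrow> complex" where
  "ip f g = (\<integral>x. f x * cnj (g x) \<partial>\<mu>)"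

definition n2 :: "('g \<Rightarrow> complex) \<Rightarrow> real" where
  "n2 f = (\<integral>x. (cmod (f x))\<^sup>2 \<partial>\<mu>)"

definition orthonormal :: "'i set \<Rightarrow> ('i \<Rightarrow> 'g \<Rightarrow> complex) \<Rightarrow> bool" where
  "orthonormal I e \<longleftrightarrow> (\<forall>i\<in>I. cont (e i)) \<and> (\<forall>i\<in>I. \<forall>j\<in>I. ip (e i) (e j) = (if i = j then 1 else 0))"

definition hermitian :: "('g \<Rightarrow> complex) \<Rightarrow> bool" where
  "hermitian f \<longleftrightarrow> (\<forall>x\<in>carrier G. f (inv x) = cnj (f x))"

lemma hermitianD: "hermitian f \<Longrightarrow> x \<in> carrier G \<Longrightarrow> f (inv x) = cnj (f x)"
  by (simp add: hermitian_def)

lemma integral_carrier_cong: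
  "(\<And>x. x \<in> carrier G \<Longrightarrow> f x = g x) \<Longrightarrow> (\<integral>x. f x \<partial>\<mu>) = (\<integral>x. g x \<partial>\<mu>)"
  by (rule Bochner_Integration.integral_cong) auto

lemma cont_cmult: "cont f \<Longrightarrow> cont (\<lambda>x. c * f x)"
  by (intro continuous_map_cmult continuous_map_canonical_const)

lemma cont_translate:
  assumes "cont f" "g \<in> carrier G"
  shows "cont (\<lambda>x. f (g \<otimes> x))" "cont (\<lambda>x. f (x \<otimes> g))" "cont (\<lambda>x. f (inv x))" "cont (\<lambda>x. f (inv x \<otimes> g))"
    "cont (\<lambda>x. f (g \<otimes> inv x))"
  by (intro cm_comp[OF assms(1)] cm_mult cm_const cm_id cm_inv assms(2))+

lemma ip_cong:
  assumes "\<And>x. x \<in> carrier G \<Longrightarrow> f x = f' x" "\<And>x. x \<in> carrier G \<Longrightarrow> g x = g' x"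
  shows "ip f g = ip f' g'"
  unfolding ip_def by (rule integral_carrier_cong) (simp add: assms)

lemma ip_self: "ip f f = of_real (n2 f)"
  by (simp add: ip_def n2_def complex_norm_square[symmetric] del: of_real_power)

lemma ip_cnj: "cnj (ip f g) = ip g f"
  unfolding ip_def Bochner_Integration.integral_cnj[symmetric] by (simp add: mult.commute)

lemma ip_cmult_left [simp]: "ip (\<lambda>x. c * f x) g = c * ip f g"
  by (simp add: ip_def mult.assoc)

lemma ip_cmult_right [simp]: "ip f (\<lambda>x. c * g x) = cnj c * ip f g"
  by (simp add: ip_def mult.left_commute)

lemma ip_diff_left:
  assumes "cont f" "cont g" "cont h"
  shows "ip (\<lambda>x. f x - g x) h = ip f h - ip g h"
  unfolding ip_def left_diff_distrib
  by (intro Bochner_Integration.integral_diff cm_integrable continuous_map_cmult continuous_map_cnj assms)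

lemma ip_diff_right:
  assumes "cont f" "cont g" "cont h"
  shows "ip h (\<lambda>x. f x - g x) = ip h f - ip h g"
  using arg_cong[OF ip_diff_left[OF assms], where f = cnj] by (simp add: ip_cnj)

lemma ip_sum_left:
  assumes "\<And>i. i \<in> I \<Longrightarrow> cont (f i)" "cont h"
  shows "ip (\<lambda>x. \<Sum>i\<in>I. f i x) h = (\<Sum>i\<in>I. ip (f i) h)"
  unfolding ip_def sum_distrib_right
  by (intro integral_sum_cont continuous_map_cmult continuous_map_cnj assms)

lemma ip_sum_right:
  assumes "\<And>i. i \<in> I \<Longrightarrow> cont (f i)" "cont h"
  shows "ip h (\<lambda>x. \<Sum>i\<in>I. f i x) = (\<Sum>i\<in>I. ip h (f i))"
  using arg_cong[OF ip_sum_left[OF assms], where f = cnj] by (simp add: ip_cnj)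

lemma n2_nonneg [simp]: "0 \<le> n2 f"
  by (simp add: n2_def)

lemma n2_eq_0: "cont f \<Longrightarrow> n2 f = 0 \<Longrightarrow> x \<in> carrier G \<Longrightarrow> f x = 0"
  using integral_zero_imp_zero by (simp add: n2_def)

lemma n2_pos: "cont f \<Longrightarrow> x \<in> carrier G \<Longrightarrow> f x \<noteq> 0 \<Longrightarrow> 0 < n2 f"
  using n2_eq_0[of f x] n2_nonneg[of f] by (auto simp: less_le)

text \<open>Subtracting the orthogonal projection onto the span is used twice: the norm identity
  yields Bessel's inequality, and orthogonality is the Gram-Schmidt step that enlarges a
  frame.\<close>

lemma residual:
  assumes fin: "finite I" and e: "orthonormal I e" and f: "cont f"
  defines "r \<equiv> \<lambda>x. f x - (\<Sum>i\<in>I. ip f (e i) * e i x)"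
  shows "cont r" "\<And>j. j \<in> I \<Longrightarrow> ip r (e j) = 0"
    "n2 r = n2 f - (\<Sum>i\<in>I. (cmod (ip f (e i)))\<^sup>2)"
proof -
  have ce: "cont (e i)" if "i \<in> I" for i using e that by (simp add: orthonormal_def)
  have ct: "cont (\<lambda>x. ip f (e i) * e i x)" if "i \<in> I" for i by (intro cont_cmult ce that)
  have cs: "cont (\<lambda>x. \<Sum>i\<in>I. ip f (e i) * e i x)" by (intro continuous_map_sum ct fin)
  show cr: "cont r" unfolding r_def by (intro continuous_map_diff f cs)
  show orth: "ip r (e j) = 0" if j: "j \<in> I" for j
  proof -
    have "ip r (e j) = ip f (e j) - (\<Sum>i\<in>I. ip f (e i) * ip (e i) (e j))"
      unfolding r_def by (simp add: ip_diff_left[OF f cs ce[OF j]] ip_sum_left[OF ct ce[OF j]])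
    also have "(\<Sum>i\<in>I. ip f (e i) * ip (e i) (e j)) = (\<Sum>i\<in>I. if i = j then ip f (e i) else 0)"
      using e j by (intro sum.cong) (auto simp: orthonormal_def)
    finally show ?thesis using fin j by simp
  qed
  have "ip r r = ip f r - (\<Sum>i\<in>I. ip f (e i) * ip (e i) r)"
    by (subst (1) r_def) (simp add: ip_diff_left[OF f cs cr] ip_sum_left[OF ct cr])
  also have "(\<Sum>i\<in>I. ip f (e i) * ip (e i) r) = 0"
    using orth ip_cnj[of r] by (intro sum.neutral) (metis complex_cnj_zero mult_zero_right)
  also have "ip f r = ip f f - (\<Sum>i\<in>I. cnj (ip f (e i)) * ip f (e i))"
    unfolding r_def by (simp add: ip_diff_right[OF f cs f] ip_sum_right[OF ct f])
  finally have "complex_of_real (n2 r) = of_real (n2 f - (\<Sum>i\<in>I. (cmod (ip f (e i)))\<^sup>2))"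
    by (simp only: ip_self of_real_diff of_real_sum complex_norm_square mult.commute diff_zero)
  then show "n2 r = n2 f - (\<Sum>i\<in>I. (cmod (ip f (e i)))\<^sup>2)" by (simp only: of_real_eq_iff)
qed

lemma bessel:
  assumes "finite I" "orthonormal I e" "cont f"
  shows "(\<Sum>i\<in>I. (cmod (ip f (e i)))\<^sup>2) \<le> n2 f"
  using residual(3)[OF assms] n2_nonneg[of "\<lambda>x. f x - (\<Sum>i\<in>I. ip f (e i) * e i x)"] by linarith

lemma n2_cmult: "n2 (\<lambda>x. c * f x) = (cmod c)\<^sup>2 * n2 f"
  by (simp add: n2_def norm_mult power_mult_distrib)

lemma orthonormal_normalize:
  assumes "cont g" "0 < n2 g"
  shows "ip (\<lambda>x. of_real (1 / sqrt (n2 g)) * g x) (\<lambda>x. of_real (1 / sqrt (n2 g)) * g x) = 1"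
proof -
  have "n2 (\<lambda>x. of_real (1 / sqrt (n2 g)) * g x) = 1"
    unfolding n2_cmult norm_of_real using assms(2) by (simp add: power_divide)
  then show ?thesis by (simp only: ip_self of_real_1)
qed

text \<open>Bessel's inequality for the one-element system consisting of the normalised g.\<close>

lemma cauchy_schwarz:
  assumes "cont f" "cont g"
  shows "(cmod (ip f g))\<^sup>2 \<le> n2 f * n2 g"
proof (cases "n2 g = 0")
  case True
  then have "ip f g = ip f (\<lambda>x. 0)" using n2_eq_0[OF assms(2)] by (intro ip_cong) auto
  then show ?thesis using True by (simp add: ip_def)
next
  case False
  then have pos: "0 < n2 g" using n2_nonneg[of g] by linarith
  define c where "c = complex_of_real (1 / sqrt (n2 g))"
  have "orthonormal {()} (\<lambda>_ x. c * g x)"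
    using orthonormal_normalize[OF assms(2) pos, folded c_def] cont_cmult[OF assms(2)]
    by (simp add: orthonormal_def del: ip_cmult_left ip_cmult_right)
  from bessel[OF _ this assms(1)] have "(cmod c)\<^sup>2 * (cmod (ip f g))\<^sup>2 \<le> n2 f"
    by (simp add: norm_mult power_mult_distrib)
  moreover have "(cmod c)\<^sup>2 = 1 / n2 g" using pos by (simp add: c_def norm_divide power_divide)
  ultimately have "(cmod (ip f g))\<^sup>2 / n2 g \<le> n2 f" by simp
  then show ?thesis using pos by (simp add: field_simps)
qed

text \<open>These are the test functions in the two ways of writing a convolution as an inner
  product: with the first factor in \<open>conv_bound\<close>, with the second factor in the
  dimension bound for eigenspaces.\<close>

lemma n2_cnj_inv_translate:
  assumes "cont g" "x \<in> carrier G"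
  shows "n2 (\<lambda>y. cnj (g (inv y \<otimes> x))) = n2 g" "n2 (\<lambda>y. cnj (g (x \<otimes> inv y))) = n2 g"
proof -
  define F where "F = (\<lambda>y. complex_of_real ((cmod (g y))\<^sup>2))"
  have F: "cont F" unfolding F_def complex_norm_square by (intro continuous_map_cmult continuous_map_cnj assms)
  have r: "complex_of_real (n2 h) = (\<integral>y. complex_of_real ((cmod (h y))\<^sup>2) \<partial>\<mu>)" for h
    by (simp add: n2_def del: of_real_power)
  have "complex_of_real (n2 (\<lambda>y. cnj (g (inv y \<otimes> x)))) = (\<integral>y. F (inv y \<otimes> x) \<partial>\<mu>)"
    by (simp only: r F_def complex_mod_cnj)
  also have "\<dots> = (\<integral>y. F y \<partial>\<mu>)"
    using integral_inv[OF cont_translate(2)[OF F assms(2)]] integral_right_invariant[OF F assms(2)] by simp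
  finally show "n2 (\<lambda>y. cnj (g (inv y \<otimes> x))) = n2 g" by (simp only: F_def r[symmetric] of_real_eq_iff)
  have "complex_of_real (n2 (\<lambda>y. cnj (g (x \<otimes> inv y)))) = (\<integral>y. F (x \<otimes> inv y) \<partial>\<mu>)"
    by (simp only: r F_def complex_mod_cnj)
  also have "\<dots> = (\<integral>y. F y \<partial>\<mu>)"
    using integral_inv[OF cont_translate(1)[OF F assms(2)]] integral_left_invariant[OF F assms(2)] by simp
  finally show "n2 (\<lambda>y. cnj (g (x \<otimes> inv y))) = n2 g" by (simp only: F_def r[symmetric] of_real_eq_iff)
qed

lemma conv_eq_ip: "conv f g x = ip f (\<lambda>y. cnj (g (inv y \<otimes> x)))"
  by (simp add: conv_def ip_def)

lemma conv_cont:
  assumes "cont f" "cont g"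
  shows "cont (conv f g)"
proof -
  have "continuous_map (prod_topology T T) euclidean (\<lambda>z. f (snd z) * g (inv (snd z) \<otimes> fst z))"
    by (intro continuous_map_cmult cm_comp[OF assms(1)] cm_comp[OF assms(2)] cm_mult cm_inv
        continuous_map_fst continuous_map_snd)
  from cont_param_integral[OF this] show ?thesis by (simp add: conv_def[abs_def])
qed

lemma conv_cong:
  assumes "\<And>x. x \<in> carrier G \<Longrightarrow> f x = f' x" "\<And>x. x \<in> carrier G \<Longrightarrow> g x = g' x" "x \<in> carrier G"
  shows "conv f g x = conv f' g' x"
  unfolding conv_def by (rule integral_carrier_cong) (simp add: assms)

text \<open>Convolution maps pairs of square-integrable functions boundedly into the sup norm. This
  smoothing turns mean-square convergence into uniform convergence.\<close>

lemma conv_bound: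
  assumes "cont f" "cont g" "x \<in> carrier G"
  shows "(cmod (conv f g x))\<^sup>2 \<le> n2 f * n2 g"
  unfolding conv_eq_ip
  using cauchy_schwarz[OF assms(1) continuous_map_cnj[OF cont_translate(4)[OF assms(2,3)]]]
  by (simp add: n2_cnj_inv_translate(1)[OF assms(2,3)])

lemma n2_le_sup:
  assumes "cont f" "\<And>x. x \<in> carrier G \<Longrightarrow> (cmod (f x))\<^sup>2 \<le> c"
  shows "n2 f \<le> c"
  unfolding n2_def
  by (rule integral_le_const[OF continuous_map_real_pow[OF continuous_map_norm[OF assms(1)]] assms(2)])

lemma conv_assoc:
  assumes f: "cont f" and g: "cont g" and h: "cont h" and x: "x \<in> carrier G"
  shows "conv (conv f g) h x = conv f (conv g h) x"
proof -
  let ?F = "\<lambda>z. f (snd z) * g (inv (snd z) \<otimes> fst z) * h (inv (fst z) \<otimes> x)"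
  have F: "continuous_map (prod_topology T T) euclidean ?F"
    by (intro continuous_map_cmult cm_comp[OF f] cm_comp[OF g] cm_comp[OF h] cm_mult cm_inv cm_const x
        continuous_map_fst continuous_map_snd)
  have "conv (conv f g) h x = (\<integral>y. (\<integral>u. f u * g (inv u \<otimes> y) * h (inv y \<otimes> x) \<partial>\<mu>) \<partial>\<mu>)"
    by (simp add: conv_def)
  also have "\<dots> = (\<integral>u. (\<integral>y. f u * g (inv u \<otimes> y) * h (inv y \<otimes> x) \<partial>\<mu>) \<partial>\<mu>)"
    using fubini[OF F] by simp
  also have "\<dots> = (\<integral>u. f u * conv g h (inv u \<otimes> x) \<partial>\<mu>)"
  proof (rule integral_carrier_cong)
    fix u assume u: "u \<in> carrier G"
    have c: "cont (\<lambda>y. g (inv u \<otimes> y) * h (inv y \<otimes> x))"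
      using u x by (intro continuous_map_cmult cm_comp[OF g] cm_comp[OF h] cm_mult cm_inv cm_const cm_id) auto
    have "(\<integral>y. f u * g (inv u \<otimes> y) * h (inv y \<otimes> x) \<partial>\<mu>) = f u * (\<integral>y. g (inv u \<otimes> y) * h (inv y \<otimes> x) \<partial>\<mu>)"
      by (simp add: mult.assoc)
    also have "(\<integral>y. g (inv u \<otimes> y) * h (inv y \<otimes> x) \<partial>\<mu>) = (\<integral>y. g (inv u \<otimes> (u \<otimes> y)) * h (inv (u \<otimes> y) \<otimes> x) \<partial>\<mu>)"
      by (rule integral_left_invariant[OF c u, symmetric])
    also have "\<dots> = conv g h (inv u \<otimes> x)"
      unfolding conv_def using u x
      by (intro integral_carrier_cong) (simp add: m_assoc[symmetric] inv_mult_group)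
    finally show "(\<integral>y. f u * g (inv u \<otimes> y) * h (inv y \<otimes> x) \<partial>\<mu>) = f u * conv g h (inv u \<otimes> x)" .
  qed
  finally show ?thesis by (simp add: conv_def)
qed

lemma conv_inv:
  assumes f: "cont f" "hermitian f" and g: "cont g" "hermitian g" and x: "x \<in> carrier G"
  shows "conv f g (inv x) = cnj (conv g f x)"
proof -
  have c: "cont (\<lambda>y. f y * g (inv y \<otimes> inv x))"
    using x by (intro continuous_map_cmult f cm_comp[OF g(1)] cm_mult cm_inv cm_const cm_id) auto
  have c': "cont (\<lambda>y. f (inv x \<otimes> y) * g (inv (inv x \<otimes> y) \<otimes> inv x))"
    using x cont_translate(1)[OF c, of "inv x"] by simp
  have "conv f g (inv x) = (\<integral>y. f (inv x \<otimes> y) * g (inv (inv x \<otimes> y) \<otimes> inv x) \<partial>\<mu>)"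
    unfolding conv_def using integral_left_invariant[OF c, of "inv x"] x by simp
  also have "\<dots> = (\<integral>y. cnj (g y * f (inv y \<otimes> x)) \<partial>\<mu>)"
  proof (rule integral_carrier_cong)
    fix y assume y: "y \<in> carrier G"
    have "inv (inv x \<otimes> y) \<otimes> inv x = inv y" using x y by (simp add: inv_mult_group m_assoc)
    moreover have "inv x \<otimes> y = inv (inv y \<otimes> x)" using x y by (simp add: inv_mult_group)
    ultimately show "f (inv x \<otimes> y) * g (inv (inv x \<otimes> y) \<otimes> inv x) = cnj (g y * f (inv y \<otimes> x))"
      using x y hermitianD[OF f(2)] hermitianD[OF g(2)] by simp
  qed
  finally show ?thesis unfolding Bochner_Integration.integral_cnj by (simp add: conv_def)
qed

lemma conv_one:
  assumes "hermitian g"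
  shows "conv f g \<one> = ip f g"
  unfolding conv_def ip_def
  by (rule integral_carrier_cong) (simp add: hermitianD[OF assms])

lemma conv_diff_right:
  assumes "cont f" "cont g" "cont h" "x \<in> carrier G"
  shows "conv f (\<lambda>y. g y - h y) x = conv f g x - conv f h x"
  unfolding conv_def right_diff_distrib
  by (intro Bochner_Integration.integral_diff cm_integrable continuous_map_cmult assms cont_translate)

lemma conv_add_right:
  assumes "cont f" "cont g" "cont h" "x \<in> carrier G"
  shows "conv f (\<lambda>y. g y + h y) x = conv f g x + conv f h x"
  unfolding conv_def distrib_left
  by (intro Bochner_Integration.integral_add cm_integrable continuous_map_cmult assms cont_translate)

lemma conv_cmult_right: "conv f (\<lambda>y. c * g y) x = c * conv f g x"
  by (simp add: conv_def mult.left_commute)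

lemma conv_cmult_left: "conv (\<lambda>y. c * f y) g x = c * conv f g x"
  by (simp add: conv_def mult.assoc)

text \<open>Convolution from the left commutes with translation from the right, so its eigenspaces
  are right-invariant.\<close>

lemma conv_translate:
  assumes "x \<in> carrier G" "g \<in> carrier G"
  shows "conv f (\<lambda>y. h (y \<otimes> g)) x = conv f h (x \<otimes> g)"
  unfolding conv_def by (rule integral_carrier_cong) (simp add: assms m_assoc)

section \<open>Convolution powers and the top eigenfunction\<close>

primrec cpow :: "('g \<Rightarrow> complex) \<Rightarrow> nat \<Rightarrow> 'g \<Rightarrow> complex" where
  "cpow k 0 = k"
| "cpow k (Suc n) = conv k (cpow k n)"

lemma cpow_cont: "cont k \<Longrightarrow> cont (cpow k n)"
  by (induction n) (auto intro: conv_cont)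

text \<open>The index is shifted: \<open>cpow k n\<close> is the \<open>(n + 1)\<close>-st convolution power, as there is no
  unit for convolution.\<close>

lemma cpow_add:
  assumes k: "cont k" and x: "x \<in> carrier G"
  shows "conv (cpow k m) (cpow k n) x = cpow k (Suc (m + n)) x"
  using x
proof (induction m arbitrary: x)
  case (Suc m)
  have "conv (cpow k (Suc m)) (cpow k n) x = conv k (conv (cpow k m) (cpow k n)) x"
    using Suc.prems by (simp add: conv_assoc k cpow_cont)
  also have "\<dots> = conv k (cpow k (Suc (m + n))) x"
    using Suc by (intro conv_cong) auto
  finally show ?case by simp
qed simp

lemma cpow_hermitian:
  assumes k: "cont k" "hermitian k"
  shows "hermitian (cpow k n)"
proof (induction n)
  case (Suc n)
  have "conv k (cpow k n) (inv x) = cnj (conv k (cpow k n) x)" if x: "x \<in> carrier G" for x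
  proof -
    have "conv k (cpow k n) (inv x) = cnj (conv (cpow k n) k x)"
      by (rule conv_inv[OF k cpow_cont[OF k(1)] Suc x])
    also have "conv (cpow k n) k x = conv k (cpow k n) x"
      using cpow_add[OF k(1) x, of n 0] by simp
    finally show ?thesis .
  qed
  then show ?case by (simp add: hermitian_def)
qed (use k in simp)

text \<open>For Hermitian k the inner product depends on m + n only. Cauchy-Schwarz then says that
  the sequence of squared norms is log-convex.\<close>

lemma cpow_ip:
  assumes k: "cont k" "hermitian k"
  shows "ip (cpow k m) (cpow k n) = cpow k (Suc (m + n)) \<one>"
  using conv_one[OF cpow_hermitian[OF k]] cpow_add[OF k(1) one_closed] by metis

text \<open>The function p obtained is the convolution kernel of the projection onto the top
  eigenspace, so p(1) is the dimension of that space; this is why the value at the identity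
  certifies that p is nonzero. Convolving twice with k is essential because top eigenvalues of both
  signs may occur.\<close>

lemma hermitian_conv_square_eigenfunction:
  assumes k: "cont k" "hermitian k" and nz: "a \<in> carrier G" "k a \<noteq> 0"
  shows "\<exists>lam p. 0 < lam \<and> cont p \<and> p \<one> \<noteq> 0 \<and>
    (\<forall>x\<in>carrier G. conv k (conv k p) x = of_real lam * p x)"
proof -
  let ?P = "cpow k"
  note cP = cpow_cont[OF k(1)]
  \<comment> \<open>The squared norm of the (n + 1)-st convolution power, which equals the value of
    the (2n + 2)-nd at the identity.\<close>
  define b where "b n = n2 (?P n)" for n
  have b_ip: "of_real (b n) = ?P (Suc (2 * n)) \<one>" for n
    using cpow_ip[OF k, of n n] by (simp add: b_def ip_self mult_2)
  have cs: "(cmod (?P (Suc (m + n)) \<one>))\<^sup>2 \<le> b m * b n" for m n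
    using cauchy_schwarz[OF cP cP, of m n] by (simp add: cpow_ip[OF k] b_def)
  have conv: "(b (Suc n))\<^sup>2 \<le> b n * b (Suc (Suc n))" for n
    using cs[of n "Suc (Suc n)"] b_ip[of "Suc n"]
    by (metis add_Suc_right add_Suc mult_2 norm_of_real power2_abs)
  have b0: "0 < b 0" using n2_pos[OF k(1) nz] by (simp add: b_def)
  \<comment> \<open>k * k takes the nonzero value \<open>b 0\<close> at the identity; from there on
    log-convexity propagates positivity.\<close>
  have b1: "0 < b 1"
  proof -
    have "?P 1 \<one> \<noteq> 0" using b_ip[of 0] b0 by auto
    then show ?thesis using n2_pos[OF cP one_closed, of 1] by (simp add: b_def)
  qed
  have pos2: "0 < b n \<and> 0 < b (Suc n)" for n
  proof (induction n)
    case (Suc n)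
    have "0 < (b (Suc n))\<^sup>2" using Suc by simp
    also have "\<dots> \<le> b n * b (Suc (Suc n))" by (rule conv)
    finally show ?case using Suc by (simp add: zero_less_mult_iff)
  qed (use b0 b1 in simp)
  have bdd: "b (Suc n) \<le> b 0 * b n" for n
    unfolding b_def cpow.simps
    by (rule n2_le_sup[OF conv_cont[OF k(1) cP] conv_bound[OF k(1) cP]])
  have dbl: "b (Suc (2 * n)) \<le> (b n)\<^sup>2" for n
  proof -
    have "(cmod (?P (Suc (n + n)) x))\<^sup>2 \<le> (b n)\<^sup>2" if x: "x \<in> carrier G" for x
      using conv_bound[OF cP cP x, of n n] cpow_add[OF k(1) x, of n n] by (simp add: b_def power2_eq_square)
    then show ?thesis unfolding b_def mult_2 by (intro n2_le_sup cP) (simp add: b_def)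
  qed
  obtain lam A where lam: "0 < lam" "1 \<le> A" "(\<lambda>n. b n / lam ^ Suc n) \<longlonglongrightarrow> A"
    using power_growth_limit[of b] pos2 conv bdd dbl by blast
  define c where "c n = b n / lam ^ Suc n" for n
  define s where "s n = complex_of_real (1 / lam ^ Suc n)" for n
  \<comment> \<open>U n is the (n + 1)-st convolution power of k * k / lam. Because of the shifted
    index, U m convolved with U n is U (m + n + 1).\<close>
  define U where "U n = (\<lambda>x. s n * ?P (Suc (2 * n)) x)" for n
  have cU: "cont (U n)" for n unfolding U_def by (intro cont_cmult cP)
  have s_mult: "s m * s n = s (Suc (m + n))" for m n
    by (simp add: s_def power_add[symmetric] flip: of_real_mult power_Suc)
  have ipU: "ip (U m) (U n) = of_real (c (Suc (m + n)))" for m n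
  proof -
    have "ip (U m) (U n) = s m * s n * ?P (Suc (2 * (Suc (m + n)))) \<one>"
      unfolding U_def ip_cmult_left ip_cmult_right cpow_ip[OF k] by (simp add: s_def)
    also have "\<dots> = of_real (c (Suc (m + n)))"
      unfolding s_mult b_ip[symmetric] by (simp add: s_def c_def)
    finally show ?thesis .
  qed
  have n2U: "n2 (\<lambda>x. U m x - U n x) = c (Suc (m + m)) - 2 * c (Suc (m + n)) + c (Suc (n + n))" for m n
  proof -
    have "complex_of_real (n2 (\<lambda>x. U m x - U n x)) = ip (U m) (U m) - ip (U n) (U m) - (ip (U m) (U n) - ip (U n) (U n))"
      unfolding ip_self[symmetric]
      by (simp add: ip_diff_left[OF cU cU continuous_map_diff[OF cU cU]] ip_diff_right[OF cU cU cU])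
    also have "\<dots> = of_real (c (Suc (m + m)) - 2 * c (Suc (m + n)) + c (Suc (n + n)))"
      unfolding ipU by (simp add: add.commute)
    finally show ?thesis by (simp only: of_real_eq_iff)
  qed
  have convU: "conv (U m) (U n) x = U (Suc (m + n)) x" if x: "x \<in> carrier G" for m n x
    unfolding U_def conv_cmult_left conv_cmult_right cpow_add[OF k(1) x]
    by (simp add: mult.assoc[symmetric] s_mult)
  have c_lim: "c \<longlonglongrightarrow> A" using lam(3) by (simp add: c_def[abs_def])
  \<comment> \<open>All inner products of the U n are terms of the convergent sequence c, so U is
    Cauchy in mean square. One further convolution with U 0 makes it uniformly Cauchy.\<close>
  have cauchy: "\<exists>N. \<forall>m\<ge>N. \<forall>n\<ge>N. \<forall>x\<in>carrier G. (cmod (U m x - U n x))\<^sup>2 \<le> e" if e: "0 < e" for e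
  proof -
    \<comment> \<open>The summand 1 keeps the divisor positive without a case distinction; the 4 in
      \<open>d\<close> is the total 1 + 2 + 1 of the coefficients in \<open>n2U\<close>.\<close>
    define a where "a = n2 (U 0) + 1"
    define d where "d = e / (4 * a)"
    have nU: "0 < a" by (simp add: a_def add_nonneg_pos)
    have d: "0 < d" using e nU by (simp add: d_def)
    obtain N where N: "\<And>n. N \<le> n \<Longrightarrow> \<bar>c n - A\<bar> < d"
      using LIMSEQ_D[OF c_lim d] by auto
    have "(cmod (U (Suc m) x - U (Suc n) x))\<^sup>2 \<le> e" if mn: "N \<le> m" "N \<le> n" and x: "x \<in> carrier G" for m n x
    proof -
      have "U (Suc m) x - U (Suc n) x = conv (U 0) (\<lambda>x. U m x - U n x) x"
        by (simp add: conv_diff_right[OF cU cU cU x] convU[OF x])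
      then have "(cmod (U (Suc m) x - U (Suc n) x))\<^sup>2 \<le> n2 (U 0) * n2 (\<lambda>x. U m x - U n x)"
        using conv_bound[OF cU continuous_map_diff[OF cU cU] x] by simp
      also have "n2 (\<lambda>x. U m x - U n x) \<le> 4 * d"
        unfolding n2U using N[of "Suc (m + m)"] N[of "Suc (m + n)"] N[of "Suc (n + n)"] mn by linarith
      then have "n2 (U 0) * n2 (\<lambda>x. U m x - U n x) \<le> a * (4 * d)"
        unfolding a_def by (intro mult_mono) auto
      also have "\<dots> = e" using nU by (simp add: d_def)
      finally show ?thesis .
    qed
    then have "\<forall>m\<ge>Suc N. \<forall>n\<ge>Suc N. \<forall>x\<in>carrier G. (cmod (U m x - U n x))\<^sup>2 \<le> e"
      by (metis Suc_le_D Suc_le_mono)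
    then show ?thesis by blast
  qed
  have cauchy': "\<exists>N. \<forall>m\<ge>N. \<forall>n\<ge>N. \<forall>x\<in>carrier G. cmod (U m x - U n x) < e" if e: "0 < e" for e
  proof -
    obtain N where "\<forall>m\<ge>N. \<forall>n\<ge>N. \<forall>x\<in>carrier G. (cmod (U m x - U n x))\<^sup>2 \<le> (e / 2)\<^sup>2"
      using cauchy[of "(e / 2)\<^sup>2"] e by auto
    then have "\<forall>m\<ge>N. \<forall>n\<ge>N. \<forall>x\<in>carrier G. cmod (U m x - U n x) \<le> e / 2"
      using e by (auto intro: power2_le_imp_le)
    then show ?thesis using e by (intro exI[of _ N]) (smt (verit) field_sum_of_halves)
  qed
  have "\<exists>l. (\<lambda>n. U n x) \<longlonglongrightarrow> l" if "x \<in> carrier G" for x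
  proof -
    have "Cauchy (\<lambda>n. U n x)"
      using cauchy' that by (intro CauchyI) blast
    then show ?thesis by (simp add: Cauchy_convergent_iff convergent_def)
  qed
  then obtain p where p: "\<And>x. x \<in> carrier G \<Longrightarrow> (\<lambda>n. U n x) \<longlonglongrightarrow> p x" by metis
  have unif: "\<exists>N. \<forall>n\<ge>N. \<forall>x\<in>carrier G. cmod (U n x - p x) \<le> e" if e: "0 < e" for e
  proof -
    obtain N where N: "\<forall>m\<ge>N. \<forall>n\<ge>N. \<forall>x\<in>carrier G. cmod (U m x - U n x) < e" using cauchy'[OF e] by blast
    have "cmod (U n x - p x) \<le> e" if n: "N \<le> n" and x: "x \<in> carrier G" for n x
    proof (rule LIMSEQ_le_const2)
      show "(\<lambda>m. cmod (U n x - U m x)) \<longlonglongrightarrow> cmod (U n x - p x)"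
        by (intro tendsto_norm tendsto_diff tendsto_const p x)
      show "\<exists>M. \<forall>m\<ge>M. cmod (U n x - U m x) \<le> e" using N n x by (intro exI[of _ N]) (auto intro: less_imp_le)
    qed
    then show ?thesis by blast
  qed
  have cp: "cont p"
  proof (rule continuous_map_approx)
    fix e :: real assume "0 < e"
    then obtain N where "\<forall>n\<ge>N. \<forall>x\<in>carrier G. cmod (U n x - p x) \<le> e / 2" using unif[of "e / 2"] by auto
    then have "cmod (U N x - p x) < e" if "x \<in> carrier G" for x
      using that \<open>0 < e\<close> by (intro le_less_trans[of "cmod (U N x - p x)" "e / 2" e]) auto
    then show "\<exists>g. cont g \<and> (\<forall>x\<in>topspace T. dist (g x) (p x) < e)"
      using cU by (intro exI[of _ "U N"]) (auto simp: dist_norm)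
  qed
  have fixp: "conv (U 0) p x = p x" if x: "x \<in> carrier G" for x
  proof -
    have "(\<lambda>n. conv (U 0) (U n) x) \<longlonglongrightarrow> conv (U 0) p x"
    proof (rule LIMSEQ_I)
      fix e :: real assume e: "0 < e"
      have nU: "0 < n2 (U 0) + 1" by (simp add: add_nonneg_pos)
      have "0 < e\<^sup>2 / (n2 (U 0) + 1)" using e nU by simp
      then obtain d where d: "0 < d" "d\<^sup>2 < e\<^sup>2 / (n2 (U 0) + 1)"
        by (metis real_sqrt_gt_zero real_sqrt_pow2 less_imp_le field_lbound_gt_zero power_strict_mono zero_less_numeral)
      obtain N where N: "\<forall>n\<ge>N. \<forall>x\<in>carrier G. cmod (U n x - p x) \<le> d" using unif[OF d(1)] by blast
      have "cmod (conv (U 0) (U n) x - conv (U 0) p x) < e" if n: "N \<le> n" for n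
      proof -
        have "conv (U 0) (U n) x - conv (U 0) p x = conv (U 0) (\<lambda>x. U n x - p x) x"
          by (simp add: conv_diff_right[OF cU cU cp x])
        then have "(cmod (conv (U 0) (U n) x - conv (U 0) p x))\<^sup>2 \<le> n2 (U 0) * n2 (\<lambda>x. U n x - p x)"
          using conv_bound[OF cU continuous_map_diff[OF cU cp] x] by simp
        also have "n2 (\<lambda>x. U n x - p x) \<le> d\<^sup>2"
          using N n d(1) by (intro n2_le_sup continuous_map_diff cU cp power_mono) auto
        then have "n2 (U 0) * n2 (\<lambda>x. U n x - p x) \<le> (n2 (U 0) + 1) * d\<^sup>2"
          by (intro mult_mono) auto
        also have "\<dots> < e\<^sup>2" using d(2) nU by (simp add: field_simps)
        finally show ?thesis using e by (intro power2_less_imp_less[of _ e]) auto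
      qed
      then show "\<exists>N. \<forall>n\<ge>N. cmod (conv (U 0) (U n) x - conv (U 0) p x) < e" by blast
    qed
    moreover have "(\<lambda>n. conv (U 0) (U n) x) \<longlonglongrightarrow> p x"
      using LIMSEQ_Suc[OF p[OF x]] by (simp add: convU[OF x])
    ultimately show ?thesis by (rule LIMSEQ_unique)
  qed
  have "conv k (conv k p) x = of_real lam * p x" if x: "x \<in> carrier G" for x
  proof -
    have "p x = s 0 * conv (conv k k) p x"
      using fixp[OF x] by (simp add: U_def conv_cmult_left)
    then have "p x = s 0 * conv k (conv k p) x" by (simp add: conv_assoc[OF k(1) k(1) cp x])
    then show ?thesis using lam(1) by (simp add: s_def field_simps)
  qed
  moreover have "p \<one> \<noteq> 0"
  proof -
    have "U n \<one> = of_real (c n)" for n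
      unfolding U_def b_ip[symmetric] by (simp add: s_def c_def)
    then have "(\<lambda>n. complex_of_real (c n)) \<longlonglongrightarrow> p \<one>" using p[OF one_closed] by simp
    then have "p \<one> = of_real A" using tendsto_of_real[OF c_lim] LIMSEQ_unique by blast
    then show ?thesis using lam(2) by auto
  qed
  ultimately show ?thesis using lam(1) cp by blast
qed

section \<open>Finite-dimensional right-invariant function spaces\<close>

definition right_invariant :: "('g \<Rightarrow> complex) set \<Rightarrow> bool" where
  "right_invariant W \<longleftrightarrow> (\<forall>f\<in>W. cont f) \<and> (\<forall>f\<in>W. \<forall>h\<in>W. (\<lambda>x. f x + h x) \<in> W)
    \<and> (\<forall>c. \<forall>f\<in>W. (\<lambda>x. c * f x) \<in> W) \<and> (\<forall>g\<in>carrier G. \<forall>f\<in>W. (\<lambda>x. f (x \<otimes> g)) \<in> W)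
    \<and> (\<exists>f\<in>W. \<exists>x\<in>carrier G. f x \<noteq> 0)"

text \<open>Orthonormal families stand in for dimension. They are insensitive to values outside the
  carrier, where functions are arbitrary.\<close>

definition has_frame :: "('g \<Rightarrow> complex) set \<Rightarrow> nat \<Rightarrow> bool" where
  "has_frame W d \<longleftrightarrow> (\<exists>e. orthonormal {..<d} e \<and> (\<forall>i<d. e i \<in> W))"

lemma
  assumes "right_invariant W" "f \<in> W"
  shows right_invariant_add: "h \<in> W \<Longrightarrow> (\<lambda>x. f x + h x) \<in> W"
    and right_invariant_cmult: "(\<lambda>x. c * f x) \<in> W"
    and right_invariant_translate: "g \<in> carrier G \<Longrightarrow> (\<lambda>x. f (x \<otimes> g)) \<in> W"
  using assms by (auto simp: right_invariant_def)

lemma right_invariant_sum: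
  assumes "right_invariant W" "finite I" "\<And>i. i \<in> I \<Longrightarrow> f i \<in> W"
  shows "(\<lambda>x. \<Sum>i\<in>I. f i x) \<in> W"
  using assms(2,3)
proof (induction I rule: finite_induct)
  case empty
  obtain h where "h \<in> W" using assms(1) by (auto simp: right_invariant_def)
  from right_invariant_cmult[OF assms(1) this, of 0] show ?case by simp
next
  case (insert i I)
  then have "f i \<in> W" "(\<lambda>x. \<Sum>i\<in>I. f i x) \<in> W" by auto
  from right_invariant_add[OF assms(1) this] show ?case using insert.hyps by simp
qed

lemma orthonormal_subset: "orthonormal J e \<Longrightarrow> I \<subseteq> J \<Longrightarrow> orthonormal I e"
  unfolding orthonormal_def by blast

text \<open>Otherwise the residual of f, normalised, could be appended to the frame. The equality is
  claimed on the carrier only.\<close>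

lemma maximal_frame_spans:
  assumes W: "right_invariant W" and e: "orthonormal {..<d} e" "\<And>i. i < d \<Longrightarrow> e i \<in> W"
    and max: "\<not> has_frame W (Suc d)" and f: "f \<in> W" and x: "x \<in> carrier G"
  shows "f x = (\<Sum>i<d. ip f (e i) * e i x)"
proof (rule ccontr)
  assume ne: "f x \<noteq> (\<Sum>i<d. ip f (e i) * e i x)"
  have cf: "cont f" using W f by (simp add: right_invariant_def)
  define r where "r = (\<lambda>x. f x - (\<Sum>i<d. ip f (e i) * e i x))"
  note res = residual(1,2)[OF _ e(1) cf, folded r_def, simplified]
  have pos: "0 < n2 r" using n2_pos[OF res(1) x] ne by (simp add: r_def)
  define c where "c = complex_of_real (1 / sqrt (n2 r))"
  define e' where "e' = e(d := (\<lambda>x. c * r x))"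
  have rW: "r \<in> W"
  proof -
    have "(\<lambda>x. ip f (e i) * e i x) \<in> W" if "i < d" for i
      by (rule right_invariant_cmult[OF W e(2)[OF that]])
    then have "(\<lambda>x. \<Sum>i<d. ip f (e i) * e i x) \<in> W" by (intro right_invariant_sum[OF W]) auto
    from right_invariant_add[OF W f right_invariant_cmult[OF W this, of "- 1"]] show ?thesis by (simp add: r_def)
  qed
  have "ip (e i) r = 0" if "i < d" for i using res(2)[OF that] ip_cnj[of r "e i"] by simp
  then have "orthonormal {..<Suc d} e'"
    using e(1) res(2) orthonormal_normalize[OF res(1) pos, folded c_def] cont_cmult[OF res(1)]
    by (auto simp: orthonormal_def e'_def less_Suc_eq)
  moreover have "e' i \<in> W" if "i < Suc d" for i
  proof (cases "i = d")
    case True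
    then show ?thesis using right_invariant_cmult[OF W rW] by (simp add: e'_def)
  next
    case False
    then show ?thesis using e(2)[of i] that by (simp add: e'_def)
  qed
  ultimately show False using max unfolding has_frame_def by blast
qed

text \<open>\<open>\<pi>\<close> is the matrix of right translation in the frame. An invariant space
  S of coordinate vectors defines a right-invariant space of functions inside W; minimality, which
  is the hypothesis \<open>sub\<close>, provides d orthonormal functions there, whose coordinate
  vectors form an orthonormal basis contained in S. Containment in W is understood up to values off
  the carrier.\<close>

lemma minimal_invariant_irreducible:
  assumes W: "right_invariant W" and d0: "0 < d"
    and e: "orthonormal {..<d} e" "\<And>i. i < d \<Longrightarrow> e i \<in> W" and max: "\<not> has_frame W (Suc d)"
    and sub: "\<And>W'. right_invariant W' \<Longrightarrow>
      (\<And>f. f \<in> W' \<Longrightarrow> \<exists>h\<in>W. \<forall>x\<in>carrier G. f x = h x) \<Longrightarrow> has_frame W' d"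
  defines "\<pi> \<equiv> \<lambda>g i j. \<integral>x. e j (x \<otimes> g) * cnj (e i x) \<partial>\<mu>"
  shows "irreducible_rep G T (d, \<pi>)"
    and "\<And>j x g. j < d \<Longrightarrow> x \<in> carrier G \<Longrightarrow> g \<in> carrier G \<Longrightarrow> e j (x \<otimes> g) = (\<Sum>i<d. \<pi> g i j * e i x)"
proof -
  have ce: "cont (e i)" if "i < d" for i using e(1) that by (simp add: orthonormal_def)
  have on: "ip (e i) (e j) = (if i = j then 1 else 0)" if "i < d" "j < d" for i j
    using e(1) that by (simp add: orthonormal_def)
  have \<pi>: "\<pi> g i j = ip (\<lambda>x. e j (x \<otimes> g)) (e i)" for g i j by (simp add: \<pi>_def ip_def)
  show tr: "e j (x \<otimes> g) = (\<Sum>i<d. \<pi> g i j * e i x)" if "j < d" "x \<in> carrier G" "g \<in> carrier G" for j x g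
  proof -
    have "(\<lambda>x. e j (x \<otimes> g)) \<in> W" by (rule right_invariant_translate[OF W e(2)[OF that(1)] that(3)])
    from maximal_frame_spans[OF W e max this that(2)] show ?thesis by (simp add: \<pi>)
  qed
  have ip_translate: "ip (\<lambda>x. f (x \<otimes> g)) (\<lambda>x. h (x \<otimes> g)) = ip f h" if "cont f" "cont h" "g \<in> carrier G" for f h g
    unfolding ip_def
    by (rule integral_right_invariant[OF continuous_map_cmult[OF that(1) continuous_map_cnj[OF that(2)]] that(3)])
  have ip_comb: "ip (\<lambda>x. \<Sum>i<d. v i * e i x) (e j) = v j" if "j < d" for v j
  proof -
    have "ip (\<lambda>x. \<Sum>i<d. v i * e i x) (e j) = (\<Sum>i<d. v i * ip (e i) (e j))"
      using that by (subst ip_sum_left) (auto intro: cont_cmult ce)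
    also have "\<dots> = (\<Sum>i<d. if i = j then v i else 0)" by (intro sum.cong) (auto simp: on that)
    finally show ?thesis using that by simp
  qed
  have cs: "cont (\<lambda>x. \<Sum>i<d. v i * e i x)" for v by (intro continuous_map_sum cont_cmult ce) auto
  have ip_comb2: "ip (\<lambda>x. \<Sum>i<d. v i * e i x) (\<lambda>x. \<Sum>i<d. w i * e i x) = (\<Sum>i<d. v i * cnj (w i))" for v w
  proof -
    have "ip (\<lambda>x. \<Sum>i<d. v i * e i x) (\<lambda>x. \<Sum>i<d. w i * e i x) =
        (\<Sum>i<d. cnj (w i) * ip (\<lambda>x. \<Sum>i<d. v i * e i x) (e i))"
      by (subst ip_sum_right) (auto intro: cont_cmult ce cs)
    then show ?thesis by (simp add: ip_comb mult.commute)
  qed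
  have col: "(\<Sum>i<d. \<pi> g i j * cnj (\<pi> g i l)) = (if j = l then 1 else 0)"
    if "j < d" "l < d" "g \<in> carrier G" for g j l
  proof -
    have "(if j = l then 1 else 0) = ip (\<lambda>x. e j (x \<otimes> g)) (\<lambda>x. e l (x \<otimes> g))"
      using that by (simp add: ip_translate ce on)
    also have "\<dots> = ip (\<lambda>x. \<Sum>i<d. \<pi> g i j * e i x) (\<lambda>x. \<Sum>i<d. \<pi> g i l * e i x)"
      by (rule ip_cong) (simp_all add: tr that)
    finally show ?thesis by (simp add: ip_comb2)
  qed
  have inv: "\<pi> (inv g) i j = cnj (\<pi> g j i)" if "i < d" "j < d" "g \<in> carrier G" for g i j
  proof -
    have c: "cont (\<lambda>x. e j (x \<otimes> inv g))" using that by (intro cont_translate ce) auto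
    have "\<pi> (inv g) i j = ip (\<lambda>x. e j (x \<otimes> g \<otimes> inv g)) (\<lambda>x. e i (x \<otimes> g))"
      unfolding \<pi> using ip_translate[OF c ce[OF that(1)] that(3)] by simp
    also have "\<dots> = ip (e j) (\<lambda>x. e i (x \<otimes> g))"
      using that by (intro ip_cong) (simp_all add: m_assoc)
    finally show ?thesis by (simp add: \<pi> ip_cnj)
  qed
  have unit: "is_unitary d (\<pi> g)" if g: "g \<in> carrier G" for g
    unfolding is_unitary_def
  proof (intro allI impI)
    fix i j assume ij: "i < d" "j < d"
    have "(\<Sum>k<d. \<pi> g i k * cnj (\<pi> g j k)) = (\<Sum>k<d. \<pi> (inv g) k j * cnj (\<pi> (inv g) k i))"
      using ij g by (intro sum.cong) (auto simp: inv mult.commute)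
    also have "\<dots> = (if j = i then 1 else 0)" using col[OF ij(2,1), of "inv g"] g by simp
    finally show "(\<Sum>k<d. \<pi> g i k * cnj (\<pi> g j k)) = (if i = j then 1 else 0)" by auto
  qed
  have mult: "\<pi> (g \<otimes> h) i j = mat_mult d (\<pi> g) (\<pi> h) i j"
    if "i < d" "j < d" "g \<in> carrier G" "h \<in> carrier G" for g h i j
  proof -
    have "\<pi> (g \<otimes> h) i j = ip (\<lambda>x. \<Sum>k<d. \<pi> h k j * e k (x \<otimes> g)) (e i)"
      unfolding \<pi> using that by (intro ip_cong) (simp_all add: m_assoc[symmetric] tr[of j "_ \<otimes> g" h] \<pi>)
    also have "\<dots> = (\<Sum>k<d. \<pi> h k j * \<pi> g i k)"
    proof -
      have "cont (\<lambda>x. \<pi> h k j * e k (x \<otimes> g))" if "k < d" for k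
        by (intro cont_cmult cont_translate(2) ce that \<open>g \<in> carrier G\<close>)
      then show ?thesis using ce[OF that(1)] by (subst ip_sum_left) (auto simp: \<pi>)
    qed
    finally show ?thesis by (simp add: mat_mult_def mult.commute)
  qed
  have pc: "cont (\<lambda>g. \<pi> g i j)" if "i < d" "j < d" for i j
  proof -
    have "continuous_map (prod_topology T T) euclidean (\<lambda>z. e j (snd z \<otimes> fst z) * cnj (e i (snd z)))"
      by (intro continuous_map_cmult continuous_map_cnj cm_comp[OF ce[OF that(1)]] cm_comp[OF ce[OF that(2)]]
          cm_mult continuous_map_fst continuous_map_snd)
    from cont_param_integral[OF this] show ?thesis by (simp add: \<pi>_def)
  qed
  have ur: "unitary_rep G T (d, \<pi>)"
    using unit mult pc by (simp add: unitary_rep_def)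
  have "S = {\<lambda>_. 0} \<or> S = cvecs d"
    if S: "csubspace d S" and inv: "\<And>g v. g \<in> carrier G \<Longrightarrow> v \<in> S \<Longrightarrow> mat_vec d (\<pi> g) v \<in> S" for S
  proof (rule disjCI)
    assume "S \<noteq> cvecs d"
    show "S = {\<lambda>_. 0}"
    proof (rule ccontr)
      assume "S \<noteq> {\<lambda>_. 0}"
      then obtain v where v: "v \<in> S" "v \<noteq> (\<lambda>_. 0)" using S by (auto simp: csubspace_def)
      have Sadd: "(\<lambda>i. v i + w i) \<in> S" "(\<lambda>i. c * v i) \<in> S" if "v \<in> S" "w \<in> S" for v w c
        using S that by (auto simp: csubspace_def)
      have Sc: "v \<in> cvecs d" if "v \<in> S" for v using S that by (auto simp: csubspace_def)
      define W' where "W' = {f. cont f \<and> (\<exists>v\<in>S. \<forall>x\<in>carrier G. f x = (\<Sum>i<d. v i * e i x))}"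
      have "right_invariant W'"
        unfolding right_invariant_def
      proof (intro conjI ballI allI)
        fix f assume "f \<in> W'"
        then obtain v where f: "cont f" "v \<in> S" "\<And>x. x \<in> carrier G \<Longrightarrow> f x = (\<Sum>i<d. v i * e i x)"
          by (auto simp: W'_def)
        show "cont f" by fact
        show "(\<lambda>x. f x + h x) \<in> W'" if hW: "h \<in> W'" for h
        proof -
          obtain w where h: "cont h" "w \<in> S" "\<And>x. x \<in> carrier G \<Longrightarrow> h x = (\<Sum>i<d. w i * e i x)"
            using hW by (auto simp: W'_def)
          have "\<forall>x\<in>carrier G. f x + h x = (\<Sum>i<d. (v i + w i) * e i x)"
            by (simp add: f h distrib_right sum.distrib)
          then show ?thesis unfolding W'_def using f(1) h(1) Sadd(1)[OF f(2) h(2)]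
            by (auto intro!: continuous_map_add bexI[of _ "\<lambda>i. v i + w i"])
        qed
        show "(\<lambda>x. c * f x) \<in> W'" for c
        proof -
          have "\<forall>x\<in>carrier G. c * f x = (\<Sum>i<d. (c * v i) * e i x)"
            by (simp add: f sum_distrib_left mult.assoc)
          then show ?thesis unfolding W'_def using cont_cmult[OF f(1)] Sadd(2)[OF f(2) f(2)]
            by (intro CollectI conjI bexI[of _ "\<lambda>i. c * v i"]) auto
        qed
        show "(\<lambda>x. f (x \<otimes> g)) \<in> W'" if g: "g \<in> carrier G" for g
        proof -
          have "f (x \<otimes> g) = (\<Sum>i<d. mat_vec d (\<pi> g) v i * e i x)" if x: "x \<in> carrier G" for x
          proof -
            have "f (x \<otimes> g) = (\<Sum>j<d. \<Sum>i<d. v j * (\<pi> g i j * e i x))"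
              using x g by (simp add: f tr sum_distrib_left)
            also have "\<dots> = (\<Sum>i<d. \<Sum>j<d. v j * (\<pi> g i j * e i x))" by (rule sum.swap)
            finally show ?thesis by (simp add: mat_vec_def sum_distrib_left mult_ac)
          qed
          then show ?thesis unfolding W'_def using cont_translate(2)[OF f(1) g] inv[OF g f(2)]
            by (intro CollectI conjI bexI[of _ "mat_vec d (\<pi> g) v"]) auto
        qed
      next
        let ?f = "\<lambda>x. \<Sum>i<d. v i * e i x"
        have "cont ?f" by (intro continuous_map_sum cont_cmult ce) auto
        then have "?f \<in> W'" using v(1) by (auto simp: W'_def)
        moreover have "\<exists>x\<in>carrier G. ?f x \<noteq> 0"
        proof (rule ccontr)
          assume "\<not> (\<exists>x\<in>carrier G. ?f x \<noteq> 0)"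
          then have "ip ?f (e j) = ip (\<lambda>x. 0) (e j)" for j by (intro ip_cong) auto
          then have "v j = 0" if "j < d" for j using ip_comb[OF that, of v] by (simp add: ip_def)
          moreover have "v j = 0" if "\<not> j < d" for j using Sc[OF v(1)] that by (auto simp: cvecs_def)
          ultimately have "v j = 0" for j by (cases "j < d") blast+
          then show False using v(2) by (simp add: fun_eq_iff)
        qed
        ultimately show "\<exists>f\<in>W'. \<exists>x\<in>carrier G. f x \<noteq> 0" by (intro bexI[of _ ?f])
      qed
      moreover have "\<exists>h\<in>W. \<forall>x\<in>carrier G. f x = h x" if fW: "f \<in> W'" for f
      proof -
        obtain v where f: "\<forall>x\<in>carrier G. f x = (\<Sum>i<d. v i * e i x)" 
          using fW unfolding W'_def mem_Collect_eq by blast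
        have "(\<lambda>x. v i * e i x) \<in> W" if "i < d" for i by (rule right_invariant_cmult[OF W e(2)[OF that]])
        then have "(\<lambda>x. \<Sum>i<d. v i * e i x) \<in> W" by (intro right_invariant_sum[OF W]) auto
        then show ?thesis using f by (intro bexI[of _ "\<lambda>x. \<Sum>i<d. v i * e i x"])
      qed
      ultimately have "has_frame W' d" by (rule sub)
      then obtain e' where e': "orthonormal {..<d} e'" "\<And>i. i < d \<Longrightarrow> e' i \<in> W'"
        by (auto simp: has_frame_def)
      have "\<exists>v. v \<in> S \<and> (\<forall>x\<in>carrier G. e' i x = (\<Sum>j<d. v j * e j x))" if "i < d" for i
        using e'(2)[OF that] unfolding W'_def by blast
      then obtain V where V: "\<And>i. i < d \<Longrightarrow> V i \<in> S"
        "\<And>i x. i < d \<Longrightarrow> x \<in> carrier G \<Longrightarrow> e' i x = (\<Sum>j<d. V i j * e j x)" by metis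
      have "is_unitary d V"
        unfolding is_unitary_def
      proof (intro allI impI)
        fix i j assume ij: "i < d" "j < d"
        have "(\<Sum>k<d. V i k * cnj (V j k)) = ip (e' i) (e' j)"
          unfolding ip_comb2[symmetric] using ij by (intro ip_cong) (simp_all add: V)
        then show "(\<Sum>k<d. V i k * cnj (V j k)) = (if i = j then 1 else 0)"
          using e'(1) ij by (simp add: orthonormal_def)
      qed
      \<comment> \<open>The rows of V lie in S and are orthonormal. Orthonormality of the columns is
        the completeness relation that expands an arbitrary vector in these rows.\<close>
      then have "meq d d (mat_mult d (adj V) V) (smat 1)" by (rule unitary_left_inverse)
      have cV: "(\<Sum>i<d. cnj (V i l) * V i j) = (if l = j then 1 else 0)" if "l < d" "j < d" for l j
        using meqD[OF \<open>meq d d (mat_mult d (adj V) V) (smat 1)\<close> that]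
        by (simp add: mat_mult_def adj_def smat_def)
      have Ssum: "(\<lambda>j. \<Sum>i<n. c i * V i j) \<in> S" if "n \<le> d" for c n
        using that
      proof (induction n)
        case 0
        then show ?case using S by (simp add: csubspace_def)
      next
        case (Suc n)
        then have "(\<lambda>j. (\<Sum>i<n. c i * V i j) + c n * V n j) \<in> S"
          by (intro Sadd(1) Sadd(2)[OF V(1)[of n] V(1)[of n]]) auto
        then show ?case by simp
      qed
      have "w \<in> S" if w: "w \<in> cvecs d" for w
      proof -
        define c where "c i = (\<Sum>l<d. w l * cnj (V i l))" for i
        have "(\<Sum>i<d. c i * V i j) = w j" for j
        proof (cases "j < d")
          case True
          have "(\<Sum>i<d. c i * V i j) = (\<Sum>i<d. \<Sum>l<d. w l * (cnj (V i l) * V i j))"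
            by (simp add: c_def sum_distrib_right mult.assoc)
          also have "\<dots> = (\<Sum>l<d. w l * (\<Sum>i<d. cnj (V i l) * V i j))"
            by (subst sum.swap) (simp add: sum_distrib_left)
          also have "\<dots> = (\<Sum>l<d. if l = j then w l else 0)" using True by (intro sum.cong) (auto simp: cV)
          finally show ?thesis using True by simp
        next
          case False
          then have "V i j = 0" if "i < d" for i using Sc[OF V(1)[OF that]] by (simp add: cvecs_def)
          then show ?thesis using False w by (simp add: cvecs_def)
        qed
        then show ?thesis using Ssum[OF order_refl, of c] by simp
      qed
      then show False using \<open>S \<noteq> cvecs d\<close> Sc by blast
    qed
  qed
  then show "irreducible_rep G T (d, \<pi>)"
    using ur d0 unfolding irreducible_rep_def by auto
qed

text \<open>Completeness of the characters: the eigenfunctions of convolution by \<open>k\<close> would span a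
  finite-dimensional right-invariant space, on which Schur's lemma makes convolution by \<open>k\<close> zero.\<close>

theorem central_orthogonal_imp_zero:
  assumes k: "cont k" "hermitian k" "central k"
    and orth: "\<And>r. irreducible_rep G T r \<Longrightarrow> ip k (rep_char r) = 0"
    and x: "x \<in> carrier G"
  shows "k x = 0"
proof (rule ccontr)
  assume "k x \<noteq> 0"
  from hermitian_conv_square_eigenfunction[OF k(1,2) x this]
  obtain lam p where lam: "0 < lam" and p: "cont p" "p \<one> \<noteq> 0"
    "\<And>x. x \<in> carrier G \<Longrightarrow> conv k (conv k p) x = of_real lam * p x" by blast
  \<comment> \<open>Scaled so that the eigenspace is the space of functions fixed by convolution
    with H.\<close>
  define H where "H = (\<lambda>x. of_real (1 / lam) * conv k k x)"
  have cH: "cont H" unfolding H_def by (intro cont_cmult conv_cont k)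
  have H: "conv H f x = of_real (1 / lam) * conv k (conv k f) x" if "cont f" "x \<in> carrier G" for f x
    unfolding H_def conv_cmult_left conv_assoc[OF k(1) k(1) that] ..
  define V where "V = {f. cont f \<and> (\<forall>x\<in>carrier G. conv H f x = f x)}"
  have V: "right_invariant V"
    unfolding right_invariant_def
  proof (intro conjI ballI allI)
    fix f assume "f \<in> V"
    then have f: "cont f" "\<And>x. x \<in> carrier G \<Longrightarrow> conv H f x = f x" by (auto simp: V_def)
    show "cont f" by fact
    show "(\<lambda>x. f x + h x) \<in> V" if "h \<in> V" for h
      using that f by (auto simp: V_def conv_add_right cH intro: continuous_map_add)
    show "(\<lambda>x. c * f x) \<in> V" for c
      using f by (auto simp: V_def conv_cmult_right intro: cont_cmult)
    show "(\<lambda>x. f (x \<otimes> g)) \<in> V" if "g \<in> carrier G" for g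
      using that f by (auto simp: V_def conv_translate intro: cont_translate)
  next
    have "p \<in> V" using p lam by (simp add: V_def H)
    then show "\<exists>f\<in>V. \<exists>x\<in>carrier G. f x \<noteq> 0" using p(2) by blast
  qed
  \<comment> \<open>On V, evaluation at x is the inner product with a function w whose squared norm
    is \<open>n2 H\<close> for every x. Bessel's inequality at each x, integrated over x, bounds the
    size of any orthonormal family in V.\<close>
  have bound: "real m \<le> n2 H" if "\<And>i. i < m \<Longrightarrow> e i \<in> V" "orthonormal {..<m} e" for m e
  proof -
    have ce: "cont (e i)" if "i < m" for i using \<open>orthonormal {..<m} e\<close> that by (simp add: orthonormal_def)
    have "(\<Sum>i<m. (cmod (e i x))\<^sup>2) \<le> n2 H" if x: "x \<in> carrier G" for x
    proof -
      define w where "w = (\<lambda>y. cnj (H (x \<otimes> inv y)))"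
      have cw: "cont w" unfolding w_def by (intro continuous_map_cnj cont_translate cH x)
      have "e i x = cnj (ip w (e i))" if i: "i < m" for i
      proof -
        define F where "F = (\<lambda>y. H y * e i (inv y \<otimes> x))"
        have cF: "cont F" unfolding F_def by (intro continuous_map_cmult cH cont_translate ce i x)
        have "e i x = conv H (e i) x" using \<open>\<And>i. i < m \<Longrightarrow> e i \<in> V\<close>[OF i] x by (simp add: V_def)
        also have "\<dots> = (\<integral>y. F y \<partial>\<mu>)" by (simp add: conv_def F_def)
        also have "\<dots> = (\<integral>y. F (x \<otimes> inv y) \<partial>\<mu>)"
          using integral_inv[OF cont_translate(1)[OF cF x]] integral_left_invariant[OF cF x] by simp
        also have "\<dots> = (\<integral>y. e i y * cnj (w y) \<partial>\<mu>)"
        proof (rule integral_carrier_cong)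
          fix y assume y: "y \<in> carrier G"
          have "inv (x \<otimes> inv y) \<otimes> x = y" using x y by (simp add: inv_mult_group m_assoc)
          then show "F (x \<otimes> inv y) = e i y * cnj (w y)" by (simp add: F_def w_def mult.commute)
        qed
        finally show ?thesis by (simp add: ip_cnj) (simp add: ip_def)
      qed
      then have "(\<Sum>i<m. (cmod (e i x))\<^sup>2) = (\<Sum>i<m. (cmod (ip w (e i)))\<^sup>2)" by simp
      also have "\<dots> \<le> n2 w" using \<open>orthonormal {..<m} e\<close> cw by (intro bessel) auto
      also have "\<dots> = n2 H" unfolding w_def by (rule n2_cnj_inv_translate(2)[OF cH x])
      finally show ?thesis .
    qed
    then have "(\<integral>x. (\<Sum>i<m. (cmod (e i x))\<^sup>2) \<partial>\<mu>) \<le> n2 H"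
      using ce by (intro integral_le_const continuous_map_sum continuous_map_real_pow continuous_map_norm) auto
    moreover have "(\<integral>x. (\<Sum>i<m. (cmod (e i x))\<^sup>2) \<partial>\<mu>) = (\<Sum>i<m. n2 (e i))"
      unfolding n2_def using ce
      by (intro Bochner_Integration.integral_sum cm_integrable continuous_map_real_pow continuous_map_norm) auto
    moreover have "n2 (e i) = 1" if "i < m" for i
      using ip_self[of "e i"] \<open>orthonormal {..<m} e\<close> that by (simp add: orthonormal_def)
    ultimately show ?thesis by simp
  qed
  define good where "good W \<longleftrightarrow> right_invariant W \<and> W \<subseteq> V" for W
  have frame_le: "m \<le> nat \<lceil>n2 H\<rceil>" if fr: "has_frame W m" and gd: "good W" for W m
  proof -
    obtain e where "orthonormal {..<m} e" "\<And>i. i < m \<Longrightarrow> e i \<in> W" using fr by (auto simp: has_frame_def)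
    then have "real m \<le> n2 H" using bound[of m e] gd by (auto simp: good_def)
    then show ?thesis by linarith
  qed
  have frame_mono: "has_frame W m" if fr: "has_frame W n" and mn: "m \<le> n" for W m n
  proof -
    obtain e where e: "orthonormal {..<n} e" "\<forall>i<n. e i \<in> W" using fr unfolding has_frame_def by blast
    have "orthonormal {..<m} e" by (rule orthonormal_subset[OF e(1)]) (use mn in auto)
    then show ?thesis using e(2) mn unfolding has_frame_def by (intro exI[of _ e]) auto
  qed
  \<comment> \<open>The greatest frame size exists by the bound above. A right-invariant subspace of
    V of least rank will carry the irreducible representation.\<close>
  define rk where "rk W = (GREATEST m. has_frame W m)" for W
  have f0: "has_frame W 0" for W by (simp add: has_frame_def orthonormal_def)
  have rk: "has_frame W (rk W)" "\<not> has_frame W (Suc (rk W))" if "good W" for W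
  proof -
    show "has_frame W (rk W)" unfolding rk_def
      by (rule GreatestI_nat[where P = "has_frame W", OF f0]) (use frame_le[OF _ that] in blast)
    show "\<not> has_frame W (Suc (rk W))"
      using Greatest_le_nat[of "has_frame W" "Suc (rk W)" "nat \<lceil>n2 H\<rceil>"] frame_le[OF _ that]
      unfolding rk_def by fastforce
  qed
  have "good V" using V by (simp add: good_def)
  then obtain W where W: "good W" "\<And>W'. good W' \<Longrightarrow> rk W \<le> rk W'"
    using ex_has_least_nat[of good V rk] by blast
  define d where "d = rk W"
  have Wi: "right_invariant W" "W \<subseteq> V" using W(1) by (auto simp: good_def)
  obtain e where e: "orthonormal {..<d} e" "\<And>i. i < d \<Longrightarrow> e i \<in> W"
    using rk(1)[OF W(1)] by (auto simp: has_frame_def d_def)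
  have max: "\<not> has_frame W (Suc d)" using rk(2)[OF W(1)] by (simp add: d_def)
  have d0: "0 < d"
  proof (rule ccontr)
    assume "\<not> 0 < d"
    obtain f y where "f \<in> W" "y \<in> carrier G" "f y \<noteq> 0" using Wi(1) by (auto simp: right_invariant_def)
    then show False using maximal_frame_spans[OF Wi(1) e max, of f y] \<open>\<not> 0 < d\<close> by simp
  qed
  have sub: "has_frame W' d"
    if "right_invariant W'" "\<And>f. f \<in> W' \<Longrightarrow> \<exists>h\<in>W. \<forall>x\<in>carrier G. f x = h x" for W'
  proof -
    have "f \<in> V" if fW: "f \<in> W'" for f
    proof -
      obtain h where h: "h \<in> V" "\<And>x. x \<in> carrier G \<Longrightarrow> f x = h x"
        using \<open>\<And>f. f \<in> W' \<Longrightarrow> \<exists>h\<in>W. \<forall>x\<in>carrier G. f x = h x\<close>[OF fW] Wi(2) by blast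
      have "conv H f x = conv H h x" if "x \<in> carrier G" for x using h(2) that by (intro conv_cong) auto
      moreover have "cont f" using \<open>right_invariant W'\<close> that by (simp add: right_invariant_def)
      ultimately show ?thesis using h by (simp add: V_def)
    qed
    then have "good W'" using that(1) by (auto simp: good_def)
    then show ?thesis using W(2) rk(1) frame_mono unfolding d_def by blast
  qed
  define \<pi> where "\<pi> = (\<lambda>g i j. \<integral>x. e j (x \<otimes> g) * cnj (e i x) \<partial>\<mu>)"
  have irr: "irreducible_rep G T (d, \<pi>)"
    and tr: "\<And>j x g. j < d \<Longrightarrow> x \<in> carrier G \<Longrightarrow> g \<in> carrier G \<Longrightarrow> e j (x \<otimes> g) = (\<Sum>i<d. \<pi> g i j * e i x)"
    unfolding \<pi>_def using minimal_invariant_irreducible[OF Wi(1) d0 e max sub] by blast+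
  have ur: "unitary_rep G T (d, \<pi>)" using irr by (simp add: irreducible_rep_def)
  \<comment> \<open>Translating \<open>e 0\<close> to the identity expresses the convolution through
    the integrals of k against matrix entries of \<open>\<pi>\<close>; these vanish since k is
    central and orthogonal to the character.\<close>
  have k0: "conv k (e 0) x = 0" if x: "x \<in> carrier G" for x
  proof -
    have "conv k (e 0) x = (\<integral>y. (\<Sum>i<d. \<Sum>l<d. (\<pi> x l 0 * e i \<one>) * (k y * cnj (\<pi> y l i))) \<partial>\<mu>)"
      unfolding conv_def
    proof (rule integral_carrier_cong)
      fix y assume y: "y \<in> carrier G"
      have "e 0 (inv y \<otimes> x) = (\<Sum>i<d. \<pi> (inv y \<otimes> x) i 0 * e i \<one>)"
        using tr[OF d0 one_closed, of "inv y \<otimes> x"] x y by simp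
      also have "\<dots> = (\<Sum>i<d. \<Sum>l<d. cnj (\<pi> y l i) * \<pi> x l 0 * e i \<one>)"
        using x y d0 by (simp add: rep_mult_entry[OF ur] rep_inv_entry[OF ur] sum_distrib_right)
      finally show "k y * e 0 (inv y \<otimes> x) = (\<Sum>i<d. \<Sum>l<d. (\<pi> x l 0 * e i \<one>) * (k y * cnj (\<pi> y l i)))"
        by (simp add: sum_distrib_left mult_ac)
    qed
    also have "\<dots> = (\<Sum>i<d. \<Sum>l<d. \<integral>y. (\<pi> x l 0 * e i \<one>) * (k y * cnj (\<pi> y l i)) \<partial>\<mu>)"
    proof -
      have c: "cont (\<lambda>y. (\<pi> x l 0 * e i \<one>) * (k y * cnj (\<pi> y l i)))" if "l < d" "i < d" for l i
        using that by (intro cont_cmult continuous_map_cmult k continuous_map_cnj rep_cont[OF ur])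
      have "(\<integral>y. (\<Sum>i<d. \<Sum>l<d. (\<pi> x l 0 * e i \<one>) * (k y * cnj (\<pi> y l i))) \<partial>\<mu>) =
          (\<Sum>i<d. \<integral>y. (\<Sum>l<d. (\<pi> x l 0 * e i \<one>) * (k y * cnj (\<pi> y l i))) \<partial>\<mu>)"
        by (intro integral_sum_cont continuous_map_sum c) auto
      also have "\<dots> = (\<Sum>i<d. \<Sum>l<d. \<integral>y. (\<pi> x l 0 * e i \<one>) * (k y * cnj (\<pi> y l i)) \<partial>\<mu>)"
        by (intro sum.cong refl integral_sum_cont c) auto
      finally show ?thesis .
    qed
    also have "\<dots> = 0"
      using central_fourier_scalar[OF irr k(1,3)] orth[OF irr]
      by (intro sum.neutral ballI) (simp add: ip_def)
    finally show ?thesis .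
  qed
  have e0: "e 0 \<in> V" "cont (e 0)" using e(2)[OF d0] Wi(2) by (auto simp: V_def)
  have "e 0 x = 0" if x: "x \<in> carrier G" for x
  proof -
    have "e 0 x = of_real (1 / lam) * conv k (conv k (e 0)) x" using e0 x H by (auto simp: V_def)
    also have "conv k (conv k (e 0)) x = conv k (\<lambda>_. 0) x" using k0 x by (intro conv_cong) auto
    finally show ?thesis by (simp add: conv_def)
  qed
  then have "ip (e 0) (e 0) = ip (\<lambda>_. 0) (e 0)" by (intro ip_cong) auto
  then show False using e(1) d0 by (simp add: orthonormal_def ip_def)
qed

section \<open>Autocorrelation and Parseval's identity\<close>

definition autocorr :: "('g \<Rightarrow> complex) \<Rightarrow> 'g \<Rightarrow> complex" where
  "autocorr z x = (\<integral>y. z y * cnj (z (inv x \<otimes> y)) \<partial>\<mu>)"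

text \<open>\<open>autocorr z\<close> is the convolution of z with the function x -> cnj (z (inv
  x)). It is Hermitian, as the completeness theorem demands, while z itself need not be.\<close>

lemma autocorr:
  assumes z: "cont z" "central z"
  shows "cont (autocorr z)" "hermitian (autocorr z)" "central (autocorr z)" "autocorr z \<one> = of_real (n2 z)"
proof -
  have "continuous_map (prod_topology T T) euclidean (\<lambda>u. z (snd u) * cnj (z (inv (fst u) \<otimes> snd u)))"
    by (intro continuous_map_cmult continuous_map_cnj cm_comp[OF z(1)] cm_mult cm_inv
        continuous_map_fst continuous_map_snd)
  from cont_param_integral[OF this] show "cont (autocorr z)" by (simp add: autocorr_def[abs_def])
  have c: "cont (\<lambda>y. z y * cnj (z (x \<otimes> y)))" if "x \<in> carrier G" for x
    by (intro continuous_map_cmult continuous_map_cnj z cont_translate that)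
  show "hermitian (autocorr z)"
    unfolding hermitian_def
  proof
    fix x assume x: "x \<in> carrier G"
    have "autocorr z (inv x) = (\<integral>y. z (inv x \<otimes> y) * cnj (z (x \<otimes> (inv x \<otimes> y))) \<partial>\<mu>)"
      using integral_left_invariant[OF c[OF x], of "inv x"] x by (simp add: autocorr_def)
    also have "\<dots> = (\<integral>y. cnj (z y * cnj (z (inv x \<otimes> y))) \<partial>\<mu>)"
      using x by (intro integral_carrier_cong) (simp add: m_assoc[symmetric])
    also have "\<dots> = cnj (autocorr z x)" by (simp only: Bochner_Integration.integral_cnj autocorr_def)
    finally show "autocorr z (inv x) = cnj (autocorr z x)" .
  qed
  have conj: "autocorr z (h \<otimes> x \<otimes> inv h) = autocorr z x" if h: "h \<in> carrier G" and x: "x \<in> carrier G" for h x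
  proof -
    define y' where "y' y = h \<otimes> y \<otimes> inv h" for y
    have "autocorr z (h \<otimes> x \<otimes> inv h) = (\<integral>y. z (y' y) * cnj (z (inv (h \<otimes> x \<otimes> inv h) \<otimes> y' y)) \<partial>\<mu>)"
      using integral_conj_invariant[OF c h, of "inv (h \<otimes> x \<otimes> inv h)"] h x by (simp add: autocorr_def y'_def)
    also have "\<dots> = (\<integral>y. z y * cnj (z (inv x \<otimes> y)) \<partial>\<mu>)"
    proof (rule integral_carrier_cong)
      fix y assume y: "y \<in> carrier G"
      have "inv h \<otimes> (h \<otimes> u) = u" if "u \<in> carrier G" for u
        using h that by (simp add: m_assoc[symmetric])
      then have "inv (h \<otimes> x \<otimes> inv h) \<otimes> y' y = h \<otimes> (inv x \<otimes> y) \<otimes> inv h"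
        using h x y unfolding y'_def by (simp add: inv_mult_group m_assoc)
      then show "z (y' y) * cnj (z (inv (h \<otimes> x \<otimes> inv h) \<otimes> y' y)) = z y * cnj (z (inv x \<otimes> y))"
        using central_conj[OF z(2) _ h] x y by (simp add: y'_def)
    qed
    finally show ?thesis by (simp add: autocorr_def)
  qed
  show "central (autocorr z)"
    unfolding central_def
  proof (intro ballI)
    fix g h assume gh: "g \<in> carrier G" "h \<in> carrier G"
    have "h \<otimes> (g \<otimes> h) \<otimes> inv h = h \<otimes> g" using gh by (simp add: m_assoc)
    then show "autocorr z (g \<otimes> h) = autocorr z (h \<otimes> g)" using conj[of h "g \<otimes> h"] gh by simp
  qed
  show "autocorr z \<one> = of_real (n2 z)"
    unfolding ip_self[symmetric] autocorr_def ip_def by (rule integral_carrier_cong) simp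
qed

text \<open>Replacing x by y inv x separates the character into matrix entries at y and at x and
  leaves the sum of the |S i j|^2. As S is the scalar matrix with entry a / d, this is d |a /
  d|^2.\<close>

lemma autocorr_char:
  assumes z: "cont z" "central z" and r: "irreducible_rep G T (d, \<pi>)"
  shows "ip (autocorr z) (rep_char (d, \<pi>)) = of_real ((cmod (ip z (rep_char (d, \<pi>))))\<^sup>2 / real d)"
proof -
  have ur: "unitary_rep G T (d, \<pi>)" and d0: "0 < d" using r by (auto simp: irreducible_rep_def)
  let ?\<chi> = "rep_char (d, \<pi>)"
  have cx: "cont ?\<chi>" by (rule rep_char_cont[OF ur])
  define a where "a = ip z ?\<chi>"
  define S where "S i j = (\<integral>x. z x * cnj (\<pi> x i j) \<partial>\<mu>)" for i j
  have S: "S i j = (if i = j then a / of_nat d else 0)" if "i < d" "j < d" for i j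
    unfolding S_def a_def ip_def by (rule central_fourier_scalar[OF r z that])
  let ?F = "\<lambda>u. z (snd u) * cnj (z (inv (fst u) \<otimes> snd u)) * cnj (?\<chi> (fst u))"
  have F: "continuous_map (prod_topology T T) euclidean ?F"
    by (intro continuous_map_cmult continuous_map_cnj cm_comp[OF z(1)] cm_comp[OF cx] cm_mult cm_inv
        continuous_map_fst continuous_map_snd)
  have "ip (autocorr z) ?\<chi> = (\<integral>x. (\<integral>y. ?F (x, y) \<partial>\<mu>) \<partial>\<mu>)"
    by (simp add: ip_def autocorr_def)
  also have "\<dots> = (\<integral>y. (\<integral>x. ?F (x, y) \<partial>\<mu>) \<partial>\<mu>)" by (rule fubini[OF F, symmetric])
  also have "\<dots> = (\<integral>y. (\<Sum>i<d. \<Sum>j<d. z y * cnj (\<pi> y i j) * cnj (S i j)) \<partial>\<mu>)"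
  proof (rule integral_carrier_cong)
    fix y assume y: "y \<in> carrier G"
    have c: "cont (\<lambda>x. cnj (z (inv x \<otimes> y)) * cnj (?\<chi> x))"
      using y by (intro continuous_map_cmult continuous_map_cnj cx cont_translate(4)[OF z(1)])
    have cS: "cont (\<lambda>x. cnj (\<pi> y i j) * cnj (z x * cnj (\<pi> x i j)))" if "i < d" "j < d" for i j
      using that by (intro cont_cmult continuous_map_cmult continuous_map_cnj z rep_cont[OF ur])
    have "(\<integral>x. ?F (x, y) \<partial>\<mu>) = z y * (\<integral>x. cnj (z (inv x \<otimes> y)) * cnj (?\<chi> x) \<partial>\<mu>)"
      by (simp add: mult.assoc)
    also have "(\<integral>x. cnj (z (inv x \<otimes> y)) * cnj (?\<chi> x) \<partial>\<mu>)
        = (\<integral>x. cnj (z (inv (y \<otimes> inv x) \<otimes> y)) * cnj (?\<chi> (y \<otimes> inv x)) \<partial>\<mu>)"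
      using integral_inv[OF cont_translate(1)[OF c y]] integral_left_invariant[OF c y] by simp
    also have "\<dots> = (\<integral>x. (\<Sum>i<d. \<Sum>j<d. cnj (\<pi> y i j) * cnj (z x * cnj (\<pi> x i j))) \<partial>\<mu>)"
    proof (rule integral_carrier_cong)
      fix x assume x: "x \<in> carrier G"
      have "inv (y \<otimes> inv x) \<otimes> y = x" using x y by (simp add: inv_mult_group m_assoc)
      moreover have "?\<chi> (y \<otimes> inv x) = (\<Sum>i<d. \<Sum>j<d. \<pi> y i j * cnj (\<pi> x i j))"
        using x y by (simp add: rep_char_def rep_mult_entry[OF ur] rep_inv_entry[OF ur])
      ultimately show "cnj (z (inv (y \<otimes> inv x) \<otimes> y)) * cnj (?\<chi> (y \<otimes> inv x)) =
          (\<Sum>i<d. \<Sum>j<d. cnj (\<pi> y i j) * cnj (z x * cnj (\<pi> x i j)))"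
        by (simp add: sum_distrib_left mult_ac)
    qed
    also have "\<dots> = (\<Sum>i<d. \<integral>x. (\<Sum>j<d. cnj (\<pi> y i j) * cnj (z x * cnj (\<pi> x i j))) \<partial>\<mu>)"
      by (intro integral_sum_cont continuous_map_sum cS) auto
    also have "\<dots> = (\<Sum>i<d. \<Sum>j<d. \<integral>x. cnj (\<pi> y i j) * cnj (z x * cnj (\<pi> x i j)) \<partial>\<mu>)"
      by (intro sum.cong refl integral_sum_cont cS) auto
    also have "\<dots> = (\<Sum>i<d. \<Sum>j<d. cnj (\<pi> y i j) * cnj (S i j))"
      by (simp only: S_def integral_mult_right_zero Bochner_Integration.integral_cnj)
    finally show "(\<integral>x. ?F (x, y) \<partial>\<mu>) = (\<Sum>i<d. \<Sum>j<d. z y * cnj (\<pi> y i j) * cnj (S i j))"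
      by (simp add: sum_distrib_left mult_ac)
  qed
  also have "\<dots> = (\<Sum>i<d. \<Sum>j<d. S i j * cnj (S i j))"
  proof -
    have c: "cont (\<lambda>y. z y * cnj (\<pi> y i j) * cnj (S i j))" if "i < d" "j < d" for i j
      using that by (intro continuous_map_cmult continuous_map_cnj z rep_cont[OF ur] continuous_map_canonical_const)
    have "(\<integral>y. (\<Sum>i<d. \<Sum>j<d. z y * cnj (\<pi> y i j) * cnj (S i j)) \<partial>\<mu>) =
       (\<Sum>i<d. \<integral>y. (\<Sum>j<d. z y * cnj (\<pi> y i j) * cnj (S i j)) \<partial>\<mu>)"
      by (intro integral_sum_cont continuous_map_sum c) auto
    also have "\<dots> = (\<Sum>i<d. \<Sum>j<d. \<integral>y. z y * cnj (\<pi> y i j) * cnj (S i j) \<partial>\<mu>)"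
      by (intro sum.cong refl integral_sum_cont c) auto
    finally show ?thesis by (simp add: S_def)
  qed
  also have "\<dots> = (\<Sum>i<d. \<Sum>j<d. if i = j then (a / of_nat d) * cnj (a / of_nat d) else 0)"
    by (intro sum.cong refl) (simp add: S)
  also have "\<dots> = of_nat d * ((a / of_nat d) * cnj (a / of_nat d))" by simp
  also have "\<dots> = a * cnj a / of_nat d" using d0 by simp
  also have "\<dots> = of_real ((cmod a)\<^sup>2 / real d)"
    unfolding of_real_divide complex_norm_square by simp
  finally show ?thesis by (simp only: a_def)
qed

text \<open>Rows of a unitary matrix have norm 1, so each of the d diagonal entries has modulus at
  most 1.\<close>

lemma rep_char_norm_le:
  assumes "unitary_rep G T (d, \<pi>)" "x \<in> carrier G"
  shows "cmod (rep_char (d, \<pi>) x) \<le> real d"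
proof -
  have "cmod (\<pi> x i i) \<le> 1" if i: "i < d" for i
  proof -
    have "complex_of_real (\<Sum>k<d. (cmod (\<pi> x i k))\<^sup>2) = (\<Sum>k<d. \<pi> x i k * cnj (\<pi> x i k))"
      by (simp only: of_real_sum complex_norm_square)
    also have "\<dots> = 1" using rep_unitary[OF assms] i by (simp add: is_unitary_def)
    finally have "(\<Sum>k<d. (cmod (\<pi> x i k))\<^sup>2) = 1" using of_real_eq_1_iff by blast
    moreover have "(cmod (\<pi> x i i))\<^sup>2 \<le> (\<Sum>k<d. (cmod (\<pi> x i k))\<^sup>2)" using i by (intro member_le_sum) auto
    ultimately show ?thesis by (simp add: abs_square_le_1)
  qed
  then have "cmod (\<Sum>i<d. \<pi> x i i) \<le> (\<Sum>i<d. 1)" by (intro sum_norm_le) auto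
  then show ?thesis by (simp add: rep_char_def)
qed

text \<open>\<open>q\<close> is the character series with the coefficients that
  \<open>autocorr_char\<close> gives for the autocorrelation of z, so completeness makes the two
  functions equal. At the identity a character divided by its degree is 1; there q becomes the sum
  of the squared coefficients, and the autocorrelation becomes the squared norm.\<close>

theorem parseval_central:
  assumes z: "cont z" "central z"
  shows "((\<lambda>\<zeta>. (cmod (ip z (character \<zeta>)))\<^sup>2) has_sum n2 z) (unitary_dual G T)"
proof -
  define D where "D = unitary_dual G T"
  define ch where "ch \<zeta> = rep_char (rep_of \<zeta>)" for \<zeta>
  define dm where "dm \<zeta> = fst (rep_of \<zeta>)" for \<zeta> :: "'g rep set"
  define a where "a \<zeta> = (cmod (ip z (ch \<zeta>)))\<^sup>2" for \<zeta>
  have irr: "irreducible_rep G T (dm \<zeta>, snd (rep_of \<zeta>))" if "\<zeta> \<in> D" for \<zeta>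
    using unitary_dual_rep(1)[of \<zeta> T] that by (simp add: D_def dm_def)
  have ch: "ch \<zeta> = rep_char (dm \<zeta>, snd (rep_of \<zeta>))" for \<zeta> by (simp add: ch_def dm_def)
  have ur: "unitary_rep G T (dm \<zeta>, snd (rep_of \<zeta>))" and dm: "0 < dm \<zeta>" if "\<zeta> \<in> D" for \<zeta>
    using irr[OF that] by (auto simp: irreducible_rep_def)
  have cch: "cont (ch \<zeta>)" if "\<zeta> \<in> D" for \<zeta> unfolding ch by (rule rep_char_cont[OF ur[OF that]])
  have on: "orthonormal D ch"
    unfolding orthonormal_def
  proof (intro conjI ballI)
    fix \<zeta> \<eta> assume D: "\<zeta> \<in> D" "\<eta> \<in> D"
    have i: "irreducible_rep G T (rep_of \<zeta>)" "irreducible_rep G T (rep_of \<eta>)"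
      using unitary_dual_rep(1) D by (auto simp: D_def)
    have "\<not> rep_equiv G (rep_of \<zeta>) (rep_of \<eta>)" if "\<zeta> \<noteq> \<eta>"
      using unitary_dual_eqI[of \<zeta> T \<eta>] D that by (auto simp: D_def)
    then show "ip (ch \<zeta>) (ch \<eta>) = (if \<zeta> = \<eta> then 1 else 0)"
      using rep_char_orth[OF i] by (auto simp: ip_def ch_def)
  qed (use cch in simp)
  have a0: "0 \<le> a \<zeta>" for \<zeta> by (simp add: a_def)
  have "sum a F \<le> n2 z" if "F \<subseteq> D" "finite F" for F
    unfolding a_def by (rule bessel[OF that(2) orthonormal_subset[OF on that(1)] z(1)])
  then have sa: "a summable_on D"
    by (intro nonneg_bdd_above_summable_on a0 bdd_aboveI2[of _ _ "n2 z"]) auto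
  \<comment> \<open>Division by the degree bounds the term by \<open>a \<zeta>\<close> everywhere on
    G, and \<open>a\<close> is summable by Bessel's inequality.\<close>
  define t where "t \<zeta> x = of_real (a \<zeta>) * (ch \<zeta> x / of_nat (dm \<zeta>))" for \<zeta> x
  have ct: "cont (t \<zeta>)" if "\<zeta> \<in> D" for \<zeta>
    using cont_cmult[OF cch[OF that], of "of_real (a \<zeta>) / of_nat (dm \<zeta>)"] by (simp add: t_def[abs_def])
  have nt: "norm (t \<zeta> x) \<le> a \<zeta>" if "\<zeta> \<in> D" "x \<in> carrier G" for \<zeta> x
  proof -
    have "cmod (ch \<zeta> x) / real (dm \<zeta>) \<le> 1"
      using rep_char_norm_le[OF ur[OF that(1)] that(2)] dm[OF that(1)] by (simp add: ch)
    then show ?thesis unfolding t_def using a0[of \<zeta>]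
      by (simp add: norm_mult norm_divide mult_left_le[of "cmod (ch \<zeta> x) / real (dm \<zeta>)" "a \<zeta>"] del: times_divide_eq_right)
  qed
  have abs_t: "(\<lambda>\<zeta>. norm (t \<zeta> x)) summable_on D" if "x \<in> carrier G" for x
  proof (rule Infinite_Sum.abs_summable_on_comparison_test)
    show "(\<lambda>\<zeta>. norm (a \<zeta>)) summable_on D" using sa a0 by simp
    show "norm (t \<zeta> x) \<le> norm (a \<zeta>)" if "\<zeta> \<in> D" for \<zeta>
      using nt[OF that \<open>x \<in> carrier G\<close>] a0[of \<zeta>] by simp
  qed
  define q where "q x = infsum (\<lambda>\<zeta>. t \<zeta> x) D" for x
  define s where "s = infsum a D"
  \<comment> \<open>Uniform approximation of q by finite partial sums over sets containing a
    prescribed \<open>F0\<close>: the coefficient of q at \<eta> is read off partial sums that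
    include \<eta>.\<close>
  have approx: "\<exists>F. finite F \<and> F \<subseteq> D \<and> F0 \<subseteq> F \<and> (\<forall>x\<in>carrier G. cmod (q x - (\<Sum>\<zeta>\<in>F. t \<zeta> x)) \<le> e)"
    if e: "0 < e" and F0: "finite F0" "F0 \<subseteq> D" for e F0
  proof -
    obtain F1 where F1: "finite F1" "F1 \<subseteq> D" "dist (sum a F1) s \<le> e"
      using has_sum_finite_approximation[OF has_sum_infsum[OF sa] e] by (auto simp: s_def)
    let ?F = "F1 \<union> F0"
    have F: "finite ?F" "?F \<subseteq> D" using F1 F0 by auto
    have "sum a F1 \<le> sum a ?F" using F a0 by (intro sum_mono2) auto
    then have sF: "s - sum a ?F \<le> e" using F1(3) by (simp add: dist_real_def abs_le_iff)
    have "cmod (q x - (\<Sum>\<zeta>\<in>?F. t \<zeta> x)) \<le> e" if x: "x \<in> carrier G" for x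
    proof -
      have st: "(\<lambda>\<zeta>. t \<zeta> x) summable_on D" by (rule abs_summable_summable[OF abs_t[OF x]])
      have "q x - (\<Sum>\<zeta>\<in>?F. t \<zeta> x) = infsum (\<lambda>\<zeta>. t \<zeta> x) (D - ?F)"
        using infsum_Diff[OF st _ F(2)] F(1) by (simp add: q_def)
      also have "cmod \<dots> \<le> infsum (\<lambda>\<zeta>. norm (t \<zeta> x)) (D - ?F)"
        by (intro norm_infsum_bound summable_on_subset_banach[OF abs_t[OF x]]) auto
      also have "\<dots> \<le> infsum a (D - ?F)"
        by (intro infsum_mono summable_on_subset_banach[OF abs_t[OF x]] summable_on_subset_banach[OF sa] nt x) auto
      also have "\<dots> = s - sum a ?F" using infsum_Diff[OF sa _ F(2)] F(1) by (simp add: s_def)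
      also have "\<dots> \<le> e" by (rule sF)
      finally show ?thesis .
    qed
    then show ?thesis using F by (intro exI[of _ ?F]) auto
  qed
  have csum: "cont (\<lambda>x. \<Sum>\<zeta>\<in>F. t \<zeta> x)" if "finite F" "F \<subseteq> D" for F
    using that ct by (intro continuous_map_sum) auto
  have cq: "cont q"
  proof (rule continuous_map_approx)
    fix e :: real assume e: "0 < e"
    obtain F where F: "finite F" "F \<subseteq> D" "\<forall>x\<in>carrier G. cmod (q x - (\<Sum>\<zeta>\<in>F. t \<zeta> x)) \<le> e / 2"
      using approx[of "e / 2" "{}"] e by auto
    have "dist (\<Sum>\<zeta>\<in>F. t \<zeta> x) (q x) < e" if "x \<in> carrier G" for x
      using F(3)[rule_format, OF that] e by (simp add: dist_norm norm_minus_commute)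
    then show "\<exists>g. cont g \<and> (\<forall>x\<in>topspace T. dist (g x) (q x) < e)"
      using csum[OF F(1,2)] by (intro exI[of _ "\<lambda>x. \<Sum>\<zeta>\<in>F. t \<zeta> x"]) simp
  qed
  have ipq: "ip q (ch \<eta>) = of_real (a \<eta> / real (dm \<eta>))" if \<eta>: "\<eta> \<in> D" for \<eta>
  proof -
    have "cmod (ip q (ch \<eta>) - of_real (a \<eta> / real (dm \<eta>))) \<le> e * real (dm \<eta>)" if e: "0 < e" for e
    proof -
      obtain F where F: "finite F" "F \<subseteq> D" "\<eta> \<in> F" "\<forall>x\<in>carrier G. cmod (q x - (\<Sum>\<zeta>\<in>F. t \<zeta> x)) \<le> e"
        using approx[OF e, of "{\<eta>}"] \<eta> by auto
      have "ip (\<lambda>x. \<Sum>\<zeta>\<in>F. t \<zeta> x) (ch \<eta>) = (\<Sum>\<zeta>\<in>F. ip (t \<zeta>) (ch \<eta>))"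
        using F ct cch[OF \<eta>] by (intro ip_sum_left) auto
      also have "\<dots> = (\<Sum>\<zeta>\<in>F. if \<zeta> = \<eta> then of_real (a \<eta> / real (dm \<eta>)) else 0)"
      proof (rule sum.cong[OF refl])
        fix \<zeta> assume "\<zeta> \<in> F"
        then have "\<zeta> \<in> D" using F(2) by blast
        then have "ip (ch \<zeta>) (ch \<eta>) = (if \<zeta> = \<eta> then 1 else 0)" using on \<eta> unfolding orthonormal_def by blast
        moreover have "ip (t \<zeta>) (ch \<eta>) = of_real (a \<zeta>) / of_nat (dm \<zeta>) * ip (ch \<zeta>) (ch \<eta>)"
          unfolding ip_cmult_left[symmetric] by (rule ip_cong) (simp_all add: t_def)
        ultimately show "ip (t \<zeta>) (ch \<eta>) = (if \<zeta> = \<eta> then of_real (a \<eta> / real (dm \<eta>)) else 0)" by simp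
      qed
      also have "\<dots> = of_real (a \<eta> / real (dm \<eta>))" using F by simp
      finally have "ip q (ch \<eta>) - of_real (a \<eta> / real (dm \<eta>)) = ip (\<lambda>x. q x - (\<Sum>\<zeta>\<in>F. t \<zeta> x)) (ch \<eta>)"
        by (simp add: ip_diff_left[OF cq csum[OF F(1,2)] cch[OF \<eta>]])
      also have "cmod \<dots> \<le> e * real (dm \<eta>)"
        unfolding ip_def
      proof (rule norm_integral_le)
        show "cont (\<lambda>x. (q x - (\<Sum>\<zeta>\<in>F. t \<zeta> x)) * cnj (ch \<eta> x))"
          by (intro continuous_map_cmult continuous_map_cnj continuous_map_diff cq csum[OF F(1,2)] cch[OF \<eta>])
        show "cmod ((q x - (\<Sum>\<zeta>\<in>F. t \<zeta> x)) * cnj (ch \<eta> x)) \<le> e * real (dm \<eta>)" if "x \<in> carrier G" for x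
          unfolding norm_mult complex_mod_cnj
          using F(4) that e rep_char_norm_le[OF ur[OF \<eta>] that] by (intro mult_mono) (auto simp: ch)
      qed
      finally show ?thesis .
    qed
    note le = this
    have "cmod (ip q (ch \<eta>) - of_real (a \<eta> / real (dm \<eta>))) \<le> 0 + e" if "0 < e" for e
      using le[of "e / real (dm \<eta>)"] that dm[OF \<eta>] by simp
    then have "cmod (ip q (ch \<eta>) - of_real (a \<eta> / real (dm \<eta>))) \<le> 0" by (rule field_le_epsilon)
    then show ?thesis by simp
  qed
  have hq: "hermitian q"
    unfolding hermitian_def
  proof
    fix x assume x: "x \<in> carrier G"
    have "t \<zeta> (inv x) = cnj (t \<zeta> x)" if "\<zeta> \<in> D" for \<zeta>
      using x by (simp add: t_def ch rep_char_def rep_inv_entry[OF ur[OF that]])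
    then show "q (inv x) = cnj (q x)" unfolding q_def infsum_cnj[symmetric] by (intro infsum_cong)
  qed
  have zq: "central q"
    unfolding central_def
  proof (intro ballI)
    fix g h assume gh: "g \<in> carrier G" "h \<in> carrier G"
    have "ch \<zeta> (g \<otimes> h) = ch \<zeta> (h \<otimes> g)" if "\<zeta> \<in> D" for \<zeta>
      unfolding ch by (rule centralD[OF rep_char_central[OF ur[OF that]] gh])
    then show "q (g \<otimes> h) = q (h \<otimes> g)" unfolding q_def t_def by (intro infsum_cong) simp
  qed
  have q1: "q \<one> = of_real s"
  proof -
    have "t \<zeta> \<one> = of_real (a \<zeta>)" if "\<zeta> \<in> D" for \<zeta>
    proof -
      have "ch \<zeta> \<one> = of_nat (dm \<zeta>)"
        using rep_one[OF ur[OF that]] by (simp add: ch rep_char_def meq_def smat_def)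
      then show ?thesis using dm[OF that] by (simp add: t_def)
    qed
    then have "q \<one> = infsum (\<lambda>\<zeta>. complex_of_real (a \<zeta>)) D" unfolding q_def by (intro infsum_cong)
    also have "\<dots> = of_real s" unfolding s_def by (rule infsumI[OF has_sum_of_real[OF has_sum_infsum[OF sa]]])
    finally show ?thesis .
  qed
  define k where "k = (\<lambda>x. autocorr z x - q x)"
  note w = autocorr[OF z]
  have "k \<one> = 0"
  proof (rule central_orthogonal_imp_zero)
    show "cont k" unfolding k_def by (intro continuous_map_diff w cq)
    show "hermitian k" using w(2) hq by (simp add: hermitian_def k_def)
    show "central k" using w(3) zq by (simp add: central_def k_def)
    show "ip k (rep_char r) = 0" if r: "irreducible_rep G T r" for r
    proof -
      obtain \<zeta> where \<zeta>: "\<zeta> \<in> D" "rep_equiv G (rep_of \<zeta>) r"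
        using unitary_dual_cover[OF r] by (auto simp: D_def)
      have "ip k (rep_char r) = ip k (ch \<zeta>)"
        using rep_equiv_char[OF \<zeta>(2)] by (intro ip_cong) (simp_all add: ch_def)
      also have "\<dots> = ip (autocorr z) (ch \<zeta>) - ip q (ch \<zeta>)"
        unfolding k_def by (rule ip_diff_left[OF w(1) cq cch[OF \<zeta>(1)]])
      also have "ip (autocorr z) (ch \<zeta>) = ip q (ch \<zeta>)"
        unfolding ipq[OF \<zeta>(1)] a_def unfolding ch by (rule autocorr_char[OF z irr[OF \<zeta>(1)]])
      finally show ?thesis by simp
    qed
  qed simp
  then have "complex_of_real (n2 z) = of_real s" using q1 w(4) by (simp add: k_def)
  then have "n2 z = s" by (simp only: of_real_eq_iff)
  then have "(a has_sum n2 z) D" using has_sum_infsum[OF sa] by (simp add: s_def)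
  then show ?thesis by (simp add: a_def[abs_def] ch_def D_def character_eq)
qed

end

section \<open>Harmonicity\<close>

lemma boxes_Nil [simp]: "boxes [] = {}"
  by (simp add: boxes_def)

lemma ysize_Nil [simp]: "ysize [] = 0"
  by (simp add: ysize_def)

lemma hook_prod_Nil [simp]: "hook_prod [] = 1"
  by (simp add: hook_prod_def)

lemma Ytotal_eq:
  assumes "finite S" "ysupp \<Lambda> \<subseteq> S"
  shows "Ytotal \<Lambda> = (\<Sum>\<zeta>\<in>S. ysize (\<Lambda> \<zeta>))"
  unfolding Ytotal_def using assms by (intro sum.mono_neutral_left) (auto simp: ysupp_def)

definition content_prod :: "complex \<Rightarrow> nat list \<Rightarrow> complex" where
  "content_prod a lam = (\<Prod>b\<in>boxes lam. (a + of_int (content b)) * (cnj a + of_int (content b)))"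

text \<open>What remains for one \<zeta> of the quotient defining \<open>phi_z\<close>: by the hook
  length formula the factorials cancel, and so does one of the two hook products.\<close>

definition local_weight :: "'g measure \<Rightarrow> ('g \<Rightarrow> complex) \<Rightarrow> 'g rep set \<Rightarrow> nat list \<Rightarrow> complex" where
  "local_weight \<mu> z \<zeta> lam =
     content_prod (alpha_z \<mu> z \<zeta>) lam / of_real (hook_prod lam * real (dim_class \<zeta>) ^ ysize lam)"

lemma local_weight_Nil [simp]: "local_weight \<mu> z \<zeta> [] = 1"
  by (simp add: local_weight_def content_prod_def)

text \<open>S may be any finite set containing the support, since the empty diagram has weight 1.
  This lets a vertex and its neighbour be compared over a common index set.\<close>

lemma phi_z_eq:
  assumes \<Lambda>: "\<Lambda> \<in> Yn D n" and S: "finite S" "ysupp \<Lambda> \<subseteq> S"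
    and dm: "\<And>\<zeta>. \<zeta> \<in> D \<Longrightarrow> 0 < dim_class \<zeta>"
  shows "phi_z \<mu> z \<Lambda> = (\<Prod>\<zeta>\<in>S. local_weight \<mu> z \<zeta> (\<Lambda> \<zeta>)) / of_real (pochhammer (I_z \<mu> z) n)"
proof -
  have n: "Ytotal \<Lambda> = n" using \<Lambda> by (simp add: Yn_def Ytotal_def)
  have D: "\<zeta> \<in> D" "young (\<Lambda> \<zeta>)" if "\<zeta> \<in> ysupp \<Lambda>" for \<zeta>
  proof -
    show "\<zeta> \<in> D" using \<Lambda> that unfolding Yn_def ysupp_def by blast
    then show "young (\<Lambda> \<zeta>)" using \<Lambda> by (simp add: Yn_def)
  qed
  define A where "A \<zeta> = content_prod (alpha_z \<mu> z \<zeta>) (\<Lambda> \<zeta>)" for \<zeta>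
  define B where "B \<zeta> = real (dim_class \<zeta>) ^ ysize (\<Lambda> \<zeta>) / hook_prod (\<Lambda> \<zeta>)" for \<zeta>
  have "M_z \<mu> z \<Lambda> = of_real (fact n / pochhammer (I_z \<mu> z) n) *
      (\<Prod>\<zeta>\<in>ysupp \<Lambda>. A \<zeta> / of_real ((hook_prod (\<Lambda> \<zeta>))\<^sup>2))"
    unfolding M_z_def n A_def content_prod_def hook_prod_def
    by (simp add: prod_dividef prod_power_distrib)
  moreover have "DIM_Y \<Lambda> = fact n * (\<Prod>\<zeta>\<in>ysupp \<Lambda>. B \<zeta>)"
    unfolding DIM_Y_def n B_def
    by (rule arg_cong[where f = "\<lambda>t. fact n * t"], rule prod.cong[OF refl]) (simp add: hook_length_formula D)
  moreover have "A \<zeta> / of_real ((hook_prod (\<Lambda> \<zeta>))\<^sup>2) = local_weight \<mu> z \<zeta> (\<Lambda> \<zeta>) * of_real (B \<zeta>)"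
    and B0: "B \<zeta> \<noteq> 0" if "\<zeta> \<in> ysupp \<Lambda>" for \<zeta>
    using dm[OF D(1)[OF that]] hook_prod_pos[OF D(2)[OF that]]
    by (simp_all add: local_weight_def A_def B_def power2_eq_square)
  ultimately have "M_z \<mu> z \<Lambda> = of_real (fact n / pochhammer (I_z \<mu> z) n) *
      ((\<Prod>\<zeta>\<in>ysupp \<Lambda>. local_weight \<mu> z \<zeta> (\<Lambda> \<zeta>)) * of_real (\<Prod>\<zeta>\<in>ysupp \<Lambda>. B \<zeta>))"
    and "DIM_Y \<Lambda> = fact n * (\<Prod>\<zeta>\<in>ysupp \<Lambda>. B \<zeta>)"
    by (simp_all add: prod.distrib)
  moreover have "(\<Prod>\<zeta>\<in>ysupp \<Lambda>. B \<zeta>) \<noteq> 0"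
    using B0 finite_subset[OF S(2,1)] by simp
  ultimately have "phi_z \<mu> z \<Lambda> = (\<Prod>\<zeta>\<in>ysupp \<Lambda>. local_weight \<mu> z \<zeta> (\<Lambda> \<zeta>)) / of_real (pochhammer (I_z \<mu> z) n)"
    by (simp add: phi_z_def del: of_real_prod)
  also have "(\<Prod>\<zeta>\<in>ysupp \<Lambda>. local_weight \<mu> z \<zeta> (\<Lambda> \<zeta>)) = (\<Prod>\<zeta>\<in>S. local_weight \<mu> z \<zeta> (\<Lambda> \<zeta>))"
    using S by (intro prod.mono_neutral_left) (auto simp: ysupp_def)
  finally show ?thesis .
qed

text \<open>The factor by which content product over hook product changes along an edge, kept as a
  real number: its nonnegativity justifies regrouping the infinite sum over edges.\<close>

definition up_ratio :: "complex \<Rightarrow> nat list \<Rightarrow> nat list \<Rightarrow> real" where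
  "up_ratio a lam mu = (cmod (a + of_int (content (box_diff lam mu))))\<^sup>2 * hook_prod lam / hook_prod mu"

lemma add_box_ysize: "add_box lam mu \<Longrightarrow> ysize mu = Suc (ysize lam)"
  by (simp add: add_box_def card_boxes)

lemma content_prod_add:
  assumes "young lam" "young mu" "add_box lam mu"
  shows "content_prod a mu / of_real (hook_prod mu) =
    content_prod a lam / of_real (hook_prod lam) * of_real (up_ratio a lam mu)"
proof -
  let ?c = "of_int (content (box_diff lam mu)) :: complex"
  have "content_prod a mu = content_prod a lam * ((a + ?c) * cnj (a + ?c))"
    using box_diff[OF assms(3)] by (simp add: content_prod_def)
  also have "(a + ?c) * cnj (a + ?c) = of_real ((cmod (a + ?c))\<^sup>2)"
    by (rule complex_norm_square[symmetric])
  finally show ?thesis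
    using hook_prod_pos[OF assms(1)] hook_prod_pos[OF assms(2)] by (simp add: up_ratio_def)
qed

text \<open>\<open>hook_prod_add_sum\<close> with b the conjugate of a, divided by the weight of
  \<open>lam\<close>; nonvanishing of the content product permits the division.\<close>

lemma up_ratio_sum:
  assumes y: "young lam" and nz: "content_prod a lam \<noteq> 0"
  shows "(\<Sum>mu | young mu \<and> add_box lam mu. up_ratio a lam mu) = (cmod a)\<^sup>2 + real (ysize lam)"
proof -
  let ?S = "{mu. young mu \<and> add_box lam mu}" and ?w = "content_prod a lam / of_real (hook_prod lam)"
  have "?w * of_real (\<Sum>mu\<in>?S. up_ratio a lam mu) = (\<Sum>mu\<in>?S. content_prod a mu / of_real (hook_prod mu))"
    unfolding of_real_sum sum_distrib_left
  proof (rule sum.cong[OF refl])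
    fix mu assume "mu \<in> ?S"
    then have "young mu" "add_box lam mu" by auto
    from content_prod_add[OF y this]
    show "?w * of_real (up_ratio a lam mu) = content_prod a mu / of_real (hook_prod mu)" by (rule sym)
  qed
  also have "\<dots> = (a * cnj a + of_nat (ysize lam)) * ?w"
    unfolding content_prod_def by (rule hook_prod_add_sum(1)[OF y])
  also have "a * cnj a + of_nat (ysize lam) = of_real ((cmod a)\<^sup>2 + real (ysize lam))"
    unfolding of_real_add complex_norm_square by simp
  finally have "?w * of_real (\<Sum>mu\<in>?S. up_ratio a lam mu) = ?w * of_real ((cmod a)\<^sup>2 + real (ysize lam))"
    by (simp only: mult.commute)
  moreover have "?w \<noteq> 0" using nz hook_prod_pos[OF y] by simp
  ultimately have "complex_of_real (\<Sum>mu\<in>?S. up_ratio a lam mu) = of_real ((cmod a)\<^sup>2 + real (ysize lam))"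
    by (metis mult_left_cancel)
  then show ?thesis by (simp only: of_real_eq_iff)
qed

lemma add_box_irrefl [simp]: "\<not> add_box lam lam"
  by (simp add: add_box_def)

text \<open>The description in \<open>edge_label\<close> is unique because no diagram has one box
  more than itself, so only the updated coordinate qualifies.\<close>

lemma edge_label_update:
  assumes "add_box (M \<zeta>) mu"
  shows "edge_label M (M(\<zeta> := mu)) = \<zeta>"
  unfolding edge_label_def using assms by (intro the_equality) (auto split: if_splits)

lemma Yn_update:
  assumes M: "M \<in> Yn D n" and "\<zeta> \<in> D" "young mu" "add_box (M \<zeta>) mu"
  shows "M(\<zeta> := mu) \<in> Yn D (Suc n)"
proof -
  have sub: "ysupp (M(\<zeta> := mu)) \<subseteq> insert \<zeta> (ysupp M)" by (auto simp: ysupp_def)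
  have fin: "finite (insert \<zeta> (ysupp M))" using M by (simp add: Yn_def)
  have "Ytotal (M(\<zeta> := mu)) = (\<Sum>\<eta>\<in>insert \<zeta> (ysupp M). ysize ((M(\<zeta> := mu)) \<eta>))"
    by (rule Ytotal_eq[OF fin sub])
  also have "\<dots> = (\<Sum>\<eta>\<in>insert \<zeta> (ysupp M). ysize (M \<eta>) + (if \<eta> = \<zeta> then 1 else 0))"
    using add_box_ysize[OF assms(4)] by (intro sum.cong) auto
  also have "\<dots> = Ytotal M + 1"
    using fin Ytotal_eq[OF fin, of M] by (simp add: sum.distrib subset_insertI)
  also have "Ytotal M = n" using M by (simp add: Yn_def Ytotal_def)
  finally have "(\<Sum>\<eta>\<in>ysupp (M(\<zeta> := mu)). ysize ((M(\<zeta> := mu)) \<eta>)) = Suc n"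
    by (simp add: Ytotal_def del: fun_upd_apply)
  moreover have "\<forall>\<eta>. \<eta> \<notin> D \<longrightarrow> (M(\<zeta> := mu)) \<eta> = []" "\<forall>\<eta>\<in>D. young ((M(\<zeta> := mu)) \<eta>)"
    using M assms by (auto simp: Yn_def)
  ultimately show ?thesis
    using finite_subset[OF sub fin] unfolding Yn_def mem_Collect_eq by blast
qed

text \<open>Turns the sum over edges into a double sum over \<zeta> and the diagrams that extend
  \<open>M \<zeta>\<close>; \<open>up_map_inj\<close> allows the reindexing.\<close>

lemma up_set_eq:
  assumes M: "M \<in> Yn D n"
  shows "{\<Lambda> \<in> Yn D (Suc n). Yedge D M \<Lambda>} =
    (\<lambda>(\<zeta>, mu). M(\<zeta> := mu)) ` (SIGMA \<zeta>:D. {mu. young mu \<and> add_box (M \<zeta>) mu})"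
proof (intro equalityI subsetI)
  fix \<Lambda> assume "\<Lambda> \<in> {\<Lambda> \<in> Yn D (Suc n). Yedge D M \<Lambda>}"
  then obtain \<zeta> where \<Lambda>: "\<Lambda> \<in> Yn D (Suc n)" "\<zeta> \<in> D" "add_box (M \<zeta>) (\<Lambda> \<zeta>)" "\<forall>\<eta>. \<eta> \<noteq> \<zeta> \<longrightarrow> \<Lambda> \<eta> = M \<eta>"
    by (auto simp: Yedge_def)
  have "young (\<Lambda> \<zeta>)" using \<Lambda> by (simp add: Yn_def)
  moreover have "\<Lambda> = M(\<zeta> := \<Lambda> \<zeta>)" using \<Lambda>(4) by (auto simp: fun_eq_iff)
  ultimately show "\<Lambda> \<in> (\<lambda>(\<zeta>, mu). M(\<zeta> := mu)) ` (SIGMA \<zeta>:D. {mu. young mu \<and> add_box (M \<zeta>) mu})"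
    using \<Lambda> by (intro image_eqI[of _ _ "(\<zeta>, \<Lambda> \<zeta>)"]) auto
next
  fix \<Lambda> assume "\<Lambda> \<in> (\<lambda>(\<zeta>, mu). M(\<zeta> := mu)) ` (SIGMA \<zeta>:D. {mu. young mu \<and> add_box (M \<zeta>) mu})"
  then obtain \<zeta> mu where "\<zeta> \<in> D" "young mu" "add_box (M \<zeta>) mu" "\<Lambda> = M(\<zeta> := mu)" by auto
  then show "\<Lambda> \<in> {\<Lambda> \<in> Yn D (Suc n). Yedge D M \<Lambda>}"
    using Yn_update[OF M] by (auto simp: Yedge_def)
qed

lemma up_map_inj:
  "inj_on (\<lambda>(\<zeta>, mu). M(\<zeta> := mu)) (SIGMA \<zeta>:D. {mu. young mu \<and> add_box (M \<zeta>) mu})"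
proof (rule inj_onI, clarify)
  fix \<zeta> mu \<zeta>' mu'
  assume a: "add_box (M \<zeta>) mu" "add_box (M \<zeta>') mu'" and e: "M(\<zeta> := mu) = M(\<zeta>' := mu')"
  have "\<zeta> = \<zeta>'" using edge_label_update[of M, OF a(1)] edge_label_update[of M, OF a(2)] e by simp
  then show "\<zeta> = \<zeta>' \<and> mu = mu'" using fun_cong[OF e, of \<zeta>] by simp
qed

theorem theorem8p1:
  fixes G :: "('g, 'b) monoid_scheme" and T :: "'g topology" and \<mu> :: "'g measure"
    and z :: "'g \<Rightarrow> complex"
  assumes "compact_group G T"
    and "normalized_haar G T \<mu>"
    and "countable (unitary_dual G T)"
    and "continuous_map T euclidean z"
    and "\<forall>g \<in> carrier G. z g \<noteq> 0"
    and "\<forall>g \<in> carrier G. \<forall>h \<in> carrier G. z (g \<otimes>\<^bsub>G\<^esub> h) = z (h \<otimes>\<^bsub>G\<^esub> g)"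
  shows "\<forall>n \<ge> 1. \<forall>M \<in> Yn (unitary_dual G T) (n - 1).
    ((\<lambda>\<Lambda>. of_nat (dim_class (edge_label M \<Lambda>)) * phi_z \<mu> z \<Lambda>) has_sum phi_z \<mu> z M)
      {\<Lambda> \<in> Yn (unitary_dual G T) n. Yedge (unitary_dual G T) M \<Lambda>}"
proof (intro allI impI ballI)
  fix n :: nat and M assume n1: "1 \<le> n" and "M \<in> Yn (unitary_dual G T) (n - 1)"
  define D where "D = unitary_dual G T"
  obtain m where n: "n = Suc m" using n1 by (cases n) auto
  have M: "M \<in> Yn D m" using \<open>M \<in> _\<close> by (simp add: n D_def)
  interpret group G using assms(1) by (simp add: compact_group_def)
  interpret haar_group G T \<mu> using assms(1,2) by unfold_locales
  define \<alpha> where "\<alpha> = alpha_z \<mu> z"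
  have \<alpha>: "\<alpha> \<zeta> = ip z (character \<zeta>)" for \<zeta> by (simp add: \<alpha>_def alpha_z_def ip_def)
  have I: "I_z \<mu> z = n2 z" by (simp add: I_z_def n2_def)
  \<comment> \<open>Nonvanishing of z makes I positive, so the divisor I + m is nonzero even for m =
    0.\<close>
  have I_pos: "0 < I_z \<mu> z" unfolding I using n2_pos[OF assms(4) one_closed] assms(5) by simp
  have dm: "0 < dim_class \<zeta>" if "\<zeta> \<in> D" for \<zeta>
    using unitary_dual_rep(1)[of \<zeta> T] that by (auto simp: irreducible_rep_def dim_class_def D_def)
  have finM: "finite (ysupp M)" and totM: "(\<Sum>\<zeta>\<in>ysupp M. ysize (M \<zeta>)) = m"
    using M by (auto simp: Yn_def)
  have suppM: "ysupp M \<subseteq> D" using M unfolding Yn_def ysupp_def by blast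
  have yM: "young (M \<zeta>)" if "\<zeta> \<in> D" for \<zeta> using M that by (simp add: Yn_def)
  define U where "U \<zeta> = {mu. young mu \<and> add_box (M \<zeta>) mu}" for \<zeta>
  \<comment> \<open>I + m is the last factor of the rising factorial at n = m + 1. With this
    constant every edge term is c times the real number \<open>up_ratio\<close>.\<close>
  define c where "c = phi_z \<mu> z M / of_real (I_z \<mu> z + real m)"
  have key: "of_nat (dim_class \<zeta>) * phi_z \<mu> z (M(\<zeta> := mu)) = c * of_real (up_ratio (\<alpha> \<zeta>) (M \<zeta>) mu)"
    if \<zeta>: "\<zeta> \<in> D" and mu: "mu \<in> U \<zeta>" for \<zeta> mu
  proof -
    let ?S = "insert \<zeta> (ysupp M)"
    have mu': "young mu" "add_box (M \<zeta>) mu" using mu by (auto simp: U_def)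
    have sub: "ysupp (M(\<zeta> := mu)) \<subseteq> ?S" by (auto simp: ysupp_def)
    define R where "R = (\<Prod>\<eta>\<in>ysupp M - {\<zeta>}. local_weight \<mu> z \<eta> (M \<eta>))"
    \<comment> \<open>\<zeta> is split off whether or not it already lies in the support of
      M.\<close>
    have prodS: "(\<Prod>\<eta>\<in>?S. f \<eta>) = f \<zeta> * (\<Prod>\<eta>\<in>ysupp M - {\<zeta>}. f \<eta>)" for f :: "_ \<Rightarrow> complex"
      using finM by (simp add: prod.insert_remove)
    have "phi_z \<mu> z (M(\<zeta> := mu)) = local_weight \<mu> z \<zeta> mu * R / of_real (pochhammer (I_z \<mu> z) (Suc m))"
    proof -
      have "(\<Prod>\<eta>\<in>ysupp M - {\<zeta>}. local_weight \<mu> z \<eta> ((M(\<zeta> := mu)) \<eta>)) = R"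
        unfolding R_def by (rule prod.cong) auto
      then show ?thesis
        using phi_z_eq[OF Yn_update[OF M \<zeta> mu'] _ sub dm] finM unfolding prodS by simp
    qed
    moreover have "phi_z \<mu> z M = local_weight \<mu> z \<zeta> (M \<zeta>) * R / of_real (pochhammer (I_z \<mu> z) m)"
      using phi_z_eq[OF M _ subset_insertI dm, of \<zeta>] finM by (simp add: prodS R_def)
    \<comment> \<open>The extra box puts one more power of the degree of \<zeta> into the
      denominator, and the multiplicity of the edge cancels it.\<close>
    moreover have "of_nat (dim_class \<zeta>) * local_weight \<mu> z \<zeta> mu =
        local_weight \<mu> z \<zeta> (M \<zeta>) * of_real (up_ratio (\<alpha> \<zeta>) (M \<zeta>) mu)"
    proof -
      have "of_nat (dim_class \<zeta>) * local_weight \<mu> z \<zeta> mu =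
          (content_prod (\<alpha> \<zeta>) mu / of_real (hook_prod mu)) / of_nat (dim_class \<zeta>) ^ ysize (M \<zeta>)"
        using dm[OF \<zeta>] by (simp add: local_weight_def \<alpha>_def add_box_ysize[OF mu'(2)])
      also have "\<dots> = local_weight \<mu> z \<zeta> (M \<zeta>) * of_real (up_ratio (\<alpha> \<zeta>) (M \<zeta>) mu)"
        unfolding content_prod_add[OF yM[OF \<zeta>] mu'] by (simp add: local_weight_def \<alpha>_def)
      finally show ?thesis .
    qed
    moreover have "complex_of_real (pochhammer (I_z \<mu> z) (Suc m)) = of_real (pochhammer (I_z \<mu> z) m) * of_real (I_z \<mu> z + real m)"
      by (simp add: pochhammer_Suc)
    ultimately show ?thesis unfolding c_def by (simp add: mult_ac)
  qed
  have "((\<lambda>(\<zeta>, mu). c * of_real (up_ratio (\<alpha> \<zeta>) (M \<zeta>) mu)) has_sum phi_z \<mu> z M) (Sigma D U)"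
  \<comment> \<open>If the value at M is zero, then c = 0 and every edge term vanishes. Otherwise no
    content product of M vanishes, as \<open>up_ratio_sum\<close> requires.\<close>
  proof (cases "phi_z \<mu> z M = 0")
    case True
    then show ?thesis by (simp add: c_def case_prod_unfold)
  next
    case False
    have nz: "content_prod (\<alpha> \<zeta>) (M \<zeta>) \<noteq> 0" for \<zeta>
    proof (cases "\<zeta> \<in> ysupp M")
      case True
      then have "local_weight \<mu> z \<zeta> (M \<zeta>) \<noteq> 0"
        using False phi_z_eq[OF M finM order_refl dm] finM by auto
      then show ?thesis by (auto simp: local_weight_def \<alpha>_def)
    next
      case False
      then show ?thesis by (simp add: ysupp_def content_prod_def)
    qed
    have inner: "((\<lambda>mu. up_ratio (\<alpha> \<zeta>) (M \<zeta>) mu) has_sum (cmod (\<alpha> \<zeta>))\<^sup>2 + real (ysize (M \<zeta>))) (U \<zeta>)"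
      if "\<zeta> \<in> D" for \<zeta>
      using has_sum_finite[OF hook_prod_add_sum(2)[OF yM[OF that]]] up_ratio_sum[OF yM[OF that] nz]
      unfolding U_def by metis
    \<comment> \<open>The sum over \<zeta> splits into Parseval's series, with total I, and the
      finitely many box counts of M, with total m.\<close>
    have "((\<lambda>\<zeta>. real (ysize (M \<zeta>))) has_sum real m) (ysupp M)"
      using finM totM by (intro has_sum_finiteI) auto
    then have "((\<lambda>\<zeta>. real (ysize (M \<zeta>))) has_sum real m) D"
      using suppM by (subst has_sum_cong_neutral[where S = D and T = "ysupp M"]) (auto simp: ysupp_def)
    moreover have "((\<lambda>\<zeta>. (cmod (\<alpha> \<zeta>))\<^sup>2) has_sum I_z \<mu> z) D"
      unfolding \<alpha> I D_def by (rule parseval_central[OF assms(4)]) (use assms(6) in \<open>simp add: central_def\<close>)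
    ultimately have outer: "((\<lambda>\<zeta>. (cmod (\<alpha> \<zeta>))\<^sup>2 + real (ysize (M \<zeta>))) has_sum I_z \<mu> z + real m) D"
      by (rule has_sum_add[rotated])
    have nonneg: "0 \<le> up_ratio (\<alpha> \<zeta>) (M \<zeta>) mu" if "\<zeta> \<in> D" "mu \<in> U \<zeta>" for \<zeta> mu
      using hook_prod_pos[OF yM[OF that(1)]] hook_prod_pos[of mu] that(2) by (simp add: up_ratio_def U_def)
    let ?f = "\<lambda>(\<zeta>, mu). up_ratio (\<alpha> \<zeta>) (M \<zeta>) mu"
    \<comment> \<open>Nonnegativity upgrades finite inner sums and a convergent outer sum to
      unconditional summability over all pairs.\<close>
    have "?f summable_on Sigma D U"
    proof (rule summable_on_SigmaI)
      show "(\<lambda>\<zeta>. (cmod (\<alpha> \<zeta>))\<^sup>2 + real (ysize (M \<zeta>))) summable_on D"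
        using outer by (rule has_sum_imp_summable)
    qed (use inner nonneg in auto)
    then have "(?f has_sum (I_z \<mu> z + real m)) (Sigma D U)"
      by (intro has_sum_SigmaI[OF _ outer]) (use inner in auto)
    then have "((\<lambda>p. c * of_real (?f p)) has_sum c * of_real (I_z \<mu> z + real m)) (Sigma D U)"
      by (intro has_sum_cmult_right has_sum_of_real)
    moreover have "c * of_real (I_z \<mu> z + real m) = phi_z \<mu> z M"
    proof -
      have "I_z \<mu> z + real m \<noteq> 0" using I_pos by linarith
      then have "complex_of_real (I_z \<mu> z + real m) \<noteq> 0" by (simp only: of_real_eq_0_iff not_False_eq_True)
      then show ?thesis unfolding c_def times_divide_eq_left by (rule nonzero_mult_div_cancel_right)
    qed
    ultimately show ?thesis by (simp add: case_prod_unfold)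
  qed
  also have "?this \<longleftrightarrow> (((\<lambda>\<Lambda>. of_nat (dim_class (edge_label M \<Lambda>)) * phi_z \<mu> z \<Lambda>) \<circ> (\<lambda>(\<zeta>, mu). M(\<zeta> := mu)))
      has_sum phi_z \<mu> z M) (Sigma D U)"
    using key by (intro has_sum_cong) (auto simp: U_def edge_label_update)
  finally show "((\<lambda>\<Lambda>. of_nat (dim_class (edge_label M \<Lambda>)) * phi_z \<mu> z \<Lambda>) has_sum phi_z \<mu> z M)
      {\<Lambda> \<in> Yn (unitary_dual G T) n. Yedge (unitary_dual G T) M \<Lambda>}"
    unfolding D_def[symmetric] n up_set_eq[OF M] has_sum_reindex[OF up_map_inj] U_def .
qed

end
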